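(* Let $b\in(0,1]$ and let $(b_N)_{N\ge1}$ be integers with $0\le b_N<N$ and $b_N/N\to b$ as $N\to\infty$. Let $(a_j)_{j\in\mathbb Z}$ be a sequence of independent real random variables with $\mathbb E[a_j]=0$ and $\mathbb E[|a_j|^2]=1$ for all $j\in\mathbb Z$, and $\sup_{j\in\mathbb Z}\mathbb E[|a_j|^k]=C_k<\infty$ for every $k\in\mathbb N$. Let $H_N=P_NT_N$ be the associated real symmetric Hankel band matrix with bandwidth $b_N$, where $T_N=(\eta_{ij}a_{i-j})_{i,j=1}^N$ with $\eta_{ij}=1$ if $|i-j|\le b_N$ and $\eta_{ij}=0$ otherwise, and $P_N=(\delta_{i-1,N-j})_{i,j=1}^N$. Put $$Y_N=\frac{H_N}{\sqrt{(2-b)\,b\,N}}.$$ Then, almost surely, the eigenvalue distribution $\mu_{Y_N}$ converges weakly, as $N\to\infty$, to a (nonrandom) symmetric probability distribution $\gamma_H(b)$ on $\mathbb R$ which is determined by its even moments: for every $k\in\mathbb N$, $$m_{2k}(\gamma_H(b))=\frac{1}{(2-b)^{k}}\sum_{\pi\in\mathcal P_2^1(2k)}\int_{[0,1]\times[-1,1]^k}\prod_{j=1}^{2k}I_{[0,1]}\Big(x_0-b\sum_{i=1}^{j}(-1)^i\,x_{\pi(i)}\Big)\prod_{l=0}^{k}\mathrm dx_l.$$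
   Context: For a real symmetric $N\times N$ matrix $A$ with eigenvalues $\lambda_1,\dots,\lambda_N$, its eigenvalue distribution is the probability measure $\mu_A=\frac1N\sum_{j=1}^N\delta_{\lambda_j}$; if $A$ is random, $\mu_A$ is a random measure. Partitions: $[n]=\{1,\dots,n\}$. A pair partition of $[2k]$ is a partition into blocks of exactly two elements; $\mathcal P_2^1(2k)$ is the set of pair partitions of $[2k]$ each of whose blocks contains exactly one even number and exactly one odd number. The blocks $V_1,\dots,V_k$ of such a $\pi$ are numbered so that their smallest elements satisfy $s_1<s_2<\cdots<s_k$, and $\pi(i)=j$ means $i\in V_j$. $I_B$ denotes the indicator function of a set $B$, $\delta_{i,j}$ (with two indices) is the Kronecker delta, and $m_r(\gamma)=\int x^r\,\gamma(\mathrm dx)$. All random variables $a_j$ are defined on one probability space, and the same sequence $(a_j)$ is used for all $N$. *)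

theory Defs
  imports "HOL-Probability.Probability" "Jordan_Normal_Form.Char_Poly"
begin

text \<open>Matrix entries are 0-based, so the entry with row \<open>i\<close> and column \<open>j\<close> below is the
  entry \<open>(i + 1, j + 1)\<close> in 1-based notation. The subtraction in the reversal matrix never
  truncates, as \<open>j < N\<close>.\<close>

definition toeplitz_band_mat :: "(int \<Rightarrow> real) \<Rightarrow> nat \<Rightarrow> nat \<Rightarrow> real mat" where
  "toeplitz_band_mat a \<beta> N =
     Matrix.mat N N (\<lambda>(i, j). if \<bar>int i - int j\<bar> \<le> int \<beta> then a (int i - int j) else 0)"

definition reversal_mat :: "nat \<Rightarrow> real mat" where
  "reversal_mat N = Matrix.mat N N (\<lambda>(i, j). if i = N - (j + 1) then 1 else 0)"

definition hankel_band_mat :: "(int \<Rightarrow> real) \<Rightarrow> nat \<Rightarrow> nat \<Rightarrow> real mat" where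
  "hankel_band_mat a \<beta> N = reversal_mat N * toeplitz_band_mat a \<beta> N"

text \<open>Eigenvalues are counted with algebraic multiplicity. A real symmetric matrix of dimension
  \<open>N > 0\<close> has exactly \<open>N\<close> real ones, so this is then a probability measure.\<close>

definition eigenvalue_distribution :: "real mat \<Rightarrow> real measure" where
  "eigenvalue_distribution A = measure_of UNIV (sets borel)
     (\<lambda>B. (\<Sum>t\<in>#proots (char_poly A). emeasure (return borel t) B) / of_nat (dim_row A))"

lemma sets_eigenvalue_distribution [simp]: "sets (eigenvalue_distribution A) = sets borel"
  unfolding eigenvalue_distribution_def
  using sets.sigma_sets_eq[of "borel :: real measure"] by simp

lemma emeasure_eigenvalue_distribution:
  assumes "B \<in> sets borel"
  shows "emeasure (eigenvalue_distribution A) B =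
    (\<Sum>t\<in>#proots (char_poly A). emeasure (return borel t) B) / of_nat (dim_row A)"
proof -
  have sums: "(\<lambda>i. \<Sum>x\<in>#M. emeasure (return borel x) (F i)) sums
      (\<Sum>x\<in>#M. emeasure (return borel x) (\<Union>i. F i))"
    if F: "range F \<subseteq> sets (borel :: real measure)" "disjoint_family F" for F M
  proof (induction M)
    case (add x M)
    have "(\<lambda>i. emeasure (return borel x) (F i)) sums emeasure (return borel x) (\<Union>i. F i)"
      using F suminf_emeasure[of F "return borel x"]
      by (metis sets_return summableI summable_sums)
    from sums_add[OF this add] show ?case by simp
  qed simp
  have "countably_additive (sets borel)
    (\<lambda>B. (\<Sum>t\<in>#proots (char_poly A). emeasure (return borel t) B) / of_nat (dim_row A))"
    unfolding countably_additive_def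
    by (metis (no_types, lifting) ennreal_suminf_divide sums sums_unique suminf_cong)
  then show ?thesis
    using assms sets.sigma_algebra_axioms[of "borel :: real measure"]
    unfolding eigenvalue_distribution_def
    by (intro emeasure_measure_of_sigma) (auto simp: positive_def)
qed

definition opposite_parity_pairings :: "nat \<Rightarrow> nat set set set" where
  "opposite_parity_pairings n =
     {P. partition_on {1..n} P \<and>
         (\<forall>V\<in>P. card V = 2 \<and> card {i\<in>V. even i} = 1 \<and> card {i\<in>V. odd i} = 1)}"

text \<open>With the blocks numbered from 1 by increasing smallest element, the number of a block is
  the number of blocks whose smallest element does not exceed its own.\<close>

definition block_index :: "nat set set \<Rightarrow> nat \<Rightarrow> nat" where
  "block_index P i = card {W\<in>P. Min W \<le> Min (THE V. V \<in> P \<and> i \<in> V)}"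

text \<open>Points of \<open>[0,1] \<times> [-1,1]\<^sup>k\<close> are functions on the index set \<open>{0..k}\<close>.\<close>

definition hankel_band_moment :: "real \<Rightarrow> nat \<Rightarrow> real" where
  "hankel_band_moment b k =
     1 / (2 - b) ^ k *
     (\<Sum>P\<in>opposite_parity_pairings (2 * k).
        LINT x : (\<Pi>\<^sub>E l\<in>{0..k}. if l = 0 then {0..1} else {-1..1}) | (\<Pi>\<^sub>M l\<in>{0..k}. lborel).
          (\<Prod>j=1..2 * k.
             indicator {0..1} (x 0 - b * (\<Sum>i=1..j. (-1) ^ i * x (block_index P i)))))"

definition symmetric_distribution :: "real measure \<Rightarrow> bool" where
  "symmetric_distribution \<mu> \<longleftrightarrow> real_distribution \<mu> \<and> distr \<mu> borel uminus = \<mu>"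

definition has_even_moments :: "real measure \<Rightarrow> (nat \<Rightarrow> real) \<Rightarrow> bool" where
  "has_even_moments \<mu> m \<longleftrightarrow>
     (\<forall>k. integrable \<mu> (\<lambda>x. x ^ (2 * k)) \<and> (\<integral>x. x ^ (2 * k) \<partial>\<mu>) = m k)"

end

theory Submission
  imports Defs "Jordan_Normal_Form.Schur_Decomposition"
begin

text \<open>The proof is the method of moments. For a symmetric matrix of dimension \<open>N\<close> the \<open>n\<close>-th moment of the
eigenvalue distribution is the normalised trace of the \<open>n\<close>-th power, so everything rests on the
asymptotics of these traces.

The entry of the Hankel matrix at \<open>(i, l)\<close> is the variable with index \<open>N - 1 - i - l\<close>. A path of indices is
therefore recovered from its first index and from the word \<open>f\<close> of the variables met on the way, and the
trace becomes a sum over words of the number of closed walks that follow the word, times the product of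
the corresponding variables (\<open>trace_hankel_power\<close>). If \<open>n\<close> is odd, closing up determines the start of
the walk. If \<open>n\<close> is even, closing up is a condition on the word alone: the alternating sum of its letters
vanishes.

In expectation only words in which every letter occurs at least twice survive, so a word of length \<open>2k\<close>
has at most \<open>k\<close> free letters. One free letter is lost, and with it a factor \<open>N\<close>, as soon as some letter
occurs three times, or if two equal letters stand at positions of the same parity, in which case the
alternating sum is a nontrivial equation (\<open>card_degenerate_words\<close>). What remains are the words that follow a pairing
into opposite parities; for these the alternating sum vanishes identically, and the walks that stay inside
the matrix are the lattice points of a region whose rescaled volume is the integral in the limiting moment
(\<open>lattice_region_card_limit\<close>).

Almost sure convergence along all \<open>N\<close> needs summable deviations. For odd \<open>n\<close> the second moment of the
trace is already \<open>O(N^-2)\<close>, as each of two words has only one possible start. For even \<open>n\<close> the variance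
is merely \<open>O(1/N)\<close>, and the fourth central moment is used. It involves four words such that every letter
occurs at least twice in total and every word shares a letter with another one, and such a quadruple always
loses two free letters (\<open>four_linked_words\<close>), which gives \<open>O(N^-2)\<close>.

Finally there are at most \<open>k^k\<close> pairings, each contributing at most the volume \<open>2^k\<close>. With this growth
the moments determine the measure through its characteristic function, and convergence of all moments
implies weak convergence (\<open>method_of_moments\<close>). The odd limiting moments vanish, so the limit is symmetric
and already determined by its even moments.\<close>

section \<open>Moments of the eigenvalue distribution of a symmetric matrix\<close>

definition mat_trace :: "'a::comm_monoid_add mat \<Rightarrow> 'a" where
  "mat_trace A = (\<Sum>i<dim_row A. A $$ (i, i))"

lemma mat_trace_mult_commute:
  fixes A B :: "'a::comm_semiring_0 mat"
  assumes "A \<in> carrier_mat n m" "B \<in> carrier_mat m n"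
  shows "mat_trace (A * B) = mat_trace (B * A)"
proof -
  have "mat_trace (A * B) = (\<Sum>i<n. \<Sum>j<m. A $$ (i, j) * B $$ (j, i))"
    using assms by (auto simp: mat_trace_def scalar_prod_def atLeast0LessThan intro!: sum.cong)
  also have "\<dots> = (\<Sum>j<m. \<Sum>i<n. B $$ (j, i) * A $$ (i, j))"
    by (subst sum.swap) (simp add: mult.commute)
  also have "\<dots> = mat_trace (B * A)"
    using assms by (auto simp: mat_trace_def scalar_prod_def atLeast0LessThan intro!: sum.cong)
  finally show ?thesis .
qed

lemma mat_trace_similar:
  fixes A B :: "'a::comm_semiring_1 mat"
  assumes "similar_mat_wit A B P Q"
  shows "mat_trace A = mat_trace B"
proof -
  define n where "n = dim_row A"
  have c: "B \<in> carrier_mat n n" "P \<in> carrier_mat n n" "Q \<in> carrier_mat n n"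
    and QP: "Q * P = 1\<^sub>m n" and A: "A = P * B * Q"
    using similar_mat_witD[OF n_def assms] by auto
  have "mat_trace (P * B * Q) = mat_trace (P * (B * Q))"
    using c by simp
  also have "\<dots> = mat_trace ((B * Q) * P)"
    using c by (intro mat_trace_mult_commute[of _ n n]) auto
  also have "(B * Q) * P = B"
    using c QP by simp
  finally show ?thesis unfolding A .
qed

lemma upper_triangular_power_diag:
  fixes B :: "'a::comm_semiring_1 mat"
  assumes B: "B \<in> carrier_mat n n" and ut: "upper_triangular B"
  shows "upper_triangular (B ^\<^sub>m k) \<and> (\<forall>i<n. (B ^\<^sub>m k) $$ (i, i) = (B $$ (i, i)) ^ k)"
proof (induction k)
  case 0
  then show ?case using B by (auto intro!: upper_triangularI)
next
  case (Suc k)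
  have c: "B ^\<^sub>m k \<in> carrier_mat n n" using B by simp
  have z1: "(B ^\<^sub>m k) $$ (i, j) = 0" if "j < i" "i < n" for i j
    using Suc that c by auto
  have z2: "B $$ (i, j) = 0" if "j < i" "i < n" for i j
    using ut that B by auto
  have entry: "(B ^\<^sub>m Suc k) $$ (i, j) = (\<Sum>l<n. (B ^\<^sub>m k) $$ (i, l) * B $$ (l, j))"
    if "i < n" "j < n" for i j
    using B c that by (auto simp: scalar_prod_def atLeast0LessThan intro!: sum.cong)
  have "(B ^\<^sub>m Suc k) $$ (i, j) = 0" if "j < i" "i < n" for i j
  proof -
    have "(B ^\<^sub>m k) $$ (i, l) * B $$ (l, j) = 0" if "l < n" for l
      using z1[of l i] z2[of j l] that \<open>i < n\<close> \<open>j < i\<close> by (cases "l < i") auto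
    then show ?thesis using entry[of i j] that by simp
  qed
  moreover have "(B ^\<^sub>m Suc k) $$ (i, i) = (B $$ (i, i)) ^ Suc k" if "i < n" for i
  proof -
    have "(B ^\<^sub>m k) $$ (i, l) * B $$ (l, i) = (if l = i then (B ^\<^sub>m k) $$ (i, i) * B $$ (i, i) else 0)"
      if "l < n" for l
      using z1[of l i] z2[of i l] that \<open>i < n\<close> by (cases l i rule: linorder_cases) auto
    then have "(B ^\<^sub>m Suc k) $$ (i, i)
        = (\<Sum>l<n. if l = i then (B ^\<^sub>m k) $$ (i, i) * B $$ (i, i) else 0)"
      unfolding entry[OF that that] by (intro sum.cong) auto
    then show ?thesis using Suc that by (simp add: mult.commute)
  qed
  ultimately show ?case using B c by (auto intro!: upper_triangularI simp del: pow_mat.simps)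
qed

text \<open>For an eigenvector \<open>v\<close> the Hermitian form \<open>\<Sum>i. \<Sum>j. cnj (v i) * A i j * v j\<close> equals \<open>z\<close> times
the squared length of \<open>v\<close>, and symmetry makes it invariant under conjugation.\<close>

lemma eigenvalue_symmetric_real:
  fixes A :: "real mat" and z :: complex
  assumes A: "A \<in> carrier_mat n n"
    and sym: "\<And>i j. i < n \<Longrightarrow> j < n \<Longrightarrow> A $$ (i, j) = A $$ (j, i)"
    and ev: "eigenvalue (map_mat of_real A) z"
  shows "z \<in> \<real>"
proof -
  let ?A = "map_mat complex_of_real A"
  obtain v where v: "v \<in> carrier_vec n" "v \<noteq> 0\<^sub>v n" "?A *\<^sub>v v = z \<cdot>\<^sub>v v"
    using ev A unfolding eigenvalue_def eigenvector_def by auto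
  have Av: "(\<Sum>j<n. of_real (A $$ (i, j)) * v $ j) = z * v $ i" if "i < n" for i
  proof -
    have "(?A *\<^sub>v v) $ i = z * v $ i" using v that by simp
    moreover have "(?A *\<^sub>v v) $ i = (\<Sum>j<n. of_real (A $$ (i, j)) * v $ j)"
      using A v(1) that by (simp add: scalar_prod_def atLeast0LessThan)
    ultimately show ?thesis by simp
  qed
  define S where "S = (\<Sum>i<n. (cmod (v $ i))\<^sup>2)"
  define q where "q = (\<Sum>i<n. \<Sum>j<n. cnj (v $ i) * of_real (A $$ (i, j)) * v $ j)"
  have "q = (\<Sum>i<n. cnj (v $ i) * (z * v $ i))"
    unfolding q_def using Av by (intro sum.cong) (auto simp: sum_distrib_left mult.assoc simp flip: Av)
  also have "\<dots> = z * of_real S"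
    unfolding S_def of_real_sum sum_distrib_left
    by (intro sum.cong) (auto simp: complex_norm_square algebra_simps simp del: of_real_power)
  finally have q: "q = z * of_real S" .
  have "cnj q = (\<Sum>i<n. \<Sum>j<n. cnj (v $ j) * of_real (A $$ (i, j)) * v $ i)"
    unfolding q_def by (simp add: algebra_simps)
  also have "\<dots> = q"
    unfolding q_def by (subst sum.swap) (auto simp: sym intro!: sum.cong)
  finally have "cnj z * of_real S = z * of_real S" using q by simp
  moreover have "S \<noteq> 0"
  proof
    assume "S = 0"
    then have "\<forall>i<n. v $ i = 0" unfolding S_def by (subst (asm) sum_nonneg_eq_0_iff) auto
    then show False using v by (metis carrier_vecD eq_vecI index_zero_vec(1) index_zero_vec(2))
  qed
  ultimately show ?thesis by (simp add: Reals_cnj_iff)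
qed

text \<open>The factorisation over the complex numbers has only real roots and hence descends to the reals. This is
what makes the multiset of real roots complete.\<close>

lemma symmetric_char_poly_splits:
  fixes A :: "real mat"
  assumes A: "A \<in> carrier_mat n n"
    and sym: "\<And>i j. i < n \<Longrightarrow> j < n \<Longrightarrow> A $$ (i, j) = A $$ (j, i)"
  obtains rs where "char_poly A = (\<Prod>r\<leftarrow>rs. [:- r, 1:])" "length rs = n"
proof -
  interpret P: map_poly_inj_idom_hom complex_of_real ..
  have cA: "map_mat complex_of_real A \<in> carrier_mat n n" using A by simp
  obtain es where es: "char_poly (map_mat complex_of_real A) = (\<Prod>e\<leftarrow>es. [:- e, 1:])" "length es = n"
    using char_poly_factorized[OF cA] by auto
  have "\<exists>r. e = complex_of_real r" if "e \<in> set es" for e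
  proof -
    have "poly (char_poly (map_mat complex_of_real A)) e = 0"
      unfolding es(1) poly_prod_list using that
      by (auto simp: prod_list_zero_iff image_iff intro!: bexI[of _ e])
    then show ?thesis
      using eigenvalue_symmetric_real[OF A sym] eigenvalue_root_char_poly[OF cA]
      by (auto elim!: Reals_cases)
  qed
  then have "\<exists>rs. es = map complex_of_real rs"
    by (metis ex_map_conv)
  then obtain rs where rs: "es = map complex_of_real rs" by blast
  have "map_poly complex_of_real (char_poly A) = map_poly complex_of_real (\<Prod>r\<leftarrow>rs. [:- r, 1:])"
    using es(1) unfolding of_real_hom.char_poly_hom[OF A] rs by (simp add: P.hom_prod_list o_def)
  then have "char_poly A = (\<Prod>r\<leftarrow>rs. [:- r, 1:])" by (rule P.injectivity)
  with es(2) rs that show ?thesis by simp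
qed

text \<open>Presenting the measure as the image of the uniform measure on indices turns its integrals into finite
averages.\<close>

lemma eigenvalue_distribution_uniform:
  assumes n: "A \<in> carrier_mat n n" "n > 0"
    and rs: "char_poly A = (\<Prod>r\<leftarrow>rs. [:- r, 1:])" "length rs = n"
  shows "eigenvalue_distribution A = distr (uniform_count_measure {..<n}) borel (\<lambda>i. rs ! i)"
proof (rule measure_eqI)
  fix B assume "B \<in> sets (eigenvalue_distribution A)"
  then have B: "B \<in> sets borel" by simp
  have "proots (\<Prod>r\<leftarrow>xs. [:- r, 1:]) = mset xs" for xs :: "real list"
  proof (induction xs)
    case (Cons a xs)
    have nz: "(\<Prod>r\<leftarrow>xs. [:- r, 1:]) \<noteq> 0" by (auto simp: prod_list_zero_iff)
    show ?case
      using Cons proots_mult[OF _ nz, of "[:- a, 1:]"] by (simp del: mult_pCons_left)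
  qed simp
  then have pr: "proots (char_poly A) = mset rs" using rs by simp
  have "(\<Sum>t\<in>#mset rs. emeasure (return borel t) B) = (\<Sum>t\<leftarrow>rs. indicator B t)"
    using B by (simp add: sum_mset_sum_list flip: mset_map)
  also have "\<dots> = (\<Sum>i<n. indicator B (rs ! i))"
    using rs(2) by (simp add: sum_list_sum_nth atLeast0LessThan)
  also have "\<dots> = of_nat (card {i\<in>{..<n}. rs ! i \<in> B})"
    by (simp add: indicator_def sum.If_cases Int_def flip: of_nat_sum)
  finally have "emeasure (eigenvalue_distribution A) B
     = of_nat (card {i\<in>{..<n}. rs ! i \<in> B}) / of_nat n"
    using emeasure_eigenvalue_distribution[OF B] pr n by simp
  also have "\<dots> = emeasure (uniform_count_measure {..<n}) {i\<in>{..<n}. rs ! i \<in> B}"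
    using n by (subst emeasure_uniform_count_measure)
      (auto simp: divide_ennreal ennreal_of_nat_eq_real_of_nat)
  also have "\<dots> = emeasure (distr (uniform_count_measure {..<n}) borel (\<lambda>i. rs ! i)) B"
    using B by (subst emeasure_distr) (auto simp: space_uniform_count_measure
         intro!: arg_cong[where f="emeasure _"])
  finally show "emeasure (eigenvalue_distribution A) B
    = emeasure (distr (uniform_count_measure {..<n}) borel (\<lambda>i. rs ! i)) B" .
qed simp

text \<open>Since the characteristic polynomial splits over the reals, the matrix is similar to a triangular one,
whose powers have the powers of the eigenvalues on the diagonal.\<close>

lemma eigenvalue_distribution_moments:
  fixes A :: "real mat"
  assumes A: "A \<in> carrier_mat n n" and n: "n > 0"
    and sym: "\<And>i j. i < n \<Longrightarrow> j < n \<Longrightarrow> A $$ (i, j) = A $$ (j, i)"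
  shows "real_distribution (eigenvalue_distribution A)"
    and "integrable (eigenvalue_distribution A) (\<lambda>x. x ^ k)"
    and "(\<integral>x. x ^ k \<partial>eigenvalue_distribution A) = mat_trace (A ^\<^sub>m k) / real n"
proof -
  obtain rs where rs: "char_poly A = (\<Prod>r\<leftarrow>rs. [:- r, 1:])" "length rs = n"
    using symmetric_char_poly_splits[OF A sym] by blast
  note eq = eigenvalue_distribution_uniform[OF A n rs]
  interpret U: prob_space "uniform_count_measure {..<n}"
    using n by (intro prob_space_uniform_count_measure) auto
  have meas [measurable]: "(\<lambda>i. rs ! i) \<in> borel_measurable (uniform_count_measure {..<n})"
    by (simp add: measurable_def)
  interpret E: prob_space "eigenvalue_distribution A"
    unfolding eq by (rule U.prob_space_distr) simp
  show "real_distribution (eigenvalue_distribution A)"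
    by (standard; simp add: sets_eq_imp_space_eq[OF sets_eigenvalue_distribution])
  show "integrable (eigenvalue_distribution A) (\<lambda>x. x ^ k)"
    unfolding eq by (subst integrable_distr_eq)
      (auto simp: uniform_count_measure_def intro!: integrable_point_measure_finite)
  have moment: "(\<integral>x. x ^ k \<partial>eigenvalue_distribution A) = (\<Sum>i<n. (rs ! i) ^ k) / real n"
    unfolding eq by (subst integral_distr) (auto simp: integral_uniform_count_measure)
  obtain B P Q where BPQ: "schur_decomposition A rs = (B, P, Q)"
    by (cases "schur_decomposition A rs") auto
  then have sim: "similar_mat_wit A B P Q" and ut: "upper_triangular B" and diag: "diag_mat B = rs"
    using schur_decomposition[OF A rs(1) BPQ] by auto
  have B: "B \<in> carrier_mat n n" using similar_mat_witD2[OF A sim] by simp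
  have "mat_trace (A ^\<^sub>m k) = mat_trace (B ^\<^sub>m k)"
    using mat_trace_similar[OF similar_mat_wit_pow[OF sim]] .
  also have "\<dots> = (\<Sum>i<n. (rs ! i) ^ k)"
    using upper_triangular_power_diag[OF B ut] B diag
    by (auto simp: mat_trace_def diag_mat_def intro!: sum.cong)
  finally show "(\<integral>x. x ^ k \<partial>eigenvalue_distribution A) = mat_trace (A ^\<^sub>m k) / real n"
    using moment by simp
qed

section \<open>The method of moments\<close>

text \<open>The Taylor polynomial of degree \<open>2k\<close> of a characteristic function at \<open>0\<close> involves only moments, and its error
at \<open>t\<close> is at most \<open>2 * t ^ (2 * k) / fact (2 * k)\<close> times the moment of order \<open>2k\<close>. Under the growth
condition the two characteristic functions therefore agree everywhere.\<close>

lemma moment_determinacy: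
  fixes m :: "nat \<Rightarrow> real"
  assumes \<mu>: "real_distribution \<mu>" "\<And>k. integrable \<mu> (\<lambda>x. x ^ k)" "\<And>k. (\<integral>x. x ^ k \<partial>\<mu>) = m k"
    and \<nu>: "real_distribution \<nu>" "\<And>k. integrable \<nu> (\<lambda>x. x ^ k)" "\<And>k. (\<integral>x. x ^ k \<partial>\<nu>) = m k"
    and growth: "\<And>t. (\<lambda>k. t ^ (2 * k) * m (2 * k) / fact (2 * k)) \<longlonglongrightarrow> 0"
  shows "\<mu> = \<nu>"
proof (rule Levy_uniqueness[OF \<mu>(1) \<nu>(1)], rule ext)
  fix t :: real
  interpret \<mu>: real_distribution \<mu> by (rule \<mu>(1))
  interpret \<nu>: real_distribution \<nu> by (rule \<nu>(1))
  let ?s = "\<lambda>k. \<Sum>j\<le>2 * k. ((\<i> * t) ^ j / fact j) * m j"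
  have bound: "cmod (char \<mu> t - char \<nu> t) \<le> 4 * (t ^ (2 * k) * m (2 * k) / fact (2 * k))" for k
  proof -
    have "cmod (char \<mu> t - ?s k) \<le> (2 * \<bar>t\<bar> ^ (2 * k) / fact (2 * k)) * m (2 * k)"
      using \<mu>.char_approx1[of "2 * k" t] \<mu> by (simp add: power_even_abs)
    moreover have "cmod (char \<nu> t - ?s k) \<le> (2 * \<bar>t\<bar> ^ (2 * k) / fact (2 * k)) * m (2 * k)"
      using \<nu>.char_approx1[of "2 * k" t] \<nu> by (simp add: power_even_abs)
    moreover have "cmod (char \<mu> t - char \<nu> t) \<le> cmod (char \<mu> t - ?s k) + cmod (char \<nu> t - ?s k)"
      using norm_triangle_ineq4[of "char \<mu> t - ?s k" "char \<nu> t - ?s k"] by simp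
    ultimately show ?thesis by (simp add: power_even_abs)
  qed
  have "cmod (char \<mu> t - char \<nu> t) \<le> 4 * 0"
    by (rule LIMSEQ_le_const[OF tendsto_mult[OF tendsto_const growth[of t]]]) (use bound in auto)
  then show "char \<mu> t = char \<nu> t" by simp
qed

lemma clamp_error:
  fixes y c :: real
  assumes "c > 0"
  shows "\<bar>y - max (- c) (min c y)\<bar> \<le> y\<^sup>2 / c"
proof (cases "\<bar>y\<bar> \<le> c")
  case True
  then show ?thesis using assms by (auto simp: max_def min_def abs_if split: if_splits)
next
  case False
  then have "\<bar>y - max (- c) (min c y)\<bar> \<le> \<bar>y\<bar>" using assms by (auto simp: max_def min_def abs_if split: if_splits)
  also have "\<bar>y\<bar> * c \<le> \<bar>y\<bar> * \<bar>y\<bar>" using False by (intro mult_left_mono) auto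
  then have "\<bar>y\<bar> \<le> y\<^sup>2 / c" using assms by (simp add: field_simps power2_eq_square)
  finally show ?thesis .
qed

lemma integrable_power_of_even_moment:
  assumes "prob_space \<nu>" "sets \<nu> = sets borel" "integrable \<nu> (\<lambda>x::real. x ^ (2 * k))"
  shows "integrable \<nu> (\<lambda>x. x ^ k)"
proof -
  interpret prob_space \<nu> by fact
  have [measurable_cong]: "sets \<nu> = sets borel" by fact
  have b: "\<bar>x ^ k\<bar> \<le> 1 + x ^ (2 * k)" for x :: real
  proof -
    have "0 \<le> (1 - \<bar>x ^ k\<bar>)\<^sup>2" by (rule zero_le_power2)
    also have "\<dots> = 1 - 2 * \<bar>x ^ k\<bar> + x ^ (2 * k)"
      by (simp add: power2_diff power_even_eq)
    finally show ?thesis using abs_ge_zero[of "x ^ k"] by linarith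
  qed
  show ?thesis
    by (rule Bochner_Integration.integrable_bound[of _ "\<lambda>x. 1 + x ^ (2 * k)"])
      (use assms b in \<open>auto simp: power_mult intro!: AE_I2\<close>)
qed

text \<open>Powers are unbounded, so weak convergence only applies to truncations of them. Truncating an even power
from above gives its integrability by monotone convergence. Clamping \<open>x ^ k\<close> at level \<open>c\<close> changes the
integral by at most \<open>1 / c\<close> times the moment of order \<open>2k\<close>, and these moments are bounded along the
sequence, so the error is uniform in \<open>n\<close> and disappears as \<open>c\<close> grows.\<close>

lemma weak_limit_moments:
  fixes m :: "nat \<Rightarrow> real"
  assumes \<mu>: "\<And>n. real_distribution (\<mu> n)" "\<And>n k. integrable (\<mu> n) (\<lambda>x. x ^ k)"
    and lim: "\<And>k. (\<lambda>n. \<integral>x. x ^ k \<partial>\<mu> n) \<longlonglongrightarrow> m k"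
    and \<nu>: "real_distribution \<nu>" "weak_conv_m \<mu> \<nu>"
  shows "integrable \<nu> (\<lambda>x. x ^ k)" and "(\<integral>x. x ^ k \<partial>\<nu>) = m k"
proof -
  interpret \<mu>: real_distribution "\<mu> n" for n by (rule \<mu>(1))
  interpret \<nu>: real_distribution \<nu> by (rule \<nu>(1))
  have conv: "(\<lambda>n. integral\<^sup>L (\<mu> n) f) \<longlonglongrightarrow> integral\<^sup>L \<nu> f"
    if "\<And>x. isCont f x" "\<And>x. norm (f x) \<le> B" for f :: "real \<Rightarrow> real" and B
    using weak_conv_imp_integral_bdd_continuous_conv[OF \<mu>(1) \<nu>(1) \<nu>(2) that] .
  have even: "integrable \<nu> (\<lambda>x. x ^ (2 * k))" for k
  proof -
    let ?f = "\<lambda>i x. min (real i) (x ^ (2 * k))"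
    have bd: "norm (?f i x) \<le> real i" for i and x :: real
      by (auto simp: power_mult min_def abs_if)
    have int\<nu>: "integrable \<nu> (?f i)" for i
      by (rule \<nu>.integrable_const_bound[where B="real i"]) (use bd in auto)
    have int\<mu>: "integrable (\<mu> n) (?f i)" for i n
      by (rule \<mu>.integrable_const_bound[where B="real i"]) (use bd in auto)
    have le: "integral\<^sup>L \<nu> (?f i) \<le> m (2 * k)" for i
    proof (rule LIMSEQ_le[OF conv[of "?f i" "real i"] lim])
      show "\<exists>N. \<forall>n\<ge>N. integral\<^sup>L (\<mu> n) (?f i) \<le> (\<integral>x. x ^ (2 * k) \<partial>\<mu> n)"
        using int\<mu> \<mu>(2) by (auto intro!: integral_mono)
    qed (use bd in \<open>auto intro!: continuous_intros\<close>)
    have mono: "mono (\<lambda>i. ?f i x)" for x by (auto simp: mono_def min_def)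
    have "incseq (\<lambda>i. integral\<^sup>L \<nu> (?f i))"
      using int\<nu> by (intro monoI integral_mono) (auto simp: min_def)
    then obtain L where L: "(\<lambda>i. integral\<^sup>L \<nu> (?f i)) \<longlonglongrightarrow> L"
      using incseq_convergent[of "\<lambda>i. integral\<^sup>L \<nu> (?f i)"] le by metis
    have pt: "(\<lambda>i. ?f i x) \<longlonglongrightarrow> x ^ (2 * k)" for x :: real
    proof (rule tendsto_eventually)
      have "eventually (\<lambda>i. real i \<ge> x ^ (2 * k)) sequentially"
        using filterlim_real_sequentially unfolding filterlim_at_top by blast
      then show "eventually (\<lambda>i. ?f i x = x ^ (2 * k)) sequentially"
        by eventually_elim (auto simp: min_def)
    qed
    show ?thesis
      by (rule integrable_monotone_convergence[OF int\<nu> _ _ L]) (use mono pt in auto)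
  qed
  show int: "integrable \<nu> (\<lambda>x. x ^ k)" for k
    by (rule integrable_power_of_even_moment) (use even in \<open>auto simp: \<nu>.prob_space_axioms\<close>)
  let ?S = "(\<integral>x. x ^ (2 * k) \<partial>\<nu>) + m (2 * k)"
  have key: "\<bar>(\<integral>x. x ^ k \<partial>\<nu>) - m k\<bar> \<le> ?S / c" if c: "c > 0" for c
  proof -
    let ?g = "\<lambda>x::real. max (- c) (min c (x ^ k))"
    have bd: "norm (?g x) \<le> c" for x using c by (auto simp: max_def min_def abs_if)
    have err: "\<bar>integral\<^sup>L \<rho> (\<lambda>x. x ^ k) - integral\<^sup>L \<rho> ?g\<bar> \<le> (\<integral>x. x ^ (2 * k) \<partial>\<rho>) / c"
      if "real_distribution \<rho>" "\<And>k. integrable \<rho> (\<lambda>x. x ^ k)" for \<rho>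
    proof -
      interpret \<rho>: real_distribution \<rho> by fact
      have ig: "integrable \<rho> ?g"
        by (rule \<rho>.integrable_const_bound[where B=c]) (use bd in auto)
      have "\<bar>integral\<^sup>L \<rho> (\<lambda>x. x ^ k) - integral\<^sup>L \<rho> ?g\<bar> = \<bar>\<integral>x. x ^ k - ?g x \<partial>\<rho>\<bar>"
        using ig that(2) by simp
      also have "\<dots> \<le> (\<integral>x. \<bar>x ^ k - ?g x\<bar> \<partial>\<rho>)" by (rule integral_abs_bound)
      also have "\<dots> \<le> (\<integral>x. x ^ (2 * k) / c \<partial>\<rho>)"
      proof (rule integral_mono)
        show "\<bar>x ^ k - ?g x\<bar> \<le> x ^ (2 * k) / c" for x
          using clamp_error[OF c, of "x ^ k"] by (simp add: power_even_eq)
      qed (use ig that(2) in auto)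
      finally show ?thesis by simp
    qed
    have "(\<lambda>n. \<bar>(\<integral>x. x ^ k \<partial>\<nu>) - (\<integral>x. x ^ k \<partial>\<mu> n)\<bar>) \<longlonglongrightarrow> \<bar>(\<integral>x. x ^ k \<partial>\<nu>) - m k\<bar>"
      by (intro tendsto_intros lim)
    moreover have "(\<lambda>n. (\<integral>x. x ^ (2 * k) \<partial>\<nu>) / c + \<bar>integral\<^sup>L (\<mu> n) ?g - integral\<^sup>L \<nu> ?g\<bar>
          + (\<integral>x. x ^ (2 * k) \<partial>\<mu> n) / c)
       \<longlonglongrightarrow> (\<integral>x. x ^ (2 * k) \<partial>\<nu>) / c + \<bar>integral\<^sup>L \<nu> ?g - integral\<^sup>L \<nu> ?g\<bar> + m (2 * k) / c"
      using c bd by (intro tendsto_intros lim conv[of ?g c]) (auto intro!: continuous_intros)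
    moreover have "\<bar>(\<integral>x. x ^ k \<partial>\<nu>) - (\<integral>x. x ^ k \<partial>\<mu> n)\<bar> \<le>
        (\<integral>x. x ^ (2 * k) \<partial>\<nu>) / c + \<bar>integral\<^sup>L (\<mu> n) ?g - integral\<^sup>L \<nu> ?g\<bar> + (\<integral>x. x ^ (2 * k) \<partial>\<mu> n) / c" for n
      using err[OF \<nu>(1) int] err[OF \<mu>(1) \<mu>(2), of n] by linarith
    ultimately have "\<bar>(\<integral>x. x ^ k \<partial>\<nu>) - m k\<bar>
        \<le> (\<integral>x. x ^ (2 * k) \<partial>\<nu>) / c + \<bar>integral\<^sup>L \<nu> ?g - integral\<^sup>L \<nu> ?g\<bar> + m (2 * k) / c"
      by (intro LIMSEQ_le) auto
    then show ?thesis by (simp add: add_divide_distrib)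
  qed
  have "(\<lambda>n. ?S / real (Suc n)) \<longlonglongrightarrow> 0"
    using LIMSEQ_Suc[OF lim_const_over_n[of ?S]] .
  then have "\<bar>(\<integral>x. x ^ k \<partial>\<nu>) - m k\<bar> \<le> 0"
    by (rule LIMSEQ_le_const) (use key in \<open>auto simp del: of_nat_Suc\<close>)
  then show "(\<integral>x. x ^ k \<partial>\<nu>) = m k" by simp
qed

lemma tight_of_second_moment:
  fixes \<mu> :: "nat \<Rightarrow> real measure"
  assumes \<mu>: "\<And>n. real_distribution (\<mu> n)" "\<And>n. integrable (\<mu> n) (\<lambda>x. x\<^sup>2)"
    and B: "\<And>n. (\<integral>x. x\<^sup>2 \<partial>\<mu> n) \<le> B"
  shows "tight \<mu>"
  unfolding tight_def
proof (intro conjI allI impI)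
  fix \<epsilon> :: real assume \<epsilon>: "\<epsilon> > 0"
  interpret \<mu>: real_distribution "\<mu> n" for n by (rule \<mu>(1))
  define R where "R = sqrt ((\<bar>B\<bar> + 1) / \<epsilon>)"
  have R: "R > 0" "R\<^sup>2 = (\<bar>B\<bar> + 1) / \<epsilon>" using \<epsilon> unfolding R_def by (auto intro!: divide_pos_pos)
  show "\<exists>a b. a < b \<and> (\<forall>n. 1 - \<epsilon> < measure (\<mu> n) {a<..b})"
  proof (rule exI[of _ "- R"], rule exI[of _ R], intro conjI allI)
    fix n
    have "measure (\<mu> n) {x\<in>space (\<mu> n). R\<^sup>2 \<le> x\<^sup>2} \<le> (\<integral>x. x\<^sup>2 \<partial>\<mu> n) / R\<^sup>2"
      using R(1) \<mu>(2) by (intro integral_Markov_inequality_measure[of _ _ "{}"]) auto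
    also have "\<dots> \<le> B / R\<^sup>2" using B R(1) by (intro divide_right_mono) auto
    also have "\<dots> < \<epsilon>"
    proof -
      have "B < \<epsilon> * R\<^sup>2" using \<epsilon> abs_ge_self[of B] unfolding R(2) by simp
      then show ?thesis using R(1) by (simp add: pos_divide_less_eq)
    qed
    finally have 1: "measure (\<mu> n) {x. R\<^sup>2 \<le> x\<^sup>2} < \<epsilon>" by simp
    have "measure (\<mu> n) (UNIV - {- R<..R}) \<le> measure (\<mu> n) {x. R\<^sup>2 \<le> x\<^sup>2}"
      using R(1) by (intro \<mu>.finite_measure_mono) (auto simp: abs_le_square_iff[symmetric])
    moreover have "measure (\<mu> n) (UNIV - {- R<..R}) = 1 - measure (\<mu> n) {- R<..R}"
      using \<mu>.prob_compl[of "{- R<..R}" n] by simp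
    ultimately show "1 - \<epsilon> < measure (\<mu> n) {- R<..R}" using 1 by linarith
  qed (use R in auto)
qed (use \<mu> in auto)

text \<open>Bounded second moments give tightness. Every subsequential weak limit has the prescribed moments, so by
determinacy there is only one.\<close>

theorem method_of_moments:
  fixes m :: "nat \<Rightarrow> real"
  assumes \<mu>: "\<And>n. real_distribution (\<mu> n)" "\<And>n k. integrable (\<mu> n) (\<lambda>x. x ^ k)"
    and lim: "\<And>k. (\<lambda>n. \<integral>x. x ^ k \<partial>\<mu> n) \<longlonglongrightarrow> m k"
    and growth: "\<And>t. (\<lambda>k. t ^ (2 * k) * m (2 * k) / fact (2 * k)) \<longlonglongrightarrow> 0"
  obtains \<gamma> where "real_distribution \<gamma>" "\<And>k. integrable \<gamma> (\<lambda>x. x ^ k)"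
    "\<And>k. (\<integral>x. x ^ k \<partial>\<gamma>) = m k" "weak_conv_m \<mu> \<gamma>"
proof -
  obtain B where "\<And>n. \<bar>\<integral>x. x\<^sup>2 \<partial>\<mu> n\<bar> \<le> B"
    using convergent_imp_Bseq[OF convergentI[OF lim[of 2]]] unfolding Bseq_def by auto
  then have tight: "tight \<mu>"
    using \<mu> by (intro tight_of_second_moment[of _ B]) (auto intro: order_trans[OF abs_ge_self])
  have sub: "integrable \<nu> (\<lambda>x. x ^ k)" "(\<integral>x. x ^ k \<partial>\<nu>) = m k"
    if "strict_mono s" "real_distribution \<nu>" "weak_conv_m (\<mu> \<circ> s) \<nu>" for s \<nu> k
    using that \<mu> LIMSEQ_subseq_LIMSEQ[OF lim that(1)]
    by (auto intro!: weak_limit_moments[of "\<mu> \<circ> s" m \<nu> k] simp: o_def)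
  obtain r \<gamma> where r: "strict_mono r" "real_distribution \<gamma>" "weak_conv_m (\<mu> \<circ> id \<circ> r) \<gamma>"
    using tight_imp_convergent_subsubsequence[OF tight strict_mono_id] by blast
  then have \<gamma>: "integrable \<gamma> (\<lambda>x. x ^ k)" "(\<integral>x. x ^ k \<partial>\<gamma>) = m k" for k
    using sub[of r \<gamma>] by auto
  have "weak_conv_m \<mu> \<gamma>"
  proof (rule tight_subseq_weak_converge[OF \<mu>(1) r(2) tight])
    fix s \<nu> assume s: "strict_mono s" "real_distribution \<nu>" "weak_conv_m (\<mu> \<circ> s) \<nu>"
    have "\<nu> = \<gamma>"
      by (rule moment_determinacy[of _ m]) (use s sub[OF s] r(2) \<gamma> growth in auto)
    with s show "weak_conv_m (\<mu> \<circ> s) \<gamma>" by simp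
  qed
  with r(2) \<gamma> that show ?thesis by blast
qed

lemma distr_uminus_moment:
  fixes \<mu> :: "real measure"
  assumes "real_distribution \<mu>" "integrable \<mu> (\<lambda>x. x ^ k)"
  shows "real_distribution (distr \<mu> borel uminus)"
    and "integrable (distr \<mu> borel uminus) (\<lambda>x. x ^ k)"
    and "(\<integral>x. x ^ k \<partial>distr \<mu> borel uminus) = (-1) ^ k * (\<integral>x. x ^ k \<partial>\<mu>)"
proof -
  interpret real_distribution \<mu> by fact
  show "real_distribution (distr \<mu> borel uminus)" by simp
  have eq: "(\<lambda>x::real. (- x) ^ k) = (\<lambda>x. (-1) ^ k * x ^ k)"
    by (rule ext) (rule power_minus)
  show "integrable (distr \<mu> borel uminus) (\<lambda>x. x ^ k)"
    using integrable_mult_right[OF assms(2), of "(-1) ^ k"]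
    by (subst integrable_distr_eq) (simp_all only: eq, measurable)
  show "(\<integral>x. x ^ k \<partial>distr \<mu> borel uminus) = (-1) ^ k * (\<integral>x. x ^ k \<partial>\<mu>)"
    by (subst integral_distr) (simp_all only: eq integral_mult_right_zero, measurable)
qed

section \<open>Counting words by their free letters\<close>

text \<open>Words are classified by the pattern of coincidences among their letters. The number of patterns depends
only on the number of positions, whereas the alphabet grows with the matrix.\<close>

definition same_kernel :: "'p set \<Rightarrow> ('p \<Rightarrow> 'a) \<Rightarrow> ('p \<Rightarrow> 'b) \<Rightarrow> bool" where
  "same_kernel P f g \<longleftrightarrow> (\<forall>p\<in>P. \<forall>q\<in>P. f p = f q \<longleftrightarrow> g p = g q)"

definition determines :: "'p set \<Rightarrow> ('s \<Rightarrow> 'p \<Rightarrow> 'a) \<Rightarrow> 's set \<Rightarrow> 'p set \<Rightarrow> 's \<Rightarrow> bool" where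
  "determines P L S D s \<longleftrightarrow>
     (\<forall>s'\<in>S. same_kernel P (L s) (L s') \<longrightarrow> (\<forall>p\<in>D. L s' p = L s p) \<longrightarrow> s' = s)"

text \<open>The kernel of \<open>L s\<close>, the set \<open>D\<close> and the letters on \<open>D\<close> encode \<open>s\<close>. Only the last component depends
on the size of the alphabet, which enters with the exponent \<open>d\<close>.\<close>

lemma card_determined_le:
  fixes L :: "'s \<Rightarrow> 'p \<Rightarrow> 'a"
  assumes P: "finite P" and A: "finite A" "A \<noteq> {}"
    and L: "\<And>s p. s \<in> S \<Longrightarrow> p \<in> P \<Longrightarrow> L s p \<in> A"
    and det: "\<And>s. s \<in> S \<Longrightarrow> \<exists>D\<subseteq>P. card D \<le> d \<and> determines P L S D s"
  shows "finite S" and "card S \<le> 2 ^ (card P * card P) * 2 ^ card P * card A ^ d"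
proof -
  define ker where "ker s = {(p, q). p \<in> P \<and> q \<in> P \<and> L s p = L s q}" for s
  have "\<forall>s\<in>S. \<exists>D. D \<subseteq> P \<and> card D \<le> d \<and> determines P L S D s" using det by blast
  then have "\<exists>D. \<forall>s\<in>S. D s \<subseteq> P \<and> card (D s) \<le> d \<and> determines P L S (D s) s"
    by (rule bchoice)
  then obtain D where D: "\<forall>s\<in>S. D s \<subseteq> P \<and> card (D s) \<le> d \<and> determines P L S (D s) s" ..
  define code where "code s = (ker s, D s, restrict (L s) (D s))" for s
  let ?Ds = "{D \<in> Pow P. card D \<le> d}"
  let ?C = "Pow (P \<times> P) \<times> (SIGMA D:?Ds. D \<rightarrow>\<^sub>E A)"
  have inj: "inj_on code S"
  proof (rule inj_onI)
    fix s s' assume s: "s \<in> S" "s' \<in> S" "code s = code s'"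
    then have k: "ker s = ker s'" and "D s = D s'" and "restrict (L s) (D s) = restrict (L s') (D s)"
      by (auto simp: code_def)
    have "same_kernel P (L s) (L s')"
      unfolding same_kernel_def
    proof (intro ballI)
      fix p q assume "p \<in> P" "q \<in> P"
      then have "((p, q) \<in> ker s) = (L s p = L s q)" "((p, q) \<in> ker s') = (L s' p = L s' q)"
        by (auto simp: ker_def)
      with k show "L s p = L s q \<longleftrightarrow> L s' p = L s' q" by simp
    qed
    moreover have "\<forall>p\<in>D s. L s' p = L s p"
      using \<open>restrict (L s) (D s) = restrict (L s') (D s)\<close> by (metis restrict_apply')
    ultimately show "s = s'" using D s(1,2) unfolding determines_def by blast
  qed
  have sub: "code ` S \<subseteq> ?C"
    using D L by (auto simp: code_def ker_def; blast)
  have fin: "finite ?C"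
    using P A by (intro finite_cartesian_product finite_SigmaI finite_PiE) (auto intro: finite_subset)
  show "finite S" using finite_imageD[OF finite_subset[OF sub fin] inj] .
  have "card S = card (code ` S)" using card_image[OF inj] by simp
  also have "\<dots> \<le> card ?C" by (rule card_mono[OF fin sub])
  also have "\<dots> = 2 ^ (card P * card P) * (\<Sum>D\<in>?Ds. card A ^ card D)"
    using P A by (subst card_cartesian_product, subst card_SigmaI)
      (auto simp: card_Pow card_PiE finite_subset[OF _ P] intro!: finite_PiE sum.cong)
  also have "(\<Sum>D\<in>?Ds. card A ^ card D) \<le> (\<Sum>D\<in>Pow P. card A ^ d)"
    using A P by (intro sum_le_included[where i="\<lambda>x. x"]) (auto intro!: power_increasing simp: card_gt_0_iff Suc_le_eq)
  also have "\<dots> = 2 ^ card P * card A ^ d" using P by (simp add: card_Pow)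
  finally show "card S \<le> 2 ^ (card P * card P) * 2 ^ card P * card A ^ d"
    by (simp add: mult.assoc)
qed

text \<open>The set \<open>X\<close> consists of the letters that are not recorded and have to be found from linear equations.\<close>

definition recovers :: "'p set \<Rightarrow> 'p set \<Rightarrow> ('p \<Rightarrow> 'a) \<Rightarrow> 'a set \<Rightarrow> bool" where
  "recovers P D f X \<longleftrightarrow> (\<forall>g. same_kernel P f g \<longrightarrow> (\<forall>p\<in>D. g p = f p) \<longrightarrow>
     (\<forall>p\<in>P. f p \<notin> X \<longrightarrow> g p = f p))"

lemma recoversD:
  "recovers P D f X \<Longrightarrow> same_kernel P f g \<Longrightarrow> (\<forall>p\<in>D. g p = f p) \<Longrightarrow> p \<in> P \<Longrightarrow> f p \<notin> X \<Longrightarrow> g p = f p"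
  unfolding recovers_def by blast

text \<open>One position is chosen for every letter outside \<open>X\<close>.\<close>

lemma class_representatives:
  assumes "finite P" "X \<subseteq> f ` P"
  shows "\<exists>D\<subseteq>P. card D = card (f ` P) - card X \<and> recovers P D f X"
proof -
  have "\<forall>l\<in>f ` P. \<exists>p\<in>P. f p = l" by auto
  then obtain rep where rep: "\<And>l. l \<in> f ` P \<Longrightarrow> rep l \<in> P \<and> f (rep l) = l" by metis
  let ?D = "rep ` (f ` P - X)"
  have "inj_on rep (f ` P - X)" by (rule inj_on_inverseI[where g=f]) (use rep in auto)
  then have "card ?D = card (f ` P) - card X"
    using assms by (simp add: card_image card_Diff_subset finite_subset)
  moreover have "?D \<subseteq> P" using rep by auto
  moreover have "recovers P ?D f X"
    unfolding recovers_def
  proof (intro allI impI ballI)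
    fix g p assume that: "same_kernel P f g" "\<forall>p\<in>?D. g p = f p" "p \<in> P" "f p \<notin> X"
    have "rep (f p) \<in> ?D" "rep (f p) \<in> P" "f (rep (f p)) = f p" using rep that by auto
    then show "g p = f p" using that unfolding same_kernel_def by metis
  qed
  ultimately show ?thesis by blast
qed

text \<open>Two solutions with the same kernel that agree off the class of the letter \<open>l\<close> differ by a constant on
this class. Subtracting the two equations shows that the constant times the sum of the coefficients over
the class is zero.\<close>

lemma linear_equation_determines:
  fixes f g :: "'p \<Rightarrow> int"
  assumes T: "finite T" and ker: "same_kernel T f g"
    and agree: "\<And>p. p \<in> T \<Longrightarrow> f p \<noteq> l \<Longrightarrow> g p = f p"
    and eq: "(\<Sum>p\<in>T. \<sigma> p * f p) = (\<Sum>p\<in>T. \<sigma> p * g p)"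
    and nz: "(\<Sum>p | p \<in> T \<and> f p = l. \<sigma> p) \<noteq> 0"
    and p: "p \<in> T"
  shows "g p = f p"
proof (cases "f p = l")
  case True
  have "0 = (\<Sum>q\<in>T. \<sigma> q * (g q - f q))"
    using eq by (simp add: right_diff_distrib sum_subtractf)
  also have "\<dots> = (\<Sum>q | q \<in> T \<and> f q = l. \<sigma> q * (g q - f q))"
    using T agree by (intro sum.mono_neutral_right) auto
  also have "\<dots> = (\<Sum>q | q \<in> T \<and> f q = l. \<sigma> q * (g p - l))"
  proof (intro sum.cong refl)
    fix q assume "q \<in> {q \<in> T. f q = l}"
    then show "\<sigma> q * (g q - f q) = \<sigma> q * (g p - l)" using ker p True unfolding same_kernel_def by (metis (mono_tags) mem_Collect_eq)
  qed
  also have "\<dots> = (\<Sum>q | q \<in> T \<and> f q = l. \<sigma> q) * (g p - l)"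
    by (simp add: sum_distrib_right)
  finally show ?thesis using nz True by simp
qed (use agree p in auto)

lemma sum_remove_two:
  fixes c :: "nat \<Rightarrow> nat"
  assumes "finite I" "r \<in> I" "s \<in> I" "r \<noteq> s"
  shows "c r + c s + (\<Sum>i\<in>I - {r, s}. c i) = (\<Sum>i\<in>I. c i)"
proof -
  have "(\<Sum>i\<in>I. c i) = c r + (\<Sum>i\<in>I - {r}. c i)" using assms by (simp add: sum.remove)
  also have "(\<Sum>i\<in>I - {r}. c i) = c s + (\<Sum>i\<in>I - {r} - {s}. c i)" using assms by (simp add: sum.remove)
  also have "I - {r} - {s} = I - {r, s}" by auto
  finally show ?thesis by simp
qed

text \<open>Here \<open>c l r\<close> stands for the multiplicity of the letter \<open>l\<close> in the word \<open>r\<close>. Four words of length \<open>n\<close> in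
which all letters occur at least twice have at most \<open>2n\<close> letters, and the conclusion lists the ways of
losing two of them. A letter occurring exactly once in a closed word is determined by the other letters of
this word. In the last alternative this happens in two words: the equation of \<open>u\<close> does not involve \<open>l'\<close>, so
it yields \<open>l\<close>, and then the equation of \<open>v\<close> yields \<open>l'\<close>.

With \<open>2n - 1\<close> letters the multiplicities exceed \<open>2\<close> by a total of \<open>2\<close>. If no letter occurred exactly once
in a word, a letter linking two words would have multiplicity at least \<open>4\<close>, use up the whole excess, and
leave the other two words without a link. With \<open>2n\<close> letters all multiplicities are \<open>2\<close>, and the shared
letters are the edges of a graph on four vertices without isolated vertices, in which two suitable edges
always exist.\<close>

lemma four_linked_words:
  fixes c :: "'a \<Rightarrow> nat \<Rightarrow> nat"
  assumes fin: "finite \<Lambda>" and two: "\<And>l. l \<in> \<Lambda> \<Longrightarrow> 2 \<le> (\<Sum>r<4. c l r)"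
    and total: "(\<Sum>l\<in>\<Lambda>. \<Sum>r<4. c l r) = 4 * n"
    and link: "\<And>r. r < 4 \<Longrightarrow> \<exists>l\<in>\<Lambda>. c l r \<ge> 1 \<and> (\<exists>r'<4. r' \<noteq> r \<and> c l r' \<ge> 1)"
  shows "card \<Lambda> + 2 \<le> 2 * n
    \<or> card \<Lambda> + 1 \<le> 2 * n \<and> (\<exists>l\<in>\<Lambda>. \<exists>r<4. c l r = 1)
    \<or> card \<Lambda> \<le> 2 * n \<and> (\<exists>l\<in>\<Lambda>. \<exists>l'\<in>\<Lambda>. \<exists>u<4. \<exists>v<4. u \<noteq> v \<and> c l u = 1 \<and> c l' v = 1 \<and> c l' u = 0)"
proof -
  define tot where "tot l = (\<Sum>r<4. c l r)" for l
  have tot2: "tot l \<ge> 2" if "l \<in> \<Lambda>" for l using two that by (simp add: tot_def)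
  have T: "(\<Sum>l\<in>\<Lambda>. tot l) = 4 * n" using total by (simp add: tot_def)
  have le: "2 * card B \<le> (\<Sum>l\<in>B. tot l)" if "B \<subseteq> \<Lambda>" for B
    using sum_mono[of B "\<lambda>_. 2" tot] tot2 that by (auto simp: mult.commute)
  have totpair: "c l r + c l s + (\<Sum>i\<in>{..<4} - {r, s}. c l i) = tot l"
    if "r < 4" "s < 4" "r \<noteq> s" for l r s
    unfolding tot_def using that by (intro sum_remove_two) auto
  have third: "\<exists>y<4. y \<noteq> r \<and> y \<noteq> s" for r s :: nat
  proof -
    have "card ({..<4} - {r, s}) \<ge> 2"
      using diff_card_le_card_Diff[of "{r, s}" "{..<4::nat}"] card_insert_le_m1[of 2 "{s}" r] by auto
    then have "{..<4} - {r, s} \<noteq> {}" by force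
    then show ?thesis by auto
  qed
  consider "card \<Lambda> + 2 \<le> 2 * n" | "card \<Lambda> + 1 = 2 * n" | "card \<Lambda> = 2 * n"
    using le[of \<Lambda>] T by fastforce
  then show ?thesis
  proof cases
    case 2
    have "\<exists>l\<in>\<Lambda>. \<exists>r<4. c l r = 1"
    proof (rule ccontr)
      assume no: "\<not> (\<exists>l\<in>\<Lambda>. \<exists>r<4. c l r = 1)"
      have big: "\<exists>l\<in>\<Lambda>. \<exists>r'<4. r' \<noteq> r \<and> c l r \<ge> 2 \<and> c l r' \<ge> 2" if "r < 4" for r
        using link[OF that] no that by (metis One_nat_def Suc_1 Suc_leI le_neq_implies_less)
      from big[of 0] obtain l r' where l: "l \<in> \<Lambda>" "r' < 4" "r' \<noteq> 0" "c l 0 \<ge> 2" "c l r' \<ge> 2" by auto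
      obtain y where y: "y < 4" "y \<noteq> 0" "y \<noteq> r'" using third by blast
      from big[OF y(1)] obtain l' y' where l': "l' \<in> \<Lambda>" "y' < 4" "y' \<noteq> y" "c l' y \<ge> 2" "c l' y' \<ge> 2" by auto
      have t: "tot l \<ge> 4" using totpair[OF _ l(2) not_sym[OF l(3)], of l] l by simp
      have t': "tot l' \<ge> 4" using totpair[OF y(1) l'(2) not_sym[OF l'(3)], of l'] l' by simp
      have ll: "(\<Sum>i\<in>\<Lambda>. tot i) = tot l + (\<Sum>i\<in>\<Lambda> - {l}. tot i)" using fin l by (simp add: sum.remove)
      have cl: "card (\<Lambda> - {l}) = card \<Lambda> - 1" "card \<Lambda> \<ge> 1" using fin l by (auto simp: Suc_le_eq card_gt_0_iff)
      show False
      proof (cases "l = l'")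
        case True
        have "c l y \<le> (\<Sum>i\<in>{..<4} - {0, r'}. c l i)" using y by (intro member_le_sum) auto
        then have "tot l \<ge> 6" using totpair[of 0 r' l] l y l' True by simp
        then show False using ll cl le[of "\<Lambda> - {l}"] T 2 by auto
      next
        case False
        have "(\<Sum>i\<in>\<Lambda> - {l}. tot i) = tot l' + (\<Sum>i\<in>\<Lambda> - {l} - {l'}. tot i)"
          using fin l' False by (intro sum.remove) auto
        moreover have "card (\<Lambda> - {l} - {l'}) = card \<Lambda> - 2" "card \<Lambda> \<ge> 2"
          using fin l l' False card_mono[OF fin, of "{l, l'}"] by auto
        moreover have "2 * card (\<Lambda> - {l} - {l'}) \<le> (\<Sum>i\<in>\<Lambda> - {l} - {l'}. tot i)" by (rule le) auto
        ultimately show False using ll t t' T 2 by linarith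
      qed
    qed
    with 2 show ?thesis by auto
  next
    case 3
    have all2: "tot l = 2" if "l \<in> \<Lambda>" for l
    proof -
      have "(\<Sum>i\<in>\<Lambda>. tot i) = tot l + (\<Sum>i\<in>\<Lambda> - {l}. tot i)" using fin that by (simp add: sum.remove)
      moreover have "card (\<Lambda> - {l}) = card \<Lambda> - 1" "card \<Lambda> \<ge> 1" using fin that by (auto simp: Suc_le_eq card_gt_0_iff)
      ultimately show ?thesis using le[of "\<Lambda> - {l}"] T 3 tot2[OF that] by auto
    qed
    have edge: "\<exists>l\<in>\<Lambda>. \<exists>r'<4. r' \<noteq> r \<and> c l r = 1 \<and> c l r' = 1 \<and> (\<forall>s<4. s \<noteq> r \<longrightarrow> s \<noteq> r' \<longrightarrow> c l s = 0)"
      if r: "r < 4" for r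
    proof -
      from link[OF r] obtain l r' where l: "l \<in> \<Lambda>" "c l r \<ge> 1" "r' < 4" "r' \<noteq> r" "c l r' \<ge> 1" by auto
      have e: "c l r + c l r' + (\<Sum>i\<in>{..<4} - {r, r'}. c l i) = 2"
        using totpair[of r r' l] r l all2 by auto
      then have "(\<Sum>i\<in>{..<4} - {r, r'}. c l i) = 0" using l by linarith
      then have "\<forall>s<4. s \<noteq> r \<longrightarrow> s \<noteq> r' \<longrightarrow> c l s = 0" by auto
      then show ?thesis using l e by (intro bexI[of _ l] exI[of _ r']) auto
    qed
    obtain l x where l: "l \<in> \<Lambda>" "x < 4" "x \<noteq> 0" "c l 0 = 1" "c l x = 1" using edge[of 0] by auto
    obtain y where y: "y < 4" "y \<noteq> 0" "y \<noteq> x" using third by blast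
    obtain l' z where l': "l' \<in> \<Lambda>" "z < 4" "z \<noteq> y" "c l' y = 1" "\<forall>s<4. s \<noteq> y \<longrightarrow> s \<noteq> z \<longrightarrow> c l' s = 0"
      using edge[OF y(1)] by auto
    \<comment> \<open>The edge \<open>l'\<close> contains \<open>y\<close>, hence misses one end of the edge \<open>l\<close> between \<open>0\<close> and \<open>x\<close>.\<close>
    have "\<exists>u<4. u \<noteq> y \<and> c l u = 1 \<and> c l' u = 0"
    proof (cases "z = 0")
      case True
      then show ?thesis using l l' y by (intro exI[of _ x]) auto
    next
      case False
      then show ?thesis using l l' y by (intro exI[of _ 0]) auto
    qed
    then have "\<exists>l\<in>\<Lambda>. \<exists>l'\<in>\<Lambda>. \<exists>u<4. \<exists>v<4. u \<noteq> v \<and> c l u = 1 \<and> c l' v = 1 \<and> c l' u = 0"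
      using l(1) l'(1,4) y(1) by blast
    with 3 show ?thesis by simp
  qed blast
qed

definition closed_words :: "nat \<Rightarrow> int set \<Rightarrow> (nat \<Rightarrow> int) set" where
  "closed_words n A = {f \<in> {1..n} \<rightarrow>\<^sub>E A. (\<Sum>t=1..n. (-1) ^ t * f t) = 0}"

lemma alternating_sum_single:
  assumes "card {t \<in> {1..n}. f t = l} = 1"
  shows "(\<Sum>t | t \<in> {1..n} \<and> f t = l. (-1 :: int) ^ t) \<noteq> 0"
proof -
  obtain t where "{t \<in> {1..n}. f t = l} = {t}" using assms by (auto simp: card_1_singleton_iff)
  then show ?thesis by simp
qed

lemma sum_multiplicities:
  assumes "finite P"
  shows "(\<Sum>l\<in>f ` P. card {p \<in> P. f p = l}) = card P"
  using sum.image_gen[OF assms, of "\<lambda>_. 1::nat" f] by simp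

definition multiplicity_ge_two :: "'p set \<Rightarrow> ('p \<Rightarrow> 'a) \<Rightarrow> bool" where
  "multiplicity_ge_two P f \<longleftrightarrow> (\<forall>p\<in>P. card {q \<in> P. f q = f p} \<ge> 2)"

lemma multiplicity_ge_two_card:
  assumes "finite P" "multiplicity_ge_two P f"
  shows "2 * card (f ` P) \<le> card P"
proof -
  have "(\<Sum>l\<in>f ` P. 2) \<le> (\<Sum>l\<in>f ` P. card {p \<in> P. f p = l})"
    using assms(2) by (intro sum_mono) (auto simp: multiplicity_ge_two_def)
  then show ?thesis using sum_multiplicities[OF assms(1), of f] by simp
qed

text \<open>Letters that occur at least twice number at most half the positions.\<close>

lemma card_paired_words:
  assumes A: "finite A" "A \<noteq> {}"
  shows "card {h \<in> {..<R} \<rightarrow>\<^sub>E ({1..n} \<rightarrow>\<^sub>E A).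
      multiplicity_ge_two ({..<R} \<times> {1..n}) (case_prod h)}
    \<le> 2 ^ ((R * n) * (R * n)) * 2 ^ (R * n) * card A ^ (R * n div 2)"
proof -
  let ?P = "{..<R} \<times> {1..n}"
  let ?S = "{h \<in> {..<R} \<rightarrow>\<^sub>E ({1..n} \<rightarrow>\<^sub>E A). multiplicity_ge_two ?P (case_prod h)}"
  have cP: "card ?P = R * n" by simp
  have "card ?S \<le> 2 ^ (card ?P * card ?P) * 2 ^ card ?P * card A ^ (R * n div 2)"
  proof (rule card_determined_le(2)[where L="case_prod"])
    show "case_prod h p \<in> A" if "h \<in> ?S" "p \<in> ?P" for h p
      using that by (auto simp: PiE_iff)
    fix h assume h: "h \<in> ?S"
    let ?f = "case_prod h"
    obtain D where D: "D \<subseteq> ?P" "card D = card (?f ` ?P) - card ({} :: int set)" and rec: "recovers ?P D ?f {}"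
        using class_representatives[of ?P "{}" "?f"] by auto
    have "2 * card (?f ` ?P) \<le> R * n"
      using multiplicity_ge_two_card[of ?P ?f] h by auto
    then have "card D \<le> R * n div 2" using D(2) by simp
    moreover have "h' = h" if h': "h' \<in> ?S"
      and ker: "same_kernel ?P ?f (case_prod h')"
      and ag: "\<forall>p\<in>D. case_prod h' p = ?f p" for h'
    proof -
      have "h' r t = h r t" if "r < R" "t \<in> {1..n}" for r t
        using recoversD[OF rec ker ag, of "(r, t)"] that by simp
      then have "h' r = h r" if "r < R" for r
        using h h' that by (intro PiE_ext[of "h' r" "{1..n}" "\<lambda>_. A"]) (auto simp: PiE_iff)
      then show ?thesis using h h' by (intro PiE_ext[of h' "{..<R}" "\<lambda>_. {1..n} \<rightarrow>\<^sub>E A"]) auto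
    qed
    ultimately show "\<exists>D\<subseteq>?P. card D \<le> R * n div 2 \<and> determines ?P case_prod ?S D h"
      using D(1) unfolding determines_def by (intro exI[of _ D]) blast
  qed (use A in auto)
  then show ?thesis unfolding cP .
qed

definition linked :: "nat \<Rightarrow> nat \<Rightarrow> (nat \<Rightarrow> nat \<Rightarrow> 'a) \<Rightarrow> bool" where
  "linked R n h \<longleftrightarrow> (\<forall>r<R. \<exists>r'<R. r' \<noteq> r \<and> h r ` {1..n} \<inter> h r' ` {1..n} \<noteq> {})"

text \<open>The exponent \<open>2 * n\<close>, half the number of positions, is what the multiplicities alone would give. The
closure equations and the links between the words lower it by \<open>2\<close>.\<close>

lemma card_linked_words:
  assumes A: "finite A" "A \<noteq> {}"
  shows "card {h \<in> {..<4} \<rightarrow>\<^sub>E closed_words n A.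
      multiplicity_ge_two ({..<4::nat} \<times> {1..n}) (case_prod h) \<and> linked 4 n h}
    \<le> 2 ^ ((4 * n) * (4 * n)) * 2 ^ (4 * n) * card A ^ (2 * n - 2)"
proof -
  let ?P = "{..<4::nat} \<times> {1..n}"
  let ?S = "{h \<in> {..<4} \<rightarrow>\<^sub>E closed_words n A. multiplicity_ge_two ?P (case_prod h) \<and> linked 4 n h}"
  have cP: "card ?P = 4 * n" by simp
  have "card ?S \<le> 2 ^ (card ?P * card ?P) * 2 ^ card ?P * card A ^ (2 * n - 2)"
  proof (rule card_determined_le(2)[where L="case_prod"])
    show "case_prod h p \<in> A" if "h \<in> ?S" "p \<in> ?P" for h p
      using that by (auto simp: PiE_iff closed_words_def)
    fix h assume h: "h \<in> ?S"
    let ?f = "case_prod h"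
    define c where "c l r = card {t \<in> {1..n}. h r t = l}" for l r
    have csum: "(\<Sum>r<4. c l r) = card {p \<in> ?P. ?f p = l}" for l
    proof -
      have "{p \<in> ?P. ?f p = l} = (SIGMA r:{..<4}. {t \<in> {1..n}. h r t = l})" by auto
      then show ?thesis by (simp add: c_def)
    qed
    have cases: "card (?f ` ?P) + 2 \<le> 2 * n
      \<or> card (?f ` ?P) + 1 \<le> 2 * n \<and> (\<exists>l\<in>?f ` ?P. \<exists>r<4. c l r = 1)
      \<or> card (?f ` ?P) \<le> 2 * n \<and> (\<exists>l\<in>?f ` ?P. \<exists>l'\<in>?f ` ?P. \<exists>u<4. \<exists>v<4. u \<noteq> v \<and> c l u = 1 \<and> c l' v = 1 \<and> c l' u = 0)"
    proof (rule four_linked_words)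
      show "2 \<le> (\<Sum>r<4. c l r)" if "l \<in> ?f ` ?P" for l
        unfolding csum using h that by (auto simp: multiplicity_ge_two_def)
      show "(\<Sum>l\<in>?f ` ?P. \<Sum>r<4. c l r) = 4 * n"
        unfolding csum by (subst sum_multiplicities) auto
      fix r :: nat assume r: "r < 4"
      have "linked 4 n h" using h by simp
      then obtain r' where r': "r' < 4" "r' \<noteq> r" "h r ` {1..n} \<inter> h r' ` {1..n} \<noteq> {}"
        using r unfolding linked_def by blast
      then obtain t t' where rt: "t \<in> {1..n}" "t' \<in> {1..n}" "h r t = h r' t'" by force
      have "c (h r t) r \<ge> 1" "c (h r t) r' \<ge> 1"
        using r' rt by (auto simp: c_def Suc_le_eq card_gt_0_iff)
      then show "\<exists>l\<in>?f ` ?P. c l r \<ge> 1 \<and> (\<exists>r'<4. r' \<noteq> r \<and> c l r' \<ge> 1)"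
        using r' rt r by (intro bexI[of _ "h r t"]) (auto intro!: image_eqI[of _ _ "(r, t)"])
    qed auto
    have closed: "(\<Sum>t=1..n. (-1) ^ t * h' r t) = 0" if "h' \<in> ?S" "r < 4" for h' r
      using that by (auto simp: closed_words_def PiE_iff)
    have ext: "h' = h" if h': "h' \<in> ?S" and eq: "\<And>r t. r < 4 \<Longrightarrow> t \<in> {1..n} \<Longrightarrow> h' r t = h r t" for h'
    proof -
      have "h' r = h r" if "r < 4" for r
        using h h' eq that by (intro PiE_ext[of "h' r" "{1..n}" "\<lambda>_. A"]) (auto simp: PiE_iff closed_words_def)
      then show ?thesis using h h' by (intro PiE_ext[of h' "{..<4}" "\<lambda>_. closed_words n A"]) auto
    qed
    \<comment> \<open>The equation of word \<open>u\<close> recovers a letter occurring once in it, given all its other letters.\<close>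
    have recover: "h' u t = h u t" if h': "h' \<in> ?S"
      and ker: "same_kernel ?P ?f (case_prod h')"
      and u: "u < 4" "c l u = 1" and oth: "\<And>t. t \<in> {1..n} \<Longrightarrow> h u t \<noteq> l \<Longrightarrow> h' u t = h u t"
      and t: "t \<in> {1..n}" for h' u l t
    proof (rule linear_equation_determines[where T="{1..n}" and \<sigma>="\<lambda>t. (-1) ^ t" and l=l])
      show "same_kernel {1..n} (h u) (h' u)"
        using ker u by (auto simp: same_kernel_def)
      show "(\<Sum>t=1..n. (-1) ^ t * h u t) = (\<Sum>t=1..n. (-1) ^ t * h' u t)"
        using closed[OF h u(1)] closed[OF h' u(1)] by simp
      show "(\<Sum>p | p \<in> {1..n} \<and> h u p = l. (-1 :: int) ^ p) \<noteq> 0"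
        using u(2) by (intro alternating_sum_single) (simp add: c_def)
    qed (use oth t in auto)
    \<comment> \<open>A recovered letter is known in all words, because the kernels agree.\<close>
    have spread: "h' r t = h r t" if ker: "same_kernel ?P ?f (case_prod h')"
      and u: "u < 4" "c l u = 1" and eq: "\<And>t. t \<in> {1..n} \<Longrightarrow> h' u t = h u t"
      and rt: "r < 4" "t \<in> {1..n}" "h r t = l" for h' u l r t
    proof -
      obtain s where s: "s \<in> {1..n}" "h u s = l"
        using u(2) unfolding c_def by (auto simp: card_1_singleton_iff)
      have "case_prod h' (r, t) = case_prod h' (u, s)"
        using ker rt s u unfolding same_kernel_def by (metis SigmaI lessThan_iff case_prod_conv)
      then show ?thesis using eq[of s] s rt by simp
    qed
    have goal: "\<exists>D\<subseteq>?P. card D \<le> 2 * n - 2 \<and> determines ?P case_prod ?S D h"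
      if X: "X \<subseteq> ?f ` ?P" "card (?f ` ?P) - card X \<le> 2 * n - 2"
        and fin: "\<And>h' r t. h' \<in> ?S \<Longrightarrow>
           same_kernel ?P ?f (case_prod h') \<Longrightarrow>
           (\<And>r t. r < 4 \<Longrightarrow> t \<in> {1..n} \<Longrightarrow> h r t \<notin> X \<Longrightarrow> h' r t = h r t) \<Longrightarrow>
           r < 4 \<Longrightarrow> t \<in> {1..n} \<Longrightarrow> h' r t = h r t" for X
    proof -
      obtain D where D: "D \<subseteq> ?P" "card D = card (?f ` ?P) - card X" and rec: "recovers ?P D ?f X"
        using class_representatives[of ?P "X" "?f"] X by auto
      have "h' = h" if h': "h' \<in> ?S"
        and ker: "same_kernel ?P ?f (case_prod h')"
        and ag: "\<forall>p\<in>D. case_prod h' p = ?f p" for h'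
      proof (rule ext[OF h'])
        fix r t assume rt: "r < (4::nat)" "t \<in> {1..n}"
        show "h' r t = h r t"
        proof (rule fin[OF h' ker _ rt])
          fix r t assume "r < (4::nat)" "t \<in> {1..n}" "h r t \<notin> X"
          then show "h' r t = h r t" using recoversD[OF rec ker ag, of "(r, t)"] by simp
        qed
      qed
      then have "determines ?P case_prod ?S D h" unfolding determines_def by blast
      then show ?thesis using D(1,2) X(2) by (intro exI[of _ D]) simp
    qed
    from cases show "\<exists>D\<subseteq>?P. card D \<le> 2 * n - 2 \<and> determines ?P case_prod ?S D h"
    proof (elim disjE conjE bexE exE)
      assume "card (?f ` ?P) + 2 \<le> 2 * n"
      then show ?thesis by (intro goal[of "{}"]) auto
    next
      fix l r assume l: "card (?f ` ?P) + 1 \<le> 2 * n" "l \<in> ?f ` ?P" "r < 4" "c l r = 1"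
      show ?thesis
      proof (rule goal[of "{l}"])
        fix h' s t assume h': "h' \<in> ?S"
          and ker: "same_kernel ?P ?f (case_prod h')"
          and eq: "\<And>r t. r < 4 \<Longrightarrow> t \<in> {1..n} \<Longrightarrow> h r t \<notin> {l} \<Longrightarrow> h' r t = h r t"
          and st: "s < (4::nat)" "t \<in> {1..n}"
        have "h' r t = h r t" if "t \<in> {1..n}" for t
          using recover[OF h' ker l(3,4) _ that] eq l(3) by auto
        then show "h' s t = h s t"
          using eq[OF st] spread[OF ker l(3,4) _ st] by (cases "h s t = l") auto
      qed (use l in auto)
    next
      fix l l' u v
      assume l: "card (?f ` ?P) \<le> 2 * n" "l \<in> ?f ` ?P" "l' \<in> ?f ` ?P"
        and uv: "u < 4" "v < 4" "u \<noteq> v" "c l u = 1" "c l' v = 1" "c l' u = 0"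
      have nl: "h u t \<noteq> l'" if "t \<in> {1..n}" for t
        using uv(6) that unfolding c_def by (auto simp: card_eq_0_iff)
      have "l \<noteq> l'" using uv by auto
      then have "card {l, l'} = 2" by simp
      show ?thesis
      proof (rule goal[of "{l, l'}"])
        fix h' s t assume h': "h' \<in> ?S"
          and ker: "same_kernel ?P ?f (case_prod h')"
          and eq: "\<And>r t. r < 4 \<Longrightarrow> t \<in> {1..n} \<Longrightarrow> h r t \<notin> {l, l'} \<Longrightarrow> h' r t = h r t"
          and st: "s < (4::nat)" "t \<in> {1..n}"
        have u: "h' u t = h u t" if "t \<in> {1..n}" for t
          using recover[OF h' ker uv(1,4) _ that] eq uv(1) nl by auto
        have l1: "h' r t = h r t" if "r < 4" "t \<in> {1..n}" "h r t = l" for r t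
          using spread[OF ker uv(1,4) u that] .
        have v: "h' v t = h v t" if "t \<in> {1..n}" for t
          using recover[OF h' ker uv(2,5) _ that] eq[OF uv(2)] l1[OF uv(2)] by auto
        have l2: "h' r t = h r t" if "r < 4" "t \<in> {1..n}" "h r t = l'" for r t
          using spread[OF ker uv(2,5) v that] .
        show "h' s t = h s t"
          using eq[OF st] l1[OF st] l2[OF st] by auto
      qed (use l \<open>card {l, l'} = 2\<close> in auto)
    qed
  qed (use A in auto)
  then show ?thesis unfolding cP .
qed

text \<open>For two positions the alternating sum vanishes exactly if their parities differ. It is also the coefficient
of the letter in the closure equation of the word.\<close>

definition opposite_parity_paired :: "nat \<Rightarrow> (nat \<Rightarrow> 'a) \<Rightarrow> bool" where
  "opposite_parity_paired n f \<longleftrightarrow> (\<forall>s\<in>{1..n}. card {t \<in> {1..n}. f t = f s} = 2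
      \<and> (\<Sum>t | t \<in> {1..n} \<and> f t = f s. (-1 :: int) ^ t) = 0)"

text \<open>Either some letter occurs three times, so that there are fewer than \<open>k\<close> letters, or all letters occur
twice and one of them, at two positions of equal parity, is determined by the closure equation.\<close>

lemma card_degenerate_words:
  assumes A: "finite A" "A \<noteq> {}"
  shows "card {f \<in> closed_words (2 * k) A. multiplicity_ge_two {1..2 * k} f \<and> \<not> opposite_parity_paired (2 * k) f}
    \<le> 2 ^ ((2 * k) * (2 * k)) * 2 ^ (2 * k) * card A ^ (k - 1)"
proof -
  let ?P = "{1..2 * k}"
  let ?S = "{f \<in> closed_words (2 * k) A. multiplicity_ge_two ?P f \<and> \<not> opposite_parity_paired (2 * k) f}"
  have "card ?S \<le> 2 ^ (card ?P * card ?P) * 2 ^ card ?P * card A ^ (k - 1)"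
  proof (rule card_determined_le(2)[where L="\<lambda>f. f"])
    show "f p \<in> A" if "f \<in> ?S" "p \<in> ?P" for f p
      using that by (auto simp: closed_words_def)
    fix f assume f: "f \<in> ?S"
    have sum: "(\<Sum>l\<in>f ` ?P. card {p \<in> ?P. f p = l}) = 2 * k"
      using sum_multiplicities[of ?P f] by simp
    have ge2: "card {p \<in> ?P. f p = l} \<ge> 2" if "l \<in> f ` ?P" for l
      using f that by (auto simp: multiplicity_ge_two_def)
    have ext: "g = f" if "g \<in> ?S" "\<And>p. p \<in> ?P \<Longrightarrow> g p = f p" for g
      using f that by (intro PiE_ext[of g ?P "\<lambda>_. A"]) (auto simp: closed_words_def)
    consider (three) l where "l \<in> f ` ?P" "card {p \<in> ?P. f p = l} \<ge> 3"
      | (parity) l where "l \<in> f ` ?P" "\<forall>l\<in>f ` ?P. card {p \<in> ?P. f p = l} = 2"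
          "(\<Sum>t | t \<in> ?P \<and> f t = l. (-1 :: int) ^ t) \<noteq> 0"
    proof (cases "\<exists>l\<in>f ` ?P. card {p \<in> ?P. f p = l} \<ge> 3")
      case False
      have two: "\<forall>l\<in>f ` ?P. card {p \<in> ?P. f p = l} = 2"
      proof
        fix l assume l: "l \<in> f ` ?P"
        then have "\<not> 3 \<le> card {p \<in> ?P. f p = l}" using False by blast
        then show "card {p \<in> ?P. f p = l} = 2" using ge2[OF l] by linarith
      qed
      then show ?thesis using f that(2) by (auto simp: opposite_parity_paired_def)
    qed (use that in blast)
    then show "\<exists>D\<subseteq>?P. card D \<le> k - 1 \<and> determines ?P (\<lambda>f. f) ?S D f"
    proof cases
      case three
      obtain D where D: "D \<subseteq> ?P" "card D = card (f ` ?P) - card ({} :: int set)" and rec: "recovers ?P D f {}"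
        using class_representatives[of ?P "{}" "f"] by auto
      have "(\<Sum>l\<in>f ` ?P. card {p \<in> ?P. f p = l}) = card {p \<in> ?P. f p = l} + (\<Sum>l\<in>f ` ?P - {l}. card {p \<in> ?P. f p = l})"
        using three by (intro sum.remove) auto
      moreover have "(\<Sum>l\<in>f ` ?P - {l}. card {p \<in> ?P. f p = l}) \<ge> (\<Sum>l\<in>f ` ?P - {l}. 2)"
        using ge2 by (intro sum_mono) auto
      moreover have "card (f ` ?P - {l}) = card (f ` ?P) - 1" "card (f ` ?P) \<ge> 1"
        using three by (auto simp: Suc_le_eq card_gt_0_iff)
      ultimately have "card D \<le> k - 1" using three sum D(2) by auto
      moreover have "g = f" if g: "g \<in> ?S" and ker: "same_kernel ?P f g" and ag: "\<forall>p\<in>D. g p = f p" for g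
        using ext[OF g] recoversD[OF rec ker ag] by simp
      ultimately show ?thesis using D(1) unfolding determines_def by (intro exI[of _ D]) blast
    next
      case parity
      obtain D where D: "D \<subseteq> ?P" "card D = card (f ` ?P) - card {l}" and rec: "recovers ?P D f {l}"
        using class_representatives[of ?P "{l}" "f"] parity by auto
      have "(\<Sum>l\<in>f ` ?P. card {p \<in> ?P. f p = l}) = (\<Sum>l\<in>f ` ?P. 2)"
        using parity(2) by (intro sum.cong) auto
      then have "card D \<le> k - 1" using sum D(2) by simp
      moreover have "g = f" if g: "g \<in> ?S" and ker: "same_kernel ?P f g"
        and ag: "\<forall>p\<in>D. g p = f p" for g
      proof (rule ext[OF g])
        fix p assume p: "p \<in> ?P"
        show "g p = f p"
        proof (rule linear_equation_determines[where T="?P" and \<sigma>="\<lambda>t. (-1) ^ t" and l=l, OF _ ker])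
          show "(\<Sum>p\<in>?P. (-1) ^ p * f p) = (\<Sum>p\<in>?P. (-1) ^ p * g p)"
            using f g by (simp add: closed_words_def)
        qed (use recoversD[OF rec ker ag] parity p in auto)
      qed
      ultimately show ?thesis using D(1) unfolding determines_def by (intro exI[of _ D]) blast
    qed
  qed (use A in auto)
  then show ?thesis by simp
qed

section \<open>Traces of Hankel band matrices as sums over walks\<close>

lemma hankel_band_mat_carrier [simp]: "hankel_band_mat a \<beta> N \<in> carrier_mat N N"
  by (auto simp: hankel_band_mat_def reversal_mat_def toeplitz_band_mat_def)

lemma hankel_band_mat_entry:
  assumes "i < N" "l < N"
  shows "hankel_band_mat a \<beta> N $$ (i, l) =
    (if \<bar>int N - 1 - int i - int l\<bar> \<le> int \<beta> then a (int N - 1 - int i - int l) else 0)"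
proof -
  have "hankel_band_mat a \<beta> N $$ (i, l) =
      (\<Sum>r<N. (if i = N - (r + 1) then 1 else 0) *
         (if \<bar>int r - int l\<bar> \<le> int \<beta> then a (int r - int l) else 0))"
    using assms by (simp add: hankel_band_mat_def reversal_mat_def toeplitz_band_mat_def
      scalar_prod_def atLeast0LessThan)
  also have "\<dots> = (\<Sum>r<N. if r = N - 1 - i then
         (if \<bar>int r - int l\<bar> \<le> int \<beta> then a (int r - int l) else 0) else 0)"
    using assms by (intro sum.cong) auto
  also have "\<dots> = (if \<bar>int N - 1 - int i - int l\<bar> \<le> int \<beta> then a (int N - 1 - int i - int l) else 0)"
    using assms by (simp add: of_nat_diff algebra_simps)
  finally show ?thesis .
qed

lemma hankel_band_mat_symmetric:
  assumes "i < N" "l < N"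
  shows "hankel_band_mat a \<beta> N $$ (i, l) = hankel_band_mat a \<beta> N $$ (l, i)"
  unfolding hankel_band_mat_entry[OF assms] hankel_band_mat_entry[OF assms(2,1)]
  by (simp add: algebra_simps)

text \<open>A walk that follows the word \<open>f\<close> moves from the index \<open>p\<close> to \<open>N - 1 - p - f t\<close> at time \<open>t\<close>. The height is
its index at even times and the reflection \<open>N - 1 - p\<close> of its index at odd times; in these coordinates the
letters are simply added with alternating signs.\<close>

definition walk_height :: "int \<Rightarrow> (nat \<Rightarrow> int) \<Rightarrow> nat \<Rightarrow> int" where
  "walk_height i f t = i - (\<Sum>r=1..t. (-1) ^ r * f r)"

definition walk_index :: "nat \<Rightarrow> int \<Rightarrow> (nat \<Rightarrow> int) \<Rightarrow> nat \<Rightarrow> int" where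
  "walk_index N i f t = (if even t then walk_height i f t else int N - 1 - walk_height i f t)"

definition walk_inside :: "nat \<Rightarrow> int \<Rightarrow> (nat \<Rightarrow> int) \<Rightarrow> nat \<Rightarrow> bool" where
  "walk_inside N i f n \<longleftrightarrow> (\<forall>t\<in>{1..n}. 0 \<le> walk_height i f t \<and> walk_height i f t < int N)"

lemma walk_index_Suc: "walk_index N i f (Suc t) = int N - 1 - walk_index N i f t - f (Suc t)"
  by (auto simp: walk_index_def walk_height_def)

lemma walk_height_cong: "(\<And>r. r \<in> {1..t} \<Longrightarrow> f r = g r) \<Longrightarrow> walk_height i f t = walk_height i g t"
  by (simp add: walk_height_def)

lemma walk_index_range:
  assumes "walk_inside N i f n" "0 \<le> i" "i < int N"
  shows "0 \<le> walk_index N i f n \<and> walk_index N i f n < int N"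
proof (cases "n = 0")
  case True
  then show ?thesis using assms by (simp add: walk_index_def walk_height_def)
next
  case False
  then have "n \<in> {1..n}" by simp
  then have "0 \<le> walk_height i f n \<and> walk_height i f n < int N"
    using assms(1) unfolding walk_inside_def by blast
  then show ?thesis by (auto simp: walk_index_def)
qed

lemma walk_inside_Suc:
  "walk_inside N i f (Suc n) \<longleftrightarrow> walk_inside N i f n \<and>
     0 \<le> walk_index N i f (Suc n) \<and> walk_index N i f (Suc n) < int N"
  by (auto simp: walk_inside_def walk_index_def atLeastAtMostSuc_conv)

lemma sum_PiE_insert:
  assumes "x \<notin> S"
  shows "(\<Sum>f\<in>PiE (insert x S) A. g f) = (\<Sum>f\<in>PiE S A. \<Sum>y\<in>A x. g (f(x := y)))"
proof -
  have "(\<Sum>f\<in>PiE (insert x S) A. g f) = (\<Sum>(y, f)\<in>A x \<times> PiE S A. g (f(x := y)))"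
    using inj_combinator[OF assms, of A]
    by (simp add: PiE_insert_eq sum.reindex case_prod_unfold)
  also have "\<dots> = (\<Sum>y\<in>A x. \<Sum>f\<in>PiE S A. g (f(x := y)))"
    by (rule sum.cartesian_product[symmetric])
  also have "\<dots> = (\<Sum>f\<in>PiE S A. \<Sum>y\<in>A x. g (f(x := y)))"
    by (rule sum.swap)
  finally show ?thesis .
qed

abbreviation band :: "nat \<Rightarrow> int set" where
  "band \<beta> \<equiv> {- int \<beta>..int \<beta>}"

text \<open>The letter is the index of the matrix entry used in a step, so a word together with the start determines
the walk, and the sum over paths in the matrix product becomes a sum over words.\<close>

lemma hankel_power_entry:
  assumes i: "i < N" and l: "l < N"
  shows "(hankel_band_mat a \<beta> N ^\<^sub>m n) $$ (i, l) =
    (\<Sum>f\<in>{1..n} \<rightarrow>\<^sub>E band \<beta>. if walk_inside N i f n \<and> walk_index N i f n = int l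
       then \<Prod>t=1..n. a (f t) else 0)"
  using l
proof (induction n arbitrary: l)
  case 0
  have "walk_inside N (int i) f 0" "walk_index N (int i) f 0 = int i" for f
    by (auto simp: walk_inside_def walk_index_def walk_height_def)
  moreover have "dim_row (hankel_band_mat a \<beta> N) = N"
    using hankel_band_mat_carrier[of a \<beta> N] by (simp only: carrier_matD)
  moreover have "{1..0::nat} = {}" by simp
  ultimately show ?case using i 0 by (simp only: pow_mat.simps) simp
next
  case (Suc n)
  let ?H = "hankel_band_mat a \<beta> N"
  let ?ok = "\<lambda>f. walk_inside N (int i) f n"
  let ?p = "\<lambda>f. walk_index N (int i) f n"
  let ?a = "\<lambda>f. \<Prod>t=1..n. a (f t)"
  have dims: "dim_row ?H = N" "dim_col ?H = N" "dim_row (?H ^\<^sub>m n) = N" "dim_col (?H ^\<^sub>m n) = N"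
    using hankel_band_mat_carrier[of a \<beta> N] by (auto simp del: hankel_band_mat_carrier)
  have step: "(\<Sum>q<N. (if ?ok f \<and> ?p f = int q then ?a f else 0) * ?H $$ (q, l))
     = (\<Sum>y\<in>band \<beta>. if walk_inside N i (f(Suc n := y)) (Suc n)
            \<and> walk_index N i (f(Suc n := y)) (Suc n) = int l
          then \<Prod>t=1..Suc n. a ((f(Suc n := y)) t) else 0)" for f
  proof (cases "?ok f")
    case False
    have "\<not> walk_inside N i (f(Suc n := y)) (Suc n)" for y
    proof -
      have "walk_height i (f(Suc n := y)) t = walk_height i f t" if "t \<in> {1..n}" for t
        using that by (intro walk_height_cong) auto
      then have "walk_inside N i (f(Suc n := y)) n = ?ok f" unfolding walk_inside_def by simp
      then show ?thesis using False unfolding walk_inside_Suc by simp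
    qed
    then show ?thesis using False by simp
  next
    case True
    then have "0 \<le> ?p f \<and> ?p f < int N"
      using i by (intro walk_index_range) auto
    then obtain q where q: "q < N" "?p f = int q" by (metis nat_less_iff zle_iff_zadd add_0 of_nat_less_iff)
    have same: "walk_inside N i (f(Suc n := y)) n" "walk_index N i (f(Suc n := y)) n = int q"
        "(\<Prod>t=1..n. a ((f(Suc n := y)) t)) = ?a f" for y
    proof -
      have h: "walk_height i (f(Suc n := y)) t = walk_height i f t" if "t \<le> n" for t
        using that by (intro walk_height_cong) auto
      show "walk_inside N i (f(Suc n := y)) n" using True h by (auto simp: walk_inside_def)
      show "walk_index N i (f(Suc n := y)) n = int q" using q(2) unfolding walk_index_def h[OF order_refl] .
      show "(\<Prod>t=1..n. a ((f(Suc n := y)) t)) = ?a f" by (intro prod.cong) auto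
    qed
    have "(\<Sum>q'<N. (if ?ok f \<and> ?p f = int q' then ?a f else 0) * ?H $$ (q', l))
        = (\<Sum>q'<N. if q' = q then ?a f * ?H $$ (q, l) else 0)"
      using True q by (intro sum.cong) auto
    also have "\<dots> = ?a f * ?H $$ (q, l)" using q by simp
    also have "\<dots> = (\<Sum>y\<in>band \<beta>. if y = int N - 1 - int q - int l then ?a f * a y else 0)"
      unfolding hankel_band_mat_entry[OF q(1) \<open>l < N\<close>] by (auto simp: abs_le_iff)
    also have "\<dots> = (\<Sum>y\<in>band \<beta>. if walk_inside N i (f(Suc n := y)) (Suc n)
            \<and> walk_index N i (f(Suc n := y)) (Suc n) = int l
          then \<Prod>t=1..Suc n. a ((f(Suc n := y)) t) else 0)"
    proof (intro sum.cong refl)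
      fix y
      have "walk_index N i (f(Suc n := y)) (Suc n) = int N - 1 - int q - y"
        by (simp add: walk_index_Suc same)
      moreover have "(\<Prod>t=1..Suc n. a ((f(Suc n := y)) t)) = ?a f * a y"
        using same(3)[of y] by simp
      ultimately show "(if y = int N - 1 - int q - int l then ?a f * a y else 0) =
        (if walk_inside N i (f(Suc n := y)) (Suc n) \<and> walk_index N i (f(Suc n := y)) (Suc n) = int l
          then \<Prod>t=1..Suc n. a ((f(Suc n := y)) t) else 0)"
        using same(1)[of y] \<open>l < N\<close> unfolding walk_inside_Suc by (auto simp del: fun_upd_apply)
    qed
    finally show ?thesis .
  qed
  have "(?H ^\<^sub>m Suc n) $$ (i, l) = (\<Sum>q<N. (?H ^\<^sub>m n) $$ (i, q) * ?H $$ (q, l))"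
    using dims i Suc.prems by (simp add: scalar_prod_def atLeast0LessThan)
  also have "\<dots> = (\<Sum>q<N. \<Sum>f\<in>{1..n} \<rightarrow>\<^sub>E band \<beta>. (if ?ok f \<and> ?p f = int q then ?a f else 0) * ?H $$ (q, l))"
    using Suc.IH by (simp add: sum_distrib_right)
  also have "\<dots> = (\<Sum>f\<in>{1..n} \<rightarrow>\<^sub>E band \<beta>. \<Sum>q<N. (if ?ok f \<and> ?p f = int q then ?a f else 0) * ?H $$ (q, l))"
    by (rule sum.swap)
  also have "\<dots> = (\<Sum>f\<in>{1..Suc n} \<rightarrow>\<^sub>E band \<beta>. if walk_inside N i f (Suc n) \<and> walk_index N i f (Suc n) = int l
       then \<Prod>t=1..Suc n. a (f t) else 0)"
    unfolding step by (subst sum_PiE_insert[symmetric]) (auto simp: atLeastAtMostSuc_conv)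
  finally show ?case .
qed

definition closed_walks :: "nat \<Rightarrow> nat \<Rightarrow> (nat \<Rightarrow> int) \<Rightarrow> nat" where
  "closed_walks N n f = card {i \<in> {..<N}. walk_inside N (int i) f n \<and> walk_index N (int i) f n = int i}"

theorem trace_hankel_power:
  "mat_trace (hankel_band_mat a \<beta> N ^\<^sub>m n) =
    (\<Sum>f\<in>{1..n} \<rightarrow>\<^sub>E band \<beta>. real (closed_walks N n f) * (\<Prod>t=1..n. a (f t)))"
proof -
  have dim: "dim_row (hankel_band_mat a \<beta> N ^\<^sub>m n) = N"
    using hankel_band_mat_carrier[of a \<beta> N] by (auto simp del: hankel_band_mat_carrier)
  have "mat_trace (hankel_band_mat a \<beta> N ^\<^sub>m n) =
     (\<Sum>i<N. \<Sum>f\<in>{1..n} \<rightarrow>\<^sub>E band \<beta>. if walk_inside N (int i) f n \<and> walk_index N (int i) f n = int i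
       then \<Prod>t=1..n. a (f t) else 0)"
    unfolding mat_trace_def dim by (intro sum.cong) (auto simp: hankel_power_entry)
  also have "\<dots> = (\<Sum>f\<in>{1..n} \<rightarrow>\<^sub>E band \<beta>. \<Sum>i<N. if walk_inside N (int i) f n \<and> walk_index N (int i) f n = int i
       then \<Prod>t=1..n. a (f t) else 0)"
    by (rule sum.swap)
  also have "\<dots> = (\<Sum>f\<in>{1..n} \<rightarrow>\<^sub>E band \<beta>. real (closed_walks N n f) * (\<Prod>t=1..n. a (f t)))"
    by (intro sum.cong refl) (simp add: closed_walks_def sum.If_cases Int_def)
  finally show ?thesis .
qed

lemma closed_walks_le: "closed_walks N n f \<le> N"
proof -
  have "closed_walks N n f \<le> card {..<N}" unfolding closed_walks_def by (intro card_mono) auto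
  then show ?thesis by simp
qed

text \<open>At even times the start cancels from the closure condition.\<close>

lemma closed_walks_even:
  assumes "even n" "f \<in> {1..n} \<rightarrow>\<^sub>E A" "f \<notin> closed_words n A"
  shows "closed_walks N n f = 0"
  using assms by (auto simp: closed_walks_def closed_words_def walk_index_def walk_height_def)

lemma closed_walks_even_closed:
  assumes "even n" "f \<in> closed_words n A"
  shows "closed_walks N n f = card {i \<in> {..<N}. walk_inside N (int i) f n}"
  using assms by (auto simp: closed_walks_def closed_words_def walk_index_def walk_height_def)

text \<open>At odd times the index is the reflected height, so the closure condition contains twice the start and determines it.\<close>

lemma closed_walks_odd:
  assumes "odd n"
  shows "closed_walks N n f \<le> 1"
proof -
  let ?S = "{i \<in> {..<N}. walk_inside N (int i) f n \<and> walk_index N (int i) f n = int i}"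
  have "i = j" if "i \<in> ?S" "j \<in> ?S" for i j
    using that assms by (auto simp: walk_index_def walk_height_def)
  then have "card ?S \<le> 1" by (intro card_le_Suc0_iff_eq[THEN iffD2, unfolded One_nat_def[symmetric]]) auto
  then show ?thesis by (simp add: closed_walks_def)
qed

lemma power_smult_mat:
  fixes A :: "'a::comm_semiring_1 mat"
  assumes A: "A \<in> carrier_mat n n"
  shows "(c \<cdot>\<^sub>m A) ^\<^sub>m k = c ^ k \<cdot>\<^sub>m (A ^\<^sub>m k)"
proof (induction k)
  case 0
  then show ?case using A by (intro eq_matI) auto
next
  case (Suc k)
  have "(c \<cdot>\<^sub>m A) ^\<^sub>m Suc k = (c ^ k \<cdot>\<^sub>m (A ^\<^sub>m k)) * (c \<cdot>\<^sub>m A)" using Suc by simp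
  also have "\<dots> = c ^ k \<cdot>\<^sub>m (A ^\<^sub>m k * (c \<cdot>\<^sub>m A))"
    using A by (intro mult_smult_assoc_mat[of _ n n]) auto
  also have "A ^\<^sub>m k * (c \<cdot>\<^sub>m A) = c \<cdot>\<^sub>m (A ^\<^sub>m k * A)"
    using A by (intro mult_smult_distrib[of _ n n]) auto
  finally show ?case using A by (auto intro!: eq_matI simp: mult_ac)
qed

lemma mat_trace_smult:
  fixes A :: "'a::comm_semiring_0 mat"
  assumes "A \<in> carrier_mat n n"
  shows "mat_trace (c \<cdot>\<^sub>m A) = c * mat_trace A"
  using assms by (auto simp: mat_trace_def sum_distrib_left)

section \<open>Products of independent entries\<close>

text \<open>The product is at most a power of its largest factor; the summand \<open>1\<close> covers the empty product. In this
form expectations of products are bounded by moments of single factors.\<close>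

lemma prod_le_one_plus_sum_power:
  fixes x :: "'p \<Rightarrow> real"
  assumes S: "finite S" and x: "\<And>p. p \<in> S \<Longrightarrow> 0 \<le> x p"
  shows "(\<Prod>p\<in>S. x p) \<le> 1 + (\<Sum>p\<in>S. x p ^ card S)"
proof (cases "S = {}")
  case False
  define m where "m = Max (x ` S)"
  have "m \<in> x ` S" using False S unfolding m_def by (intro Max_in) auto
  then obtain q where q: "q \<in> S" "m = x q" by auto
  have "(\<Prod>p\<in>S. x p) \<le> (\<Prod>p\<in>S. m)"
    using S x by (intro prod_mono) (auto simp: m_def)
  also have "\<dots> = x q ^ card S" using q by simp
  also have "\<dots> \<le> (\<Sum>p\<in>S. x p ^ card S)"
    using S q x by (intro member_le_sum) auto
  finally show ?thesis by simp
qed simp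

text \<open>The sum of all \<open>G n\<close> has finite expectation and is therefore finite almost surely.\<close>

lemma (in prob_space) AE_tendsto_zero_of_summable:
  fixes G :: "nat \<Rightarrow> 'a \<Rightarrow> real"
  assumes int: "\<And>n. integrable M (G n)" and nn: "\<And>n \<omega>. 0 \<le> G n \<omega>"
    and sm: "summable (\<lambda>n. expectation (G n))"
  shows "AE \<omega> in M. (\<lambda>n. G n \<omega>) \<longlonglongrightarrow> 0"
proof -
  have [measurable]: "G n \<in> borel_measurable M" for n using int by auto
  have "(\<integral>\<^sup>+\<omega>. (\<Sum>n. ennreal (G n \<omega>)) \<partial>M) = (\<Sum>n. \<integral>\<^sup>+\<omega>. ennreal (G n \<omega>) \<partial>M)"
    by (rule nn_integral_suminf) (use int in auto)
  also have "\<dots> = (\<Sum>n. ennreal (expectation (G n)))"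
    using int nn by (intro suminf_cong nn_integral_eq_integral) auto
  also have "\<dots> = ennreal (\<Sum>n. expectation (G n))"
    using sm nn by (intro suminf_ennreal2) auto
  finally have "(\<integral>\<^sup>+\<omega>. (\<Sum>n. ennreal (G n \<omega>)) \<partial>M) \<noteq> \<infinity>" by simp
  then have "AE \<omega> in M. (\<Sum>n. ennreal (G n \<omega>)) \<noteq> \<infinity>"
    by (intro nn_integral_noteq_infinite) auto
  then show ?thesis
  proof eventually_elim
    case (elim \<omega>)
    then have "summable (\<lambda>n. G n \<omega>)"
      using nn by (intro summable_suminf_not_top) auto
    then show ?case by (rule summable_LIMSEQ_zero)
  qed
qed

lemma (in prob_space) AE_tendsto_zero_of_inverse_squares:
  fixes G :: "nat \<Rightarrow> 'a \<Rightarrow> real"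
  assumes p: "even p" "0 < p" and int: "\<And>n. integrable M (\<lambda>\<omega>. G n \<omega> ^ p)"
    and bound: "\<And>n. 1 \<le> n \<Longrightarrow> expectation (\<lambda>\<omega>. G n \<omega> ^ p) \<le> C / (real n)\<^sup>2"
  shows "AE \<omega> in M. (\<lambda>n. G n \<omega>) \<longlonglongrightarrow> 0"
proof -
  have nn: "0 \<le> G n \<omega> ^ p" for n \<omega> using p(1) by (rule zero_le_even_power)
  have "summable (\<lambda>n. C / (real n)\<^sup>2)"
    using summable_mult[OF inverse_power_summable[of 2], of C] by (simp add: divide_inverse)
  then have "summable (\<lambda>n. expectation (\<lambda>\<omega>. G n \<omega> ^ p))"
    by (rule summable_comparison_test'[where N=1]) (use bound nn in \<open>simp add: integral_nonneg_AE\<close>)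
  then have "AE \<omega> in M. (\<lambda>n. G n \<omega> ^ p) \<longlonglongrightarrow> 0"
    by (intro AE_tendsto_zero_of_summable int nn)
  then show ?thesis by eventually_elim (simp add: power_tendsto_0_iff p(2))
qed

locale independent_entries = prob_space M for M :: "'w measure" +
  fixes a :: "int \<Rightarrow> 'w \<Rightarrow> real"
  assumes indep: "indep_vars (\<lambda>_. borel) a UNIV"
    and mean_zero: "\<And>j. expectation (a j) = 0"
    and variance_one: "\<And>j. expectation (\<lambda>\<omega>. \<bar>a j \<omega>\<bar> ^ 2) = 1"
    and bounded_moments: "\<And>k::nat. (SUP j. \<integral>\<^sup>+\<omega>. ennreal (\<bar>a j \<omega>\<bar> ^ k) \<partial>M) < \<infinity>"
begin

lemma entry_measurable [measurable]: "a j \<in> borel_measurable M"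
  using indep by (auto simp: indep_vars_def)

definition abs_moment :: "nat \<Rightarrow> real" where
  "abs_moment k = enn2real (SUP j. \<integral>\<^sup>+\<omega>. ennreal (\<bar>a j \<omega>\<bar> ^ k) \<partial>M)"

lemma entry_moments:
  shows "integrable M (\<lambda>\<omega>. \<bar>a j \<omega>\<bar> ^ k)" and "expectation (\<lambda>\<omega>. \<bar>a j \<omega>\<bar> ^ k) \<le> abs_moment k"
proof -
  have le: "(\<integral>\<^sup>+\<omega>. ennreal (\<bar>a j \<omega>\<bar> ^ k) \<partial>M) \<le> (SUP j. \<integral>\<^sup>+\<omega>. ennreal (\<bar>a j \<omega>\<bar> ^ k) \<partial>M)"
    by (rule SUP_upper) simp
  show int: "integrable M (\<lambda>\<omega>. \<bar>a j \<omega>\<bar> ^ k)"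
    using le_less_trans[OF le bounded_moments[of k]] by (intro integrableI_bounded) auto
  have "ennreal (expectation (\<lambda>\<omega>. \<bar>a j \<omega>\<bar> ^ k)) \<le> (SUP j. \<integral>\<^sup>+\<omega>. ennreal (\<bar>a j \<omega>\<bar> ^ k) \<partial>M)"
    using le nn_integral_eq_integral[OF int] by simp
  also have "\<dots> = ennreal (abs_moment k)"
    using bounded_moments[of k] unfolding abs_moment_def infinity_ennreal_def
    by (metis ennreal_enn2real)
  finally show "expectation (\<lambda>\<omega>. \<bar>a j \<omega>\<bar> ^ k) \<le> abs_moment k"
    by (subst (asm) ennreal_le_iff) (auto simp: abs_moment_def)
qed

lemma monomial_bound:
  assumes P: "finite P"
  shows "integrable M (\<lambda>\<omega>. \<Prod>p\<in>P. a (f p) \<omega>)"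
    and "expectation (\<lambda>\<omega>. \<bar>\<Prod>p\<in>P. a (f p) \<omega>\<bar>) \<le> 1 + real (card P) * abs_moment (card P)"
proof -
  let ?b = "\<lambda>\<omega>. 1 + (\<Sum>p\<in>P. \<bar>a (f p) \<omega>\<bar> ^ card P)"
  have b: "\<bar>\<Prod>p\<in>P. a (f p) \<omega>\<bar> \<le> ?b \<omega>" for \<omega>
    unfolding abs_prod using P by (intro prod_le_one_plus_sum_power) auto
  have ib: "integrable M ?b"
    using entry_moments by (intro Bochner_Integration.integrable_add Bochner_Integration.integrable_sum) auto
  show int: "integrable M (\<lambda>\<omega>. \<Prod>p\<in>P. a (f p) \<omega>)"
    by (rule Bochner_Integration.integrable_bound[OF ib])
      (use b in \<open>auto intro!: AE_I2 order_trans[OF _ abs_ge_self]\<close>)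
  have "expectation (\<lambda>\<omega>. \<bar>\<Prod>p\<in>P. a (f p) \<omega>\<bar>) \<le> expectation ?b"
    using int ib b by (intro integral_mono) auto
  also have "\<dots> = 1 + (\<Sum>p\<in>P. expectation (\<lambda>\<omega>. \<bar>a (f p) \<omega>\<bar> ^ card P))"
    using entry_moments by (subst Bochner_Integration.integral_add)
      (auto simp: prob_space intro!: Bochner_Integration.integrable_sum Bochner_Integration.integral_sum)
  also have "\<dots> \<le> 1 + (\<Sum>p\<in>P. abs_moment (card P))"
    using entry_moments by (intro add_left_mono sum_mono) auto
  finally show "expectation (\<lambda>\<omega>. \<bar>\<Prod>p\<in>P. a (f p) \<omega>\<bar>) \<le> 1 + real (card P) * abs_moment (card P)" by simp
qed

text \<open>Factoring through the restricted family makes independence of disjoint subfamilies applicable to arbitrary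
polynomials in the entries, including centred ones.\<close>

definition depends_on :: "int set \<Rightarrow> ('w \<Rightarrow> real) \<Rightarrow> bool" where
  "depends_on J F \<longleftrightarrow> (\<exists>G\<in>borel_measurable (PiM J (\<lambda>_. borel)). \<forall>\<omega>. F \<omega> = G (restrict (\<lambda>j. a j \<omega>) J))"

lemma depends_on_const: "depends_on J (\<lambda>_. c)"
  unfolding depends_on_def by (intro bexI[of _ "\<lambda>_. c"]) auto

lemma depends_on_entry: "j \<in> J \<Longrightarrow> depends_on J (a j)"
  unfolding depends_on_def by (intro bexI[of _ "\<lambda>x. x j"]) auto

lemma depends_on_diff: "depends_on J F \<Longrightarrow> depends_on J F' \<Longrightarrow> depends_on J (\<lambda>\<omega>. F \<omega> - F' \<omega>)"
  unfolding depends_on_def by (elim bexE, rule_tac x="\<lambda>x. G x - Ga x" in bexI) auto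

lemma depends_on_mult: "depends_on J F \<Longrightarrow> depends_on J F' \<Longrightarrow> depends_on J (\<lambda>\<omega>. F \<omega> * F' \<omega>)"
  unfolding depends_on_def by (elim bexE, rule_tac x="\<lambda>x. G x * Ga x" in bexI) auto

lemma depends_on_prod: "finite I \<Longrightarrow> (\<And>i. i \<in> I \<Longrightarrow> depends_on J (F i)) \<Longrightarrow> depends_on J (\<lambda>\<omega>. \<Prod>i\<in>I. F i \<omega>)"
  by (induction I rule: finite_induct) (auto intro: depends_on_const depends_on_mult)

lemma expectation_mult_disjoint:
  assumes dep: "depends_on A F" "depends_on B F'" and AB: "A \<inter> B = {}"
    and int: "integrable M F" "integrable M F'"
  shows "expectation (\<lambda>\<omega>. F \<omega> * F' \<omega>) = expectation F * expectation F'"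
proof -
  obtain G where G: "G \<in> borel_measurable (PiM A (\<lambda>_. borel))" "\<And>\<omega>. F \<omega> = G (restrict (\<lambda>j. a j \<omega>) A)"
    using dep(1) unfolding depends_on_def by blast
  obtain G' where G': "G' \<in> borel_measurable (PiM B (\<lambda>_. borel))" "\<And>\<omega>. F' \<omega> = G' (restrict (\<lambda>j. a j \<omega>) B)"
    using dep(2) unfolding depends_on_def by blast
  have "indep_var borel (G \<circ> (\<lambda>\<omega>. restrict (\<lambda>j. a j \<omega>) A)) borel (G' \<circ> (\<lambda>\<omega>. restrict (\<lambda>j. a j \<omega>) B))"
    by (rule indep_var_compose[OF indep_var_restrict[OF indep AB] G(1) G'(1)]) auto
  moreover have "G \<circ> (\<lambda>\<omega>. restrict (\<lambda>j. a j \<omega>) A) = F" using G(2) by (auto simp: fun_eq_iff)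
  moreover have "G' \<circ> (\<lambda>\<omega>. restrict (\<lambda>j. a j \<omega>) B) = F'" using G'(2) by (auto simp: fun_eq_iff)
  ultimately have "indep_var borel F borel F'" by simp
  then show ?thesis by (rule indep_var_lebesgue_integral[OF _ int])
qed

lemma expectation_single_letter:
  assumes P: "finite P" and p0: "p0 \<in> P" and single: "\<And>p. p \<in> P \<Longrightarrow> p \<noteq> p0 \<Longrightarrow> f p \<noteq> f p0"
  shows "expectation (\<lambda>\<omega>. \<Prod>p\<in>P. a (f p) \<omega>) = 0"
proof -
  have eq: "(\<lambda>\<omega>. \<Prod>p\<in>P. a (f p) \<omega>) = (\<lambda>\<omega>. a (f p0) \<omega> * (\<Prod>p\<in>P - {p0}. a (f p) \<omega>))"
    using P p0 by (simp add: prod.remove)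
  have "expectation (\<lambda>\<omega>. a (f p0) \<omega> * (\<Prod>p\<in>P - {p0}. a (f p) \<omega>)) = expectation (a (f p0)) * expectation (\<lambda>\<omega>. \<Prod>p\<in>P - {p0}. a (f p) \<omega>)"
  proof (rule expectation_mult_disjoint[of "{f p0}" _ "f ` (P - {p0})"])
    show "integrable M (a (f p0))" using monomial_bound(1)[of "{p0}" f] by simp
    have "f p0 \<notin> f ` (P - {p0})" using single by (metis DiffE imageE insertI1)
    then show "{f p0} \<inter> f ` (P - {p0}) = {}" by simp
  qed (use P in \<open>auto intro!: depends_on_entry depends_on_prod monomial_bound\<close>)
  then show ?thesis unfolding eq using mean_zero by simp
qed

lemma expectation_paired_letters:
  assumes P: "finite P" and two: "\<And>l. l \<in> f ` P \<Longrightarrow> card {p \<in> P. f p = l} = 2"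
  shows "expectation (\<lambda>\<omega>. \<Prod>p\<in>P. a (f p) \<omega>) = 1"
proof -
  have "(\<Prod>p\<in>P. a (f p) \<omega>) = (\<Prod>l\<in>f ` P. \<bar>a l \<omega>\<bar> ^ 2)" for \<omega>
  proof -
    have "(\<Prod>p\<in>P. a (f p) \<omega>) = (\<Prod>l\<in>f ` P. \<Prod>p\<in>{p \<in> P. f p = l}. a (f p) \<omega>)"
      by (rule prod.image_gen[OF P])
    also have "\<dots> = (\<Prod>l\<in>f ` P. \<bar>a l \<omega>\<bar> ^ 2)"
      using two by (intro prod.cong refl) (simp add: power2_eq_square)
    finally show ?thesis .
  qed
  then have "expectation (\<lambda>\<omega>. \<Prod>p\<in>P. a (f p) \<omega>) = expectation (\<lambda>\<omega>. \<Prod>l\<in>f ` P. \<bar>a l \<omega>\<bar> ^ 2)"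
    by simp
  also have "\<dots> = (\<Prod>l\<in>f ` P. expectation (\<lambda>\<omega>. \<bar>a l \<omega>\<bar> ^ 2))"
  proof (rule indep_vars_lebesgue_integral)
    show "indep_vars (\<lambda>_. borel) (\<lambda>l \<omega>. \<bar>a l \<omega>\<bar> ^ 2) (f ` P)"
      by (rule indep_vars_compose2[OF indep_vars_subset[OF indep]]) auto
    show "integrable M (\<lambda>\<omega>. \<bar>a l \<omega>\<bar> ^ 2)" for l by (rule entry_moments)
  qed (use P in auto)
  finally show ?thesis using variance_one by simp
qed

abbreviation word_prod :: "nat \<Rightarrow> (nat \<Rightarrow> int) \<Rightarrow> 'w \<Rightarrow> real" where
  "word_prod n f \<omega> \<equiv> (\<Prod>t=1..n. a (f t) \<omega>)"

definition centred_word :: "nat \<Rightarrow> (nat \<Rightarrow> int) \<Rightarrow> 'w \<Rightarrow> real" where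
  "centred_word n f \<omega> = word_prod n f \<omega> - expectation (word_prod n f)"

lemma expectation_words_eq_0:
  assumes "\<not> multiplicity_ge_two P f" "finite P"
  shows "expectation (\<lambda>\<omega>. \<Prod>p\<in>P. a (f p) \<omega>) = 0"
proof -
  obtain p where p: "p \<in> P" "card {q \<in> P. f q = f p} < 2"
    using assms unfolding multiplicity_ge_two_def by (auto simp: not_le)
  have "f q \<noteq> f p" if "q \<in> P" "q \<noteq> p" for q
  proof
    assume "f q = f p"
    then have "card {p, q} \<le> card {q \<in> P. f q = f p}"
      using p that assms(2) by (intro card_mono) auto
    with p that show False by simp
  qed
  with assms p show ?thesis by (intro expectation_single_letter[of P p]) auto
qed

lemma centred_word_depends: "h ` {1..n} \<subseteq> J \<Longrightarrow> depends_on J (centred_word n h)"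
  unfolding centred_word_def
  by (intro depends_on_diff depends_on_prod depends_on_const depends_on_entry) auto

lemma centred_word_fourth:
  shows "integrable M (\<lambda>\<omega>. centred_word n f \<omega> ^ 4)"
    and "expectation (\<lambda>\<omega>. centred_word n f \<omega> ^ 4) \<le>
      8 * (1 + 4 * real n * abs_moment (4 * n)) + 8 * (1 + real n * abs_moment n) ^ 4"
proof -
  let ?X = "word_prod n f" and ?c = "expectation (word_prod n f)"
  have four: "?X \<omega> ^ 4 = (\<Prod>p\<in>{..<4::nat} \<times> {1..n}. a (f (snd p)) \<omega>)" for \<omega>
    using prod.cartesian_product[of "\<lambda>_ t. a (f t) \<omega>" "{1..n}" "{..<4::nat}"]
    by (simp add: case_prod_unfold)
  have int4: "integrable M (\<lambda>\<omega>. ?X \<omega> ^ 4)"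
    unfolding four by (rule monomial_bound) simp
  have "expectation (\<lambda>\<omega>. ?X \<omega> ^ 4) \<le> expectation (\<lambda>\<omega>. \<bar>?X \<omega> ^ 4\<bar>)"
    using int4 by (intro integral_mono) auto
  also have "\<dots> \<le> 1 + 4 * real n * abs_moment (4 * n)"
    using monomial_bound(2)[of "{..<4::nat} \<times> {1..n}" "\<lambda>p. f (snd p)"] unfolding four by simp
  finally have e4: "expectation (\<lambda>\<omega>. ?X \<omega> ^ 4) \<le> 1 + 4 * real n * abs_moment (4 * n)" .
  have "\<bar>?c\<bar> \<le> expectation (\<lambda>\<omega>. \<bar>?X \<omega>\<bar>)" by (rule integral_abs_bound)
  also have "\<dots> \<le> 1 + real n * abs_moment n" using monomial_bound(2)[of "{1..n}" f] by simp
  finally have "\<bar>?c\<bar> ^ 4 \<le> (1 + real n * abs_moment n) ^ 4" by (intro power_mono) auto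
  then have c4: "?c ^ 4 \<le> (1 + real n * abs_moment n) ^ 4" by simp
  have sq: "(x - c)\<^sup>2 \<le> 2 * x\<^sup>2 + 2 * c\<^sup>2" for x c :: real
    using zero_le_power2[of "x + c"] by (simp add: power2_eq_square algebra_simps)
  have pw: "(x - c) ^ 4 \<le> 8 * x ^ 4 + 8 * c ^ 4" for x c :: real
  proof -
    have "(x - c) ^ 4 = ((x - c)\<^sup>2)\<^sup>2" by simp
    also have "\<dots> \<le> (2 * x\<^sup>2 + 2 * c\<^sup>2)\<^sup>2" using sq by (intro power_mono) auto
    also have "\<dots> \<le> 2 * (2 * x\<^sup>2)\<^sup>2 + 2 * (2 * c\<^sup>2)\<^sup>2"
      using zero_le_power2[of "2 * x\<^sup>2 - 2 * c\<^sup>2"] by (simp add: power2_eq_square algebra_simps)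
    finally show ?thesis by simp
  qed
  have ib: "integrable M (\<lambda>\<omega>. 8 * ?X \<omega> ^ 4 + 8 * ?c ^ 4)" using int4 by simp
  show int: "integrable M (\<lambda>\<omega>. centred_word n f \<omega> ^ 4)"
    unfolding centred_word_def
    by (rule Bochner_Integration.integrable_bound[OF ib])
      (use pw in \<open>auto intro!: AE_I2 order_trans[OF _ abs_ge_self]\<close>)
  have "expectation (\<lambda>\<omega>. centred_word n f \<omega> ^ 4) \<le> expectation (\<lambda>\<omega>. 8 * ?X \<omega> ^ 4 + 8 * ?c ^ 4)"
    using int ib pw by (intro integral_mono) (auto simp: centred_word_def)
  also have "\<dots> = 8 * expectation (\<lambda>\<omega>. ?X \<omega> ^ 4) + 8 * ?c ^ 4"
    using int4 by (simp add: prob_space)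
  also have "\<dots> \<le> 8 * (1 + 4 * real n * abs_moment (4 * n)) + 8 * (1 + real n * abs_moment n) ^ 4"
    using e4 c4 by (intro add_mono mult_left_mono) auto
  finally show "expectation (\<lambda>\<omega>. centred_word n f \<omega> ^ 4) \<le>
      8 * (1 + 4 * real n * abs_moment (4 * n)) + 8 * (1 + real n * abs_moment n) ^ 4" .
qed

text \<open>Stated for at most four factors with integrable fourth powers, so that it also covers the mixed products
which arise when a single letter is split off from a product of four centred words.\<close>

lemma integrable_prod_fourth_powers:
  assumes I: "I \<subseteq> {..<4::nat}"
    and F: "\<And>r. F r \<in> borel_measurable M" "\<And>r. integrable M (\<lambda>\<omega>. F r \<omega> ^ 4)"
  shows "integrable M (\<lambda>\<omega>. \<Prod>r\<in>I. F r \<omega> :: real)"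
proof -
  have fI: "finite I" using I finite_subset by blast
  have cI: "card I \<le> 4" using card_mono[OF _ I] by simp
  note [measurable] = F(1)
  let ?b = "\<lambda>\<omega>. 1 + (\<Sum>r\<in>I. 1 + F r \<omega> ^ 4)"
  have b: "\<bar>\<Prod>r\<in>I. F r \<omega>\<bar> \<le> ?b \<omega>" for \<omega>
  proof -
    have "\<bar>\<Prod>r\<in>I. F r \<omega>\<bar> \<le> 1 + (\<Sum>r\<in>I. \<bar>F r \<omega>\<bar> ^ card I)"
      unfolding abs_prod using fI by (intro prod_le_one_plus_sum_power) auto
    also have "\<dots> \<le> ?b \<omega>"
    proof (intro add_left_mono sum_mono)
      fix r
      have nn: "0 \<le> F r \<omega> ^ 4" by simp
      show "\<bar>F r \<omega>\<bar> ^ card I \<le> 1 + F r \<omega> ^ 4"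
      proof (cases "\<bar>F r \<omega>\<bar> \<le> 1")
        case True
        then have "\<bar>F r \<omega>\<bar> ^ card I \<le> 1" by (intro power_le_one) auto
        then show ?thesis using nn by linarith
      next
        case False
        then have "\<bar>F r \<omega>\<bar> ^ card I \<le> \<bar>F r \<omega>\<bar> ^ 4"
          using cI by (intro power_increasing) auto
        then show ?thesis by simp
      qed
    qed
    finally show ?thesis .
  qed
  have ib: "integrable M ?b"
    using F(2) by (intro Bochner_Integration.integrable_add Bochner_Integration.integrable_sum) auto
  show ?thesis
    by (rule Bochner_Integration.integrable_bound[OF ib])
      (use b in \<open>auto intro!: AE_I2 order_trans[OF _ abs_ge_self]\<close>)
qed

lemma centred_word_measurable [measurable]: "centred_word n f \<in> borel_measurable M"
  unfolding centred_word_def by measurable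

lemma centred_words_integrable:
  "I \<subseteq> {..<4::nat} \<Longrightarrow> integrable M (\<lambda>\<omega>. \<Prod>r\<in>I. centred_word n (h r) \<omega>)"
  by (rule integrable_prod_fourth_powers) (use centred_word_fourth(1) in auto)

definition fourth_bound :: "nat \<Rightarrow> real" where
  "fourth_bound n = 1 + 4 * (8 * (1 + 4 * real n * abs_moment (4 * n)) + 8 * (1 + real n * abs_moment n) ^ 4)"

lemma centred_words_bound:
  "\<bar>expectation (\<lambda>\<omega>. \<Prod>r<4::nat. centred_word n (h r) \<omega>)\<bar> \<le> fourth_bound n"
proof -
  let ?b = "\<lambda>\<omega>. 1 + (\<Sum>r<4::nat. centred_word n (h r) \<omega> ^ 4)"
  have b: "\<bar>\<Prod>r<4. centred_word n (h r) \<omega>\<bar> \<le> ?b \<omega>" for \<omega>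
    unfolding abs_prod
    using prod_le_one_plus_sum_power[of "{..<4::nat}" "\<lambda>r. \<bar>centred_word n (h r) \<omega>\<bar>"] by simp
  have int: "integrable M (\<lambda>\<omega>. \<Prod>r<4. centred_word n (h r) \<omega>)"
    by (rule centred_words_integrable) simp
  have ib: "integrable M ?b"
    using centred_word_fourth(1) by (intro Bochner_Integration.integrable_add Bochner_Integration.integrable_sum) auto
  have "\<bar>expectation (\<lambda>\<omega>. \<Prod>r<4. centred_word n (h r) \<omega>)\<bar> \<le> expectation (\<lambda>\<omega>. \<bar>\<Prod>r<4. centred_word n (h r) \<omega>\<bar>)"
    by (rule integral_abs_bound)
  also have "\<dots> \<le> expectation ?b" using int ib b by (intro integral_mono) auto
  also have "\<dots> = 1 + (\<Sum>r<4::nat. expectation (\<lambda>\<omega>. centred_word n (h r) \<omega> ^ 4))"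
    using centred_word_fourth(1) by (subst Bochner_Integration.integral_add)
      (auto simp: prob_space intro!: Bochner_Integration.integrable_sum Bochner_Integration.integral_sum)
  also have "\<dots> \<le> 1 + (\<Sum>r<4::nat. 8 * (1 + 4 * real n * abs_moment (4 * n)) + 8 * (1 + real n * abs_moment n) ^ 4)"
    using centred_word_fourth(2) by (intro add_left_mono sum_mono) auto
  finally show ?thesis by (simp add: fourth_bound_def)
qed

text \<open>A letter occurring only once contributes an independent factor of mean zero, since the word containing it is
then already centred. A word sharing no letter with the other three is independent of them, and its centred
product has mean zero.\<close>

lemma centred_words_eq_0:
  assumes "\<not> multiplicity_ge_two ({..<4::nat} \<times> {1..n}) (case_prod h) \<or> \<not> linked 4 n h"
  shows "expectation (\<lambda>\<omega>. \<Prod>r<4. centred_word n (h r) \<omega>) = 0"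
  using assms
proof
  assume "\<not> multiplicity_ge_two ({..<4::nat} \<times> {1..n}) (case_prod h)"
  then obtain r t where rt: "r < 4" "t \<in> {1..n}"
      "card {q \<in> {..<4::nat} \<times> {1..n}. case_prod h q = h r t} < 2"
    unfolding multiplicity_ge_two_def by (auto simp: not_le)
  have other: "h r' t' \<noteq> h r t" if "r' < 4" "t' \<in> {1..n}" "(r', t') \<noteq> (r, t)" for r' t'
  proof
    assume "h r' t' = h r t"
    then have "card {(r, t), (r', t')} \<le> card {q \<in> {..<4::nat} \<times> {1..n}. case_prod h q = h r t}"
      using rt that by (intro card_mono) auto
    with rt(3) that(3) show False by auto
  qed
  let ?Y = "\<lambda>\<omega>. (\<Prod>t'\<in>{1..n} - {t}. a (h r t') \<omega>) * (\<Prod>s\<in>{..<4} - {r}. centred_word n (h s) \<omega>)"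
  have "expectation (word_prod n (h r)) = 0"
    using rt other[of r] by (intro expectation_single_letter[of _ t]) auto
  then have cw: "centred_word n (h r) \<omega> = a (h r t) \<omega> * (\<Prod>t'\<in>{1..n} - {t}. a (h r t') \<omega>)" for \<omega>
    using rt(2) by (simp add: centred_word_def prod.remove)
  have eq: "(\<lambda>\<omega>. \<Prod>s<4. centred_word n (h s) \<omega>) = (\<lambda>\<omega>. a (h r t) \<omega> * ?Y \<omega>)"
    using rt(1) by (subst prod.remove[of _ r]) (auto simp: cw mult.assoc)
  let ?J = "- {h r t}"
  have J1: "h r t' \<in> ?J" if "t' \<in> {1..n} - {t}" for t'
    using other[of r t'] rt(1) that by auto
  have J2: "h s ` {1..n} \<subseteq> ?J" if "s \<in> {..<4} - {r}" for s
  proof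
    fix x assume "x \<in> h s ` {1..n}"
    then obtain t' where "t' \<in> {1..n}" "x = h s t'" by blast
    then show "x \<in> ?J" using other[of s t'] that by auto
  qed
  have dep: "depends_on ?J ?Y"
    using J1 J2 by (intro depends_on_mult depends_on_prod depends_on_entry centred_word_depends) auto
  \<comment> \<open>The second factor is a product of four functions with integrable fourth powers: the word \<open>r\<close> without
    its position \<open>t\<close> and the three other centred words.\<close>
  have "integrable M (\<lambda>\<omega>. \<Prod>s<4. (if s = r then \<Prod>t'\<in>{1..n} - {t}. a (h r t') \<omega> else centred_word n (h s) \<omega>))"
  proof (rule integrable_prod_fourth_powers)
    fix s
    have "(\<Prod>t'\<in>{1..n} - {t}. a (h r t') \<omega>) ^ 4 = (\<Prod>p\<in>{..<4::nat} \<times> ({1..n} - {t}). a (h r (snd p)) \<omega>)" for \<omega>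
      using prod.cartesian_product[of "\<lambda>_ t. a (h r t) \<omega>" "{1..n} - {t}" "{..<4::nat}"]
      by (simp add: case_prod_unfold)
    then have "integrable M (\<lambda>\<omega>. (\<Prod>t'\<in>{1..n} - {t}. a (h r t') \<omega>) ^ 4)"
      using monomial_bound(1)[of "{..<4::nat} \<times> ({1..n} - {t})" "\<lambda>p. h r (snd p)"] by simp
    then show "integrable M (\<lambda>\<omega>. (if s = r then \<Prod>t'\<in>{1..n} - {t}. a (h r t') \<omega> else centred_word n (h s) \<omega>) ^ 4)"
      using centred_word_fourth(1) by (cases "s = r") auto
  qed auto
  moreover have "(\<Prod>s<4. (if s = r then \<Prod>t'\<in>{1..n} - {t}. a (h r t') \<omega> else centred_word n (h s) \<omega>)) = ?Y \<omega>" for \<omega>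
  proof -
    have "(\<Prod>s\<in>{..<4} - {r}. (if s = r then \<Prod>t'\<in>{1..n} - {t}. a (h r t') \<omega> else centred_word n (h s) \<omega>))
      = (\<Prod>s\<in>{..<4} - {r}. centred_word n (h s) \<omega>)"
      by (intro prod.cong) auto
    then show ?thesis
      using prod.remove[of "{..<4}" r "\<lambda>s. if s = r then \<Prod>t'\<in>{1..n} - {t}. a (h r t') \<omega> else centred_word n (h s) \<omega>"] rt(1)
      by simp
  qed
  ultimately have intY: "integrable M ?Y" by simp
  have "expectation (\<lambda>\<omega>. a (h r t) \<omega> * ?Y \<omega>) = expectation (a (h r t)) * expectation ?Y"
    using intY dep monomial_bound(1)[of "{t}" "h r"]
    by (intro expectation_mult_disjoint[of "{h r t}" _ ?J]) (auto intro: depends_on_entry)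
  then show ?thesis unfolding eq using mean_zero by simp
next
  assume "\<not> linked 4 n h"
  then obtain r where r: "r < 4" "\<And>s. s < 4 \<Longrightarrow> s \<noteq> r \<Longrightarrow> h r ` {1..n} \<inter> h s ` {1..n} = {}"
    unfolding linked_def by blast
  let ?Y = "\<lambda>\<omega>. \<Prod>s\<in>{..<4} - {r}. centred_word n (h s) \<omega>"
  have eq: "(\<lambda>\<omega>. \<Prod>s<4. centred_word n (h s) \<omega>) = (\<lambda>\<omega>. centred_word n (h r) \<omega> * ?Y \<omega>)"
    using r(1) by (subst prod.remove[of _ r]) auto
  have int: "integrable M (word_prod n (h r))" by (rule monomial_bound) simp
  have "expectation (\<lambda>\<omega>. centred_word n (h r) \<omega> * ?Y \<omega>) = expectation (centred_word n (h r)) * expectation ?Y"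
  proof (rule expectation_mult_disjoint[of "h r ` {1..n}" _ "\<Union>s\<in>{..<4} - {r}. h s ` {1..n}"])
    show "integrable M (centred_word n (h r))" using int by (simp add: centred_word_def[abs_def])
    show "integrable M ?Y" by (rule centred_words_integrable) auto
    show "depends_on (\<Union>s\<in>{..<4} - {r}. h s ` {1..n}) ?Y"
      by (intro depends_on_prod centred_word_depends) auto
  qed (use r(2) in \<open>auto intro: centred_word_depends\<close>)
  also have "expectation (centred_word n (h r)) = 0"
    using int by (simp add: centred_word_def[abs_def] prob_space)
  finally show ?thesis unfolding eq by simp
qed

lemma expectation_linear_combination:
  fixes X :: "'i \<Rightarrow> 'w \<Rightarrow> real"
  assumes "\<And>i. integrable M (X i)"
  shows "expectation (\<lambda>\<omega>. \<Sum>i\<in>I. w i * X i \<omega>) = (\<Sum>i\<in>I. w i * expectation (X i))"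
  using assms by (subst Bochner_Integration.integral_sum) auto

text \<open>Expanding the power gives a sum over \<open>R\<close>-tuples of words. The predicate \<open>Q\<close> selects the tuples whose
expectation can be nonzero, and the number of these tuples is what has to be estimated.\<close>

lemma power_of_word_sum:
  fixes w :: "'f \<Rightarrow> real" and Z :: "'f \<Rightarrow> 'w \<Rightarrow> real" and R :: nat
  assumes W: "finite W" and w: "\<And>f. \<bar>w f\<bar> \<le> B"
    and int: "\<And>h. integrable M (\<lambda>\<omega>. \<Prod>r<R. Z (h r) \<omega>)"
    and K: "\<And>h. \<bar>expectation (\<lambda>\<omega>. \<Prod>r<R. Z (h r) \<omega>)\<bar> \<le> K"
    and zero: "\<And>h. \<not> Q h \<Longrightarrow> expectation (\<lambda>\<omega>. \<Prod>r<R. Z (h r) \<omega>) = 0"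
  shows "integrable M (\<lambda>\<omega>. (\<Sum>f\<in>W. w f * Z f \<omega>) ^ R)"
    and "expectation (\<lambda>\<omega>. (\<Sum>f\<in>W. w f * Z f \<omega>) ^ R) \<le> B ^ R * K * real (card {h \<in> {..<R} \<rightarrow>\<^sub>E W. Q h})"
proof -
  let ?H = "{..<R} \<rightarrow>\<^sub>E W"
  let ?W = "\<lambda>h. \<Prod>r<R. w (h r)"
  let ?Z = "\<lambda>h \<omega>. \<Prod>r<R. Z (h r) \<omega>"
  let ?G = "{h \<in> ?H. Q h}"
  have finH: "finite ?H" by (rule finite_PiE) (simp_all only: finite_lessThan W)
  have pow: "(\<Sum>f\<in>W. w f * Z f \<omega>) ^ R = (\<Sum>h\<in>?H. ?W h * ?Z h \<omega>)" for \<omega>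
  proof -
    have "(\<Sum>f\<in>W. w f * Z f \<omega>) ^ R = (\<Prod>r<R. \<Sum>f\<in>W. w f * Z f \<omega>)" by simp
    also have "\<dots> = (\<Sum>h\<in>?H. \<Prod>r<R. w (h r) * Z (h r) \<omega>)"
      by (rule prod_sum_PiE) (simp_all only: finite_lessThan W)
    finally show ?thesis by (simp add: prod.distrib)
  qed
  show "integrable M (\<lambda>\<omega>. (\<Sum>f\<in>W. w f * Z f \<omega>) ^ R)"
    unfolding pow by (intro Bochner_Integration.integrable_sum integrable_mult_right int)
  have B0: "0 \<le> B" using w[of undefined] by linarith
  have Wb: "\<bar>?W h\<bar> \<le> B ^ R" for h
  proof -
    have "\<bar>?W h\<bar> \<le> (\<Prod>r<R. B)" unfolding abs_prod using w by (intro prod_mono) auto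
    then show ?thesis by simp
  qed
  have "expectation (\<lambda>\<omega>. (\<Sum>f\<in>W. w f * Z f \<omega>) ^ R) = (\<Sum>h\<in>?H. ?W h * expectation (?Z h))"
    unfolding pow by (rule expectation_linear_combination) (rule int)
  also have "\<dots> = (\<Sum>h\<in>?G. ?W h * expectation (?Z h))"
    using finH zero by (intro sum.mono_neutral_right) auto
  also have "\<dots> \<le> (\<Sum>h\<in>?G. B ^ R * K)"
  proof (intro sum_mono)
    fix h
    have "?W h * expectation (?Z h) \<le> \<bar>?W h\<bar> * \<bar>expectation (?Z h)\<bar>"
      using abs_ge_self[of "?W h * expectation (?Z h)"] by (simp only: abs_mult)
    also have "\<dots> \<le> B ^ R * K" using Wb K B0 by (intro mult_mono) auto
    finally show "?W h * expectation (?Z h) \<le> B ^ R * K" .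
  qed
  finally show "expectation (\<lambda>\<omega>. (\<Sum>f\<in>W. w f * Z f \<omega>) ^ R) \<le> B ^ R * K * real (card ?G)"
    by (simp add: mult.commute)
qed

lemma fourth_central_moment:
  fixes w :: "(nat \<Rightarrow> int) \<Rightarrow> real" and A :: "int set" and n :: nat
  assumes A: "finite A" "A \<noteq> {}" and w: "\<And>f. \<bar>w f\<bar> \<le> B"
  defines "F \<equiv> \<lambda>\<omega>. \<Sum>f\<in>closed_words n A. w f * word_prod n f \<omega>"
  shows "integrable M (\<lambda>\<omega>. (F \<omega> - expectation F) ^ 4)"
    and "expectation (\<lambda>\<omega>. (F \<omega> - expectation F) ^ 4) \<le>
      B ^ 4 * fourth_bound n * (2 ^ ((4 * n) * (4 * n)) * 2 ^ (4 * n) * real (card A) ^ (2 * n - 2))"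
proof -
  have fin: "finite (closed_words n A)"
    using A by (auto simp: closed_words_def intro!: finite_subset[OF _ finite_PiE[of "{1..n}" "\<lambda>_. A"]])
  have EF: "expectation F = (\<Sum>f\<in>closed_words n A. w f * expectation (word_prod n f))"
    unfolding F_def by (rule expectation_linear_combination) (rule monomial_bound, simp)
  have diff: "F \<omega> - expectation F = (\<Sum>f\<in>closed_words n A. w f * centred_word n f \<omega>)" for \<omega>
    unfolding EF unfolding F_def centred_word_def by (simp add: right_diff_distrib sum_subtractf)
  let ?Q = "\<lambda>h. multiplicity_ge_two ({..<4::nat} \<times> {1..n}) (case_prod h) \<and> linked 4 n h"
  have int: "integrable M (\<lambda>\<omega>. \<Prod>r<4::nat. centred_word n (h r) \<omega>)" for h
    by (rule centred_words_integrable) simp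
  have zero: "expectation (\<lambda>\<omega>. \<Prod>r<4::nat. centred_word n (h r) \<omega>) = 0" if "\<not> ?Q h" for h
    using that centred_words_eq_0 by blast
  note power = power_of_word_sum[OF fin w int centred_words_bound zero]
  show "integrable M (\<lambda>\<omega>. (F \<omega> - expectation F) ^ 4)"
    unfolding diff by (rule power(1))
  have nn: "0 \<le> B" "0 \<le> fourth_bound n"
    using w[of undefined] centred_words_bound[of n undefined] by linarith+
  have "expectation (\<lambda>\<omega>. (F \<omega> - expectation F) ^ 4)
      \<le> B ^ 4 * fourth_bound n * real (card {h \<in> {..<4} \<rightarrow>\<^sub>E closed_words n A. ?Q h})"
    unfolding diff by (rule power(2))
  also have "\<dots> \<le> B ^ 4 * fourth_bound n * real (2 ^ ((4 * n) * (4 * n)) * 2 ^ (4 * n) * card A ^ (2 * n - 2))"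
    using card_linked_words[OF A, of n] nn by (intro mult_left_mono of_nat_mono mult_nonneg_nonneg) auto
  finally show "expectation (\<lambda>\<omega>. (F \<omega> - expectation F) ^ 4) \<le>
      B ^ 4 * fourth_bound n * (2 ^ ((4 * n) * (4 * n)) * 2 ^ (4 * n) * real (card A) ^ (2 * n - 2))"
    by simp
qed

lemma second_moment:
  fixes w :: "(nat \<Rightarrow> int) \<Rightarrow> real" and A :: "int set" and n :: nat
  assumes A: "finite A" "A \<noteq> {}" and w: "\<And>f. \<bar>w f\<bar> \<le> B"
  defines "F \<equiv> \<lambda>\<omega>. \<Sum>f\<in>{1..n} \<rightarrow>\<^sub>E A. w f * word_prod n f \<omega>"
  shows "integrable M (\<lambda>\<omega>. F \<omega> ^ 2)"
    and "expectation (\<lambda>\<omega>. F \<omega> ^ 2) \<le>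
      B ^ 2 * (1 + 2 * real n * abs_moment (2 * n)) * (2 ^ ((2 * n) * (2 * n)) * 2 ^ (2 * n) * real (card A) ^ n)"
proof -
  let ?P = "{..<2::nat} \<times> {1..n}"
  let ?K = "1 + 2 * real n * abs_moment (2 * n)"
  let ?Q = "\<lambda>h. multiplicity_ge_two ?P (case_prod h)"
  have fin: "finite ({1..n} \<rightarrow>\<^sub>E A)" using A by (intro finite_PiE) auto
  have flat: "(\<Prod>r<2::nat. word_prod n (h r) \<omega>) = (\<Prod>p\<in>?P. a (case_prod h p) \<omega>)" for h \<omega>
    by (simp only: prod.cartesian_product) (simp add: case_prod_unfold)
  have int: "integrable M (\<lambda>\<omega>. \<Prod>r<2::nat. word_prod n (h r) \<omega>)" for h
    unfolding flat by (rule monomial_bound) simp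
  have K: "\<bar>expectation (\<lambda>\<omega>. \<Prod>r<2::nat. word_prod n (h r) \<omega>)\<bar> \<le> ?K" for h
    unfolding flat by (rule order_trans[OF integral_abs_bound])
      (use monomial_bound(2)[of ?P "case_prod h"] in simp)
  have zero: "expectation (\<lambda>\<omega>. \<Prod>r<2::nat. word_prod n (h r) \<omega>) = 0" if "\<not> ?Q h" for h
    unfolding flat using that by (intro expectation_words_eq_0) auto
  note power = power_of_word_sum[OF fin w int K zero]
  show "integrable M (\<lambda>\<omega>. F \<omega> ^ 2)"
    unfolding F_def by (rule power(1))
  have nn: "0 \<le> B" "0 \<le> ?K" using w[of undefined] K[of undefined] by linarith+
  have "expectation (\<lambda>\<omega>. F \<omega> ^ 2) \<le> B ^ 2 * ?K * real (card {h \<in> {..<2} \<rightarrow>\<^sub>E ({1..n} \<rightarrow>\<^sub>E A). ?Q h})"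
    unfolding F_def by (rule power(2))
  also have "\<dots> \<le> B ^ 2 * ?K * real (2 ^ ((2 * n) * (2 * n)) * 2 ^ (2 * n) * card A ^ (2 * n div 2))"
    using card_paired_words[OF A, of 2 n] nn by (intro mult_left_mono of_nat_mono mult_nonneg_nonneg) auto
  finally show "expectation (\<lambda>\<omega>. F \<omega> ^ 2) \<le>
      B ^ 2 * ?K * (2 ^ ((2 * n) * (2 * n)) * 2 ^ (2 * n) * real (card A) ^ n)"
    by simp
qed

end

section \<open>Pairings of opposite parity\<close>

text \<open>This is the numbering of blocks by increasing smallest element.\<close>

lemma rank_bij_betw:
  fixes m :: "'a \<Rightarrow> 'b::linorder"
  assumes P: "finite P" and m: "inj_on m P"
  shows "bij_betw (\<lambda>V. card {W \<in> P. m W \<le> m V}) P {1..card P}"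
proof -
  let ?r = "\<lambda>V. card {W \<in> P. m W \<le> m V}"
  have less: "?r V < ?r U" if "V \<in> P" "U \<in> P" "m V < m U" for V U
  proof (rule psubset_card_mono)
    have "{W \<in> P. m W \<le> m V} \<subseteq> {W \<in> P. m W \<le> m U}" using that by auto
    moreover have "U \<in> {W \<in> P. m W \<le> m U}" "U \<notin> {W \<in> P. m W \<le> m V}" using that by auto
    ultimately show "{W \<in> P. m W \<le> m V} \<subset> {W \<in> P. m W \<le> m U}" by blast
  qed (use P in auto)
  have inj: "inj_on ?r P"
  proof (rule inj_onI)
    fix V U assume VU: "V \<in> P" "U \<in> P" "?r V = ?r U"
    then have "m V = m U" using less[of V U] less[of U V] by (metis linorder_cases nat_neq_iff)
    then show "V = U" using m VU by (auto dest: inj_onD)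
  qed
  have "?r V \<in> {1..card P}" if "V \<in> P" for V
  proof -
    have "card {V} \<le> ?r V" using that P by (intro card_mono) auto
    moreover have "?r V \<le> card P" using P by (intro card_mono) auto
    ultimately show ?thesis by simp
  qed
  then have "?r ` P \<subseteq> {1..card P}" by auto
  moreover have "card (?r ` P) = card {1..card P}" using card_image[OF inj] by simp
  ultimately have "?r ` P = {1..card P}" by (intro card_subset_eq) auto
  with inj show ?thesis by (simp add: bij_betw_def)
qed

lemma sum_alternating:
  assumes "finite V"
  shows "(\<Sum>t\<in>V. (-1 :: int) ^ t) = int (card {i \<in> V. even i}) - int (card {i \<in> V. odd i})"
  using assms
proof (induction V rule: finite_induct)
  case (insert x V)
  have "{i \<in> insert x V. even i} = (if even x then insert x {i \<in> V. even i} else {i \<in> V. even i})"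
    "{i \<in> insert x V. odd i} = (if even x then {i \<in> V. odd i} else insert x {i \<in> V. odd i})"
    by auto
  then show ?case using insert by auto
qed simp

lemma card_even_odd:
  assumes "finite V"
  shows "card V = card {i \<in> V. even i} + card {i \<in> V. odd i}"
proof -
  have "card ({i \<in> V. even i} \<union> {i \<in> V. odd i}) = card {i \<in> V. even i} + card {i \<in> V. odd i}"
    using assms by (intro card_Un_disjoint) auto
  moreover have "{i \<in> V. even i} \<union> {i \<in> V. odd i} = V" by auto
  ultimately show ?thesis by simp
qed

lemma opposite_parity_block_iff:
  assumes "finite V"
  shows "card V = 2 \<and> card {i \<in> V. even i} = 1 \<and> card {i \<in> V. odd i} = 1 \<longleftrightarrow>
    card V = 2 \<and> (\<Sum>t\<in>V. (-1 :: int) ^ t) = 0"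
  using sum_alternating[OF assms] card_even_odd[OF assms] by auto

definition constant_on_blocks :: "'p set set \<Rightarrow> ('p \<Rightarrow> 'a) \<Rightarrow> bool" where
  "constant_on_blocks P f \<longleftrightarrow> (\<forall>V\<in>P. \<forall>i\<in>V. \<forall>j\<in>V. f i = f j)"

context
  fixes k :: nat and P :: "nat set set"
  assumes P: "P \<in> opposite_parity_pairings (2 * k)"
begin

lemma pairing_partition: "partition_on {1..2 * k} P"
  using P by (simp add: opposite_parity_pairings_def)

lemma pairing_finite: "finite P"
  using pairing_partition finite_elements by blast

lemma pairing_block:
  assumes "V \<in> P"
  shows "V \<subseteq> {1..2 * k}" "finite V" "V \<noteq> {}" "card V = 2" "(\<Sum>t\<in>V. (-1 :: int) ^ t) = 0"
proof -
  show V: "V \<subseteq> {1..2 * k}" using partition_onD1[OF pairing_partition] assms by auto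
  show fin: "finite V" using V finite_subset by blast
  show "V \<noteq> {}" using partition_onD3[OF pairing_partition] assms by auto
  show "card V = 2" "(\<Sum>t\<in>V. (-1 :: int) ^ t) = 0"
    using P assms opposite_parity_block_iff[OF fin] by (auto simp: opposite_parity_pairings_def)
qed

lemma pairing_card: "card P = k"
proof -
  have "card (\<Union>P) = sum card P"
    using partition_onD2[OF pairing_partition] pairing_block(2)
    by (intro card_Union_disjoint) (auto simp: disjoint_def pairwise_def disjnt_def)
  moreover have "card (\<Union>P) = 2 * k"
    unfolding partition_onD1[OF pairing_partition, symmetric] by simp
  ultimately have "2 * k = sum card P" by simp
  also have "\<dots> = 2 * card P" using pairing_block(4) by simp
  finally show ?thesis by simp
qed

lemma sum_over_blocks: "(\<Sum>t=1..2 * k. g t) = (\<Sum>V\<in>P. \<Sum>t\<in>V. g t)"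
proof -
  have "(\<Sum>t\<in>\<Union>P. g t) = (\<Sum>V\<in>P. \<Sum>t\<in>V. g t)"
    using partition_onD2[OF pairing_partition] pairing_block(2)
    by (intro sum.Union_disjoint[unfolded o_def]) (auto simp: disjoint_def)
  then show ?thesis using partition_onD1[OF pairing_partition] by simp
qed

definition block_of :: "nat \<Rightarrow> nat set" where
  "block_of i = (THE V. V \<in> P \<and> i \<in> V)"

lemma block_of_unique:
  assumes "V \<in> P" "i \<in> V"
  shows "block_of i = V"
  unfolding block_of_def
proof (rule the_equality)
  fix W assume "W \<in> P \<and> i \<in> W"
  then show "W = V" using assms partition_onD2[OF pairing_partition] by (auto simp: disjoint_def)
qed (use assms in auto)

lemma block_of_mem:
  assumes "i \<in> {1..2 * k}"
  shows "block_of i \<in> P" "i \<in> block_of i"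
proof -
  obtain V where "V \<in> P" "i \<in> V"
    using assms unfolding partition_onD1[OF pairing_partition] by blast
  then show "block_of i \<in> P" "i \<in> block_of i" using block_of_unique by auto
qed

lemma block_rank: "bij_betw (\<lambda>V. card {W \<in> P. Min W \<le> Min V}) P {1..k}"
proof -
  have "inj_on Min P"
  proof (rule inj_onI)
    fix V W assume VW: "V \<in> P" "W \<in> P" "Min V = Min W"
    have "Min V \<in> V" "Min W \<in> W"
      using VW(1,2) by (simp_all add: pairing_block(2,3))
    then show "V = W" using block_of_unique[OF VW(1)] block_of_unique[OF VW(2)] VW(3) by metis
  qed
  then show ?thesis using rank_bij_betw[OF pairing_finite, of Min] pairing_card by simp
qed

lemma block_index_eq: "block_index P i = card {W \<in> P. Min W \<le> Min (block_of i)}"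
  by (simp add: block_index_def block_of_def)

lemma block_index_range: "i \<in> {1..2 * k} \<Longrightarrow> block_index P i \<in> {1..k}"
  using block_rank block_of_mem(1)[of i] unfolding block_index_eq by (auto simp: bij_betw_def)

lemma block_index_inj:
  "i \<in> {1..2 * k} \<Longrightarrow> j \<in> {1..2 * k} \<Longrightarrow> block_index P i = block_index P j \<longleftrightarrow> block_of i = block_of j"
  using block_rank block_of_mem(1) unfolding block_index_eq by (auto simp: bij_betw_def inj_on_def)

lemma block_index_surj:
  assumes "l \<in> {1..k}"
  obtains i where "i \<in> {1..2 * k}" "block_index P i = l"
proof -
  obtain V where V: "V \<in> P" "card {W \<in> P. Min W \<le> Min V} = l"
    using assms block_rank unfolding bij_betw_def by (metis (no_types, lifting) imageE)
  obtain i where i: "i \<in> V" using pairing_block(3)[OF V(1)] by auto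
  then have "block_index P i = l" using block_of_unique[OF V(1) i] V(2) unfolding block_index_eq by simp
  then show ?thesis using that[of i] i pairing_block(1)[OF V(1)] by auto
qed

text \<open>A block contributes its common letter times its alternating sum, which vanishes.\<close>

lemma constant_on_blocks_closed:
  assumes f: "f \<in> {1..2 * k} \<rightarrow>\<^sub>E A" and c: "constant_on_blocks P f"
  shows "f \<in> closed_words (2 * k) A" and "multiplicity_ge_two {1..2 * k} f"
proof -
  have "(\<Sum>t\<in>V. (-1) ^ t * f t) = 0" if V: "V \<in> P" for V
  proof -
    obtain i where i: "i \<in> V" using pairing_block(3)[OF V] by auto
    have "(\<Sum>t\<in>V. (-1) ^ t * f t) = (\<Sum>t\<in>V. (-1) ^ t * f i)"
      using c V i unfolding constant_on_blocks_def by (intro sum.cong refl arg_cong2[where f="(*)"]) blast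
    also have "\<dots> = (\<Sum>t\<in>V. (-1) ^ t) * f i" by (simp add: sum_distrib_right)
    finally show ?thesis using pairing_block(5)[OF V] by simp
  qed
  then have "(\<Sum>t=1..2 * k. (-1) ^ t * f t) = 0" unfolding sum_over_blocks by simp
  with f show "f \<in> closed_words (2 * k) A" by (simp add: closed_words_def)
  show "multiplicity_ge_two {1..2 * k} f"
    unfolding multiplicity_ge_two_def
  proof
    fix p assume p: "p \<in> {1..2 * k}"
    note b = block_of_mem[OF p]
    have "block_of p \<subseteq> {q \<in> {1..2 * k}. f q = f p}"
      using c b pairing_block(1)[OF b(1)] unfolding constant_on_blocks_def by blast
    then have "card (block_of p) \<le> card {q \<in> {1..2 * k}. f q = f p}" by (intro card_mono) auto
    then show "2 \<le> card {q \<in> {1..2 * k}. f q = f p}" using pairing_block(4)[OF b(1)] by simp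
  qed
qed

text \<open>A block is contained in a class of equal letters, and both have two elements.\<close>

lemma blocks_are_classes:
  assumes c: "constant_on_blocks P f" and op: "opposite_parity_paired (2 * k) f"
  shows "P = (\<lambda>s. {t \<in> {1..2 * k}. f t = f s}) ` {1..2 * k}"
proof -
  have cls: "block_of s = {t \<in> {1..2 * k}. f t = f s}" if s: "s \<in> {1..2 * k}" for s
  proof (rule card_subset_eq)
    note b = block_of_mem[OF s]
    show "block_of s \<subseteq> {t \<in> {1..2 * k}. f t = f s}"
      using c b pairing_block(1)[OF b(1)] unfolding constant_on_blocks_def by blast
    show "card (block_of s) = card {t \<in> {1..2 * k}. f t = f s}"
      using pairing_block(4)[OF b(1)] op s unfolding opposite_parity_paired_def by simp
  qed simp
  have "P = block_of ` {1..2 * k}"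
  proof (intro equalityI subsetI)
    fix V assume V: "V \<in> P"
    obtain i where i: "i \<in> V" using pairing_block(3)[OF V] by auto
    then show "V \<in> block_of ` {1..2 * k}"
      using block_of_unique[OF V i] pairing_block(1)[OF V] by (intro image_eqI[of _ _ i]) auto
  qed (use block_of_mem in auto)
  then show ?thesis using cls by auto
qed

text \<open>Following a pairing means choosing one letter for every block number, without any constraint.\<close>

lemma constant_on_blocks_bij:
  "bij_betw (\<lambda>y. \<lambda>i\<in>{1..2 * k}. y (block_index P i)) ({1..k} \<rightarrow>\<^sub>E A)
     {f \<in> {1..2 * k} \<rightarrow>\<^sub>E A. constant_on_blocks P f}"
proof (rule bij_betw_imageI)
  let ?\<Phi> = "\<lambda>y. \<lambda>i\<in>{1..2 * k}. y (block_index P i)"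
  show "inj_on ?\<Phi> ({1..k} \<rightarrow>\<^sub>E A)"
  proof (rule inj_onI)
    fix y z assume yz: "y \<in> {1..k} \<rightarrow>\<^sub>E A" "z \<in> {1..k} \<rightarrow>\<^sub>E A" "?\<Phi> y = ?\<Phi> z"
    show "y = z"
    proof (rule PiE_ext[OF yz(1,2)])
      fix l assume "l \<in> {1..k}"
      then obtain i where "i \<in> {1..2 * k}" "block_index P i = l" using block_index_surj by blast
      then show "y l = z l" using fun_cong[OF yz(3), of i] by simp
    qed
  qed
  show "?\<Phi> ` ({1..k} \<rightarrow>\<^sub>E A) = {f \<in> {1..2 * k} \<rightarrow>\<^sub>E A. constant_on_blocks P f}"
  proof (intro equalityI subsetI)
    fix f assume "f \<in> ?\<Phi> ` ({1..k} \<rightarrow>\<^sub>E A)"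
    then obtain y where y: "y \<in> {1..k} \<rightarrow>\<^sub>E A" "f = ?\<Phi> y" by auto
    have "f i = f j" if "V \<in> P" "i \<in> V" "j \<in> V" for V i j
    proof -
      have "i \<in> {1..2 * k}" "j \<in> {1..2 * k}" using that pairing_block(1)[OF that(1)] by auto
      moreover have "block_of i = block_of j" using that block_of_unique by metis
      ultimately show ?thesis using y(2) by (simp add: block_index_eq)
    qed
    moreover have "f \<in> {1..2 * k} \<rightarrow>\<^sub>E A" using y block_index_range by (auto simp: PiE_iff)
    ultimately show "f \<in> {f \<in> {1..2 * k} \<rightarrow>\<^sub>E A. constant_on_blocks P f}"
      unfolding constant_on_blocks_def by blast
  next
    fix f assume f: "f \<in> {f \<in> {1..2 * k} \<rightarrow>\<^sub>E A. constant_on_blocks P f}"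
    define rep where "rep l = (SOME i. i \<in> {1..2 * k} \<and> block_index P i = l)" for l
    have rep: "rep l \<in> {1..2 * k} \<and> block_index P (rep l) = l" if "l \<in> {1..k}" for l
      unfolding rep_def using block_index_surj[OF that] by (intro someI_ex[of "\<lambda>i. i \<in> {1..2 * k} \<and> block_index P i = l"]) blast
    define y where "y = (\<lambda>l\<in>{1..k}. f (rep l))"
    have "y \<in> {1..k} \<rightarrow>\<^sub>E A" using rep f by (auto simp: y_def PiE_iff)
    moreover have "?\<Phi> y = f"
    proof (rule PiE_ext[of _ "{1..2 * k}" "\<lambda>_. A"])
      show "?\<Phi> y \<in> {1..2 * k} \<rightarrow>\<^sub>E A"
        using \<open>y \<in> _\<close> block_index_range by (auto simp: PiE_iff)
      fix i assume i: "i \<in> {1..2 * k}"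
      note r = rep[OF block_index_range[OF i]]
      have "block_of (rep (block_index P i)) = block_of i"
        using block_index_inj[of "rep (block_index P i)" i] r i by blast
      then have "rep (block_index P i) \<in> block_of i"
        using block_of_mem(2)[of "rep (block_index P i)"] r by simp
      then have "f (rep (block_index P i)) = f i"
        using f block_of_mem[OF i] unfolding constant_on_blocks_def by blast
      then show "?\<Phi> y i = f i" using i block_index_range[OF i] by (simp add: y_def)
    qed (use f in auto)
    ultimately show "f \<in> ?\<Phi> ` ({1..k} \<rightarrow>\<^sub>E A)" by blast
  qed
qed

text \<open>Every block joins an odd number \<open>2 * j - 1\<close> to an even number \<open>2 * l\<close>, so a pairing is the graph of a map
from \<open>{1..k}\<close> to itself. This is what bounds the number of pairings by \<open>k ^ k\<close>.\<close>

lemma pairing_as_matching: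
  "P \<in> (\<lambda>g. (\<lambda>j. {2 * j - 1, 2 * g j}) ` {1..k}) ` ({1..k} \<rightarrow>\<^sub>E {1..k})"
proof -
  have ex: "\<exists>l\<in>{1..k}. {2 * j - 1, 2 * l} \<in> P" if j: "j \<in> {1..k}" for j
  proof -
    have i: "2 * j - 1 \<in> {1..2 * k}" using j by auto
    let ?V = "block_of (2 * j - 1)"
    note b = block_of_mem[OF i]
    have "card {t \<in> ?V. even t} = 1"
      using P b(1) unfolding opposite_parity_pairings_def by auto
    then obtain e where e: "{t \<in> ?V. even t} = {e}" by (auto simp: card_1_singleton_iff)
    then have e': "e \<in> ?V" "even e" by auto
    then obtain l where l: "e = 2 * l" by (auto elim: evenE)
    have "odd (2 * j - 1)" using j by auto
    then have ne: "2 * j - 1 \<noteq> e" using e' by auto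
    then have "card {2 * j - 1, e} = 2" by simp
    then have "{2 * j - 1, e} = ?V"
      using b e' pairing_block(2,4)[OF b(1)] by (intro card_subset_eq) auto
    moreover have "e \<in> {1..2 * k}" using e' pairing_block(1)[OF b(1)] by auto
    ultimately show ?thesis using b(1) l by (intro bexI[of _ l]) auto
  qed
  then obtain g0 where g0: "\<forall>j\<in>{1..k}. g0 j \<in> {1..k} \<and> {2 * j - 1, 2 * g0 j} \<in> P" by metis
  define g where "g = restrict g0 {1..k}"
  have gE: "g \<in> {1..k} \<rightarrow>\<^sub>E {1..k}" using g0 by (auto simp: g_def)
  let ?F = "\<lambda>j. {2 * j - 1, 2 * g j}"
  have inj: "inj_on ?F {1..k}"
  proof (rule inj_onI)
    fix i j assume ij: "i \<in> {1..k}" "j \<in> {1..k}" "?F i = ?F j"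
    have "odd (2 * i - 1)" using ij by auto
    moreover have "2 * i - 1 \<in> ?F j" using ij(3) by blast
    ultimately have "2 * i - 1 = 2 * j - 1" by (metis dvd_triv_left insertE singletonD)
    then show "i = j" using ij by auto
  qed
  have "?F ` {1..k} \<subseteq> P" using g0 by (auto simp: g_def)
  moreover have "card (?F ` {1..k}) = card P" using card_image[OF inj] pairing_card by simp
  ultimately have "P = ?F ` {1..k}" using pairing_finite by (metis card_subset_eq)
  then show ?thesis using gE by (intro image_eqI[of _ _ g]) auto
qed

end

lemma opposite_parity_pairings_card:
  "finite (opposite_parity_pairings (2 * k))" "card (opposite_parity_pairings (2 * k)) \<le> k ^ k"
proof -
  have sub: "opposite_parity_pairings (2 * k)
      \<subseteq> (\<lambda>g. (\<lambda>j. {2 * j - 1, 2 * g j}) ` {1..k}) ` ({1..k} \<rightarrow>\<^sub>E {1..k})"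
    using pairing_as_matching by blast
  have fin: "finite ({1..k} \<rightarrow>\<^sub>E {1..k})" by (intro finite_PiE) auto
  show "finite (opposite_parity_pairings (2 * k))"
    using finite_subset[OF sub] fin by blast
  have "card (opposite_parity_pairings (2 * k)) \<le> card ({1..k} \<rightarrow>\<^sub>E {1..k})"
    using surj_card_le[OF fin sub] .
  then show "card (opposite_parity_pairings (2 * k)) \<le> k ^ k" by (simp add: card_PiE)
qed

lemma unique_pairing_of_paired_word:
  assumes op: "opposite_parity_paired (2 * k) f"
  shows "{P \<in> opposite_parity_pairings (2 * k). constant_on_blocks P f}
     = {(\<lambda>s. {t \<in> {1..2 * k}. f t = f s}) ` {1..2 * k}}" (is "?L = {?P}")
proof -
  have part: "partition_on {1..2 * k} ?P"
    by (rule partition_onI) (auto simp: disjnt_def)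
  have blk: "card V = 2 \<and> card {i \<in> V. even i} = 1 \<and> card {i \<in> V. odd i} = 1" if V: "V \<in> ?P" for V
  proof -
    obtain s where s: "s \<in> {1..2 * k}" "V = {t \<in> {1..2 * k}. f t = f s}" using V by blast
    then have "card V = 2 \<and> (\<Sum>t\<in>V. (-1 :: int) ^ t) = 0"
      using op unfolding opposite_parity_paired_def by simp
    moreover have "finite V" using s by simp
    ultimately show ?thesis using opposite_parity_block_iff by blast
  qed
  have "?P \<in> opposite_parity_pairings (2 * k)"
    unfolding opposite_parity_pairings_def using part blk by blast
  moreover have "constant_on_blocks ?P f" by (auto simp: constant_on_blocks_def)
  ultimately show ?thesis using blocks_are_classes[OF _ _ op] by blast
qed

section \<open>Lattice points and volumes\<close>

interpretation lborel_family: product_sigma_finite "\<lambda>_ :: nat. lborel :: real measure"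
  by standard

text \<open>By Fubini: once the other coordinates are fixed, only one value of \<open>x p\<close> is excluded.\<close>

lemma AE_PiM_lborel_affine_neq:
  fixes g :: "(nat \<Rightarrow> real) \<Rightarrow> real"
  assumes J: "finite J" "p \<notin> J"
    and g: "g \<in> borel_measurable (\<Pi>\<^sub>M l\<in>insert p J. lborel)" "\<And>x t. g (x(p := t)) = g x"
  shows "AE x in (\<Pi>\<^sub>M l\<in>insert p J. lborel). x p + g x \<noteq> c"
proof -
  let ?M = "\<Pi>\<^sub>M l\<in>insert p J. lborel :: real measure"
  note [measurable] = g(1)
  let ?A = "{x \<in> space ?M. x p + g x = c}"
  have A: "?A \<in> sets ?M" by measurable
  have "emeasure ?M ?A = (\<integral>\<^sup>+x. indicator ?A x \<partial>?M)" using A by simp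
  also have "\<dots> = (\<integral>\<^sup>+y. (\<integral>\<^sup>+t. indicator ?A (y(p := t)) \<partial>lborel) \<partial>(\<Pi>\<^sub>M l\<in>J. lborel))"
    using A by (intro lborel_family.product_nn_integral_insert J) auto
  also have "\<dots> = (\<integral>\<^sup>+y. 0 \<partial>(\<Pi>\<^sub>M l\<in>J. lborel :: real measure))"
  proof (intro nn_integral_cong)
    fix y assume y: "y \<in> space (\<Pi>\<^sub>M l\<in>J. lborel :: real measure)"
    have "indicator ?A (y(p := t)) = (indicator {c - g y} t :: ennreal)" for t
      using y g(2)[of y t] by (auto simp: indicator_def space_PiM PiE_iff extensional_def)
    then show "(\<integral>\<^sup>+t. indicator ?A (y(p := t)) \<partial>lborel) = 0"
      by simp
  qed
  finally have "emeasure ?M ?A = 0" by simp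
  then show ?thesis using A by (intro AE_I[of _ _ ?A]) auto
qed

definition moment_box :: "nat \<Rightarrow> (nat \<Rightarrow> real) set" where
  "moment_box k = (\<Pi>\<^sub>E l\<in>{0..k}. if l = 0 then {0..1} else {-1..1})"

definition moment_region :: "real \<Rightarrow> nat \<Rightarrow> nat \<Rightarrow> (nat \<Rightarrow> nat) \<Rightarrow> (nat \<Rightarrow> real) set" where
  "moment_region b k n \<kappa> = {x \<in> moment_box k. \<forall>j\<in>{1..n}.
     x 0 - b * (\<Sum>i=1..j. (-1) ^ i * x (\<kappa> i)) \<in> {0..1}}"

definition lattice_box :: "nat \<Rightarrow> nat \<Rightarrow> nat \<Rightarrow> (nat \<Rightarrow> int) set" where
  "lattice_box N \<beta> k = (\<Pi>\<^sub>E l\<in>{0..k}. if l = 0 then {0..<int N} else {- int \<beta>..int \<beta>})"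

definition lattice_region :: "nat \<Rightarrow> nat \<Rightarrow> nat \<Rightarrow> nat \<Rightarrow> (nat \<Rightarrow> nat) \<Rightarrow> (nat \<Rightarrow> int) set" where
  "lattice_region N \<beta> k n \<kappa> = {z \<in> lattice_box N \<beta> k. \<forall>j\<in>{1..n}.
     z 0 - (\<Sum>i=1..j. (-1) ^ i * z (\<kappa> i)) \<in> {0..<int N}}"

text \<open>Up to endpoints, this maps \<open>[0,1]\<close> onto \<open>{0..<N}\<close> and \<open>[-1,1]\<close> onto \<open>{-\<beta>..\<beta>}\<close> with fibres of equal
length. Counting lattice points is then exactly the same as measuring a union of congruent boxes.\<close>

definition discretise :: "nat \<Rightarrow> nat \<Rightarrow> nat \<Rightarrow> real \<Rightarrow> int" where
  "discretise N \<beta> l t = (if l = 0 then \<lfloor>real N * t\<rfloor> else \<lfloor>real (2 * \<beta> + 1) * (t + 1) / 2\<rfloor> - int \<beta>)"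

definition cell :: "nat \<Rightarrow> nat \<Rightarrow> nat \<Rightarrow> int \<Rightarrow> real set" where
  "cell N \<beta> l c = (if l = 0 then {real_of_int c / real N..<real_of_int (c + 1) / real N}
     else {2 * real_of_int (c + int \<beta>) / real (2 * \<beta> + 1) - 1..<2 * real_of_int (c + int \<beta> + 1) / real (2 * \<beta> + 1) - 1})"

lemma cell_iff:
  assumes "N > 0"
  shows "t \<in> cell N \<beta> l c \<longleftrightarrow> discretise N \<beta> l t = c"
proof (cases "l = 0")
  case True
  then show ?thesis using assms
    by (auto simp: cell_def discretise_def floor_eq_iff field_simps)
next
  case False
  have "discretise N \<beta> l t = c \<longleftrightarrow> \<lfloor>real (2 * \<beta> + 1) * (t + 1) / 2\<rfloor> = c + int \<beta>"
    using False by (auto simp: discretise_def)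
  also have "\<dots> \<longleftrightarrow> t \<in> cell N \<beta> l c"
    using False unfolding floor_eq_iff cell_def by (auto simp: field_simps)
  finally show ?thesis by simp
qed

lemma emeasure_cell:
  assumes "N > 0"
  shows "emeasure lborel (cell N \<beta> l c) = ennreal (if l = 0 then 1 / real N else 2 / real (2 * \<beta> + 1))"
proof (cases "l = 0")
  case True
  have "real_of_int (c + 1) / real N - real_of_int c / real N = 1 / real N"
    using assms by (simp add: field_simps)
  moreover have "real_of_int c / real N \<le> real_of_int (c + 1) / real N"
    using assms by (intro divide_right_mono) auto
  ultimately show ?thesis using True by (simp add: cell_def del: of_int_add)
next
  case False
  have "2 * real_of_int (c + int \<beta> + 1) / real (2 * \<beta> + 1) - 1 - (2 * real_of_int (c + int \<beta>) / real (2 * \<beta> + 1) - 1)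
     = 2 / real (2 * \<beta> + 1)"
  proof -
    have "2 * (u + 1) / m - 1 - (2 * u / m - 1) = 2 / m" for u m :: real
      by (simp add: add_divide_distrib ring_distribs)
    from this[of "real_of_int (c + int \<beta>)" "real (2 * \<beta> + 1)"] show ?thesis by simp
  qed
  moreover have "2 * real_of_int (c + int \<beta>) / real (2 * \<beta> + 1) - 1 \<le> 2 * real_of_int (c + int \<beta> + 1) / real (2 * \<beta> + 1) - 1"
    by (intro diff_right_mono divide_right_mono) auto
  ultimately show ?thesis using False by (simp add: cell_def del: of_int_add of_nat_add of_nat_mult)
qed

lemma cell_borel: "cell N \<beta> l c \<in> sets borel"
  by (auto simp: cell_def)

definition cell_union :: "nat \<Rightarrow> nat \<Rightarrow> nat \<Rightarrow> nat \<Rightarrow> (nat \<Rightarrow> nat) \<Rightarrow> (nat \<Rightarrow> real) set" where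
  "cell_union N \<beta> k n \<kappa> = (\<Union>z\<in>lattice_region N \<beta> k n \<kappa>. \<Pi>\<^sub>E l\<in>{0..k}. cell N \<beta> l (z l))"

lemma finite_lattice_region: "finite (lattice_region N \<beta> k n \<kappa>)"
  unfolding lattice_region_def lattice_box_def
  by (intro finite_subset[OF _ finite_PiE[of "{0..k}" "\<lambda>l. if l = 0 then {0..<int N} else {- int \<beta>..int \<beta>}"]]) auto

lemma cell_union_sets: "cell_union N \<beta> k n \<kappa> \<in> sets (\<Pi>\<^sub>M l\<in>{0..k}. lborel)"
  unfolding cell_union_def
  by (intro sets.finite_UN finite_lattice_region sets_PiM_I_finite) (auto simp: cell_borel)

lemma mem_cell_union:
  assumes N: "N > 0" and x: "x \<in> extensional {0..k}"
  shows "x \<in> cell_union N \<beta> k n \<kappa> \<longleftrightarrow> (\<lambda>l\<in>{0..k}. discretise N \<beta> l (x l)) \<in> lattice_region N \<beta> k n \<kappa>"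
proof
  assume "x \<in> cell_union N \<beta> k n \<kappa>"
  then obtain z where z: "z \<in> lattice_region N \<beta> k n \<kappa>" "\<And>l. l \<in> {0..k} \<Longrightarrow> x l \<in> cell N \<beta> l (z l)"
    by (auto simp: cell_union_def PiE_iff)
  have "(\<lambda>l\<in>{0..k}. discretise N \<beta> l (x l)) = z"
    using z cell_iff[OF N] by (intro ext)
      (auto simp: lattice_region_def lattice_box_def PiE_iff extensional_def)
  then show "(\<lambda>l\<in>{0..k}. discretise N \<beta> l (x l)) \<in> lattice_region N \<beta> k n \<kappa>" using z by simp
next
  assume "(\<lambda>l\<in>{0..k}. discretise N \<beta> l (x l)) \<in> lattice_region N \<beta> k n \<kappa>"
  then show "x \<in> cell_union N \<beta> k n \<kappa>"
    unfolding cell_union_def using x cell_iff[OF N]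
    by (intro UN_I[of "\<lambda>l\<in>{0..k}. discretise N \<beta> l (x l)"]) (auto simp: PiE_iff)
qed

text \<open>All boxes have the volume \<open>1 / N * (2 / (2 * \<beta> + 1)) ^ k\<close>.\<close>

lemma measure_cell_union:
  assumes N: "N > 0"
  shows "measure (\<Pi>\<^sub>M l\<in>{0..k}. lborel) (cell_union N \<beta> k n \<kappa>)
     = real (card (lattice_region N \<beta> k n \<kappa>)) * (1 / real N * (2 / real (2 * \<beta> + 1)) ^ k)"
proof -
  let ?M = "\<Pi>\<^sub>M l\<in>{0..k}. lborel :: real measure"
  let ?w = "1 / real N * (2 / real (2 * \<beta> + 1)) ^ k"
  let ?Q = "\<lambda>z. \<Pi>\<^sub>E l\<in>{0..k}. cell N \<beta> l (z l)"
  have w: "emeasure ?M (?Q z) = ennreal ?w" for z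
  proof -
    have "emeasure ?M (?Q z) = (\<Prod>l\<in>{0..k}. emeasure lborel (cell N \<beta> l (z l)))"
      by (intro lborel_family.emeasure_PiM) (auto simp: cell_borel)
    also have "\<dots> = (\<Prod>l\<in>{0..k}. ennreal (if l = 0 then 1 / real N else 2 / real (2 * \<beta> + 1)))"
      using emeasure_cell[OF N] by simp
    also have "\<dots> = ennreal (\<Prod>l\<in>{0..k}. if l = 0 then 1 / real N else 2 / real (2 * \<beta> + 1))"
      by (intro prod_ennreal) auto
    also have "(\<Prod>l\<in>{0..k}. if l = 0 then 1 / real N else 2 / real (2 * \<beta> + 1)) = ?w"
      by (simp add: prod.atLeast_Suc_atMost)
    finally show ?thesis .
  qed
  have disj: "disjoint_family_on ?Q (lattice_region N \<beta> k n \<kappa>)"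
    unfolding disjoint_family_on_def
  proof (intro ballI impI)
    fix y z assume yz: "y \<in> lattice_region N \<beta> k n \<kappa>" "z \<in> lattice_region N \<beta> k n \<kappa>" "y \<noteq> z"
    show "?Q y \<inter> ?Q z = {}"
    proof (rule ccontr)
      assume "?Q y \<inter> ?Q z \<noteq> {}"
      then obtain x where x: "x \<in> ?Q y" "x \<in> ?Q z" by blast
      have "y l = z l" if "l \<in> {0..k}" for l
        using PiE_mem[OF x(1) that] PiE_mem[OF x(2) that] cell_iff[OF N] by metis
      then have "y = z" using yz unfolding lattice_region_def lattice_box_def
        by (intro PiE_ext[of y "{0..k}" _ z]) auto
      with yz show False by simp
    qed
  qed
  have "emeasure ?M (cell_union N \<beta> k n \<kappa>) = (\<Sum>z\<in>lattice_region N \<beta> k n \<kappa>. emeasure ?M (?Q z))"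
    unfolding cell_union_def using disj finite_lattice_region
    by (intro sum_emeasure[symmetric]) (auto intro!: sets_PiM_I_finite cell_borel)
  also have "\<dots> = of_nat (card (lattice_region N \<beta> k n \<kappa>)) * ennreal ?w"
    unfolding w by simp
  also have "\<dots> = ennreal (real (card (lattice_region N \<beta> k n \<kappa>)) * ?w)"
  proof -
    have "of_nat C * ennreal v = ennreal (real C * v)" if "0 \<le> v" for C v
      using that by (simp add: ennreal_mult ennreal_of_nat_eq_real_of_nat)
    then show ?thesis by simp
  qed
  finally show ?thesis by (simp add: measure_def)
qed

lemma moment_region_sets:
  assumes "\<And>i. i \<in> {1..n} \<Longrightarrow> \<kappa> i \<in> {1..k}"
  shows "moment_box k \<in> sets (\<Pi>\<^sub>M l\<in>{0..k}. lborel)"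
    and "moment_region b k n \<kappa> \<in> sets (\<Pi>\<^sub>M l\<in>{0..k}. lborel)"
proof -
  let ?M = "\<Pi>\<^sub>M l\<in>{0..k}. lborel :: real measure"
  show box: "moment_box k \<in> sets ?M"
    unfolding moment_box_def by (intro sets_PiM_I_finite) auto
  have "{x \<in> space ?M. \<forall>j\<in>{1..n}. x 0 - b * (\<Sum>i=1..j. (-1) ^ i * x (\<kappa> i)) \<in> {0..1}} \<in> sets ?M"
  proof (intro sets.sets_Collect_finite_All)
    fix j assume j: "j \<in> {1..n}"
    have \<kappa>m: "(\<lambda>x. x (\<kappa> i)) \<in> borel_measurable ?M" if "i \<in> {1..j}" for i
    proof -
      have "\<kappa> i \<in> {0..k}" using assms[of i] that j by auto
      then show ?thesis by measurable
    qed
    have zm: "(\<lambda>x. x 0) \<in> borel_measurable ?M" by measurable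
    have "(\<lambda>x. x 0 - b * (\<Sum>i=1..j. (-1) ^ i * x (\<kappa> i))) \<in> borel_measurable ?M"
      by (intro borel_measurable_diff borel_measurable_times borel_measurable_sum borel_measurable_const zm \<kappa>m)
    then show "{x \<in> space ?M. x 0 - b * (\<Sum>i=1..j. (-1) ^ i * x (\<kappa> i)) \<in> {0..1}} \<in> sets ?M"
      by measurable
  qed simp
  moreover have "moment_region b k n \<kappa> = moment_box k \<inter>
      {x \<in> space ?M. \<forall>j\<in>{1..n}. x 0 - b * (\<Sum>i=1..j. (-1) ^ i * x (\<kappa> i)) \<in> {0..1}}"
    using sets.sets_into_space[OF box] unfolding moment_region_def by blast
  ultimately show "moment_region b k n \<kappa> \<in> sets ?M" using box by auto
qed

lemma emeasure_moment_box: "emeasure (\<Pi>\<^sub>M l\<in>{0..k}. lborel) (moment_box k) = ennreal (2 ^ k)"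
proof -
  have "emeasure (\<Pi>\<^sub>M l\<in>{0..k}. lborel) (moment_box k)
      = (\<Prod>l\<in>{0..k}. emeasure lborel (if l = 0 then {0..1} else {-1..1::real}))"
    unfolding moment_box_def by (intro lborel_family.emeasure_PiM) auto
  also have "\<dots> = (\<Prod>l\<in>{0..k}. ennreal (if l = 0 then 1 else 2))"
    by (intro prod.cong) auto
  also have "\<dots> = ennreal (\<Prod>l\<in>{0..k}. if l = 0 then 1 else 2)"
    by (intro prod_ennreal) auto
  also have "(\<Prod>l\<in>{0..k}. if l = 0 then 1 else 2 :: real) = 2 ^ k"
    by (simp add: prod.atLeast_Suc_atMost)
  finally show ?thesis .
qed

lemma moment_integral_eq_measure:
  assumes "\<And>i. i \<in> {1..n} \<Longrightarrow> \<kappa> i \<in> {1..k}"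
  shows "(LINT x:moment_box k | (\<Pi>\<^sub>M l\<in>{0..k}. lborel).
      (\<Prod>j=1..n. indicator {0..1} (x 0 - b * (\<Sum>i=1..j. (-1) ^ i * x (\<kappa> i)))))
    = measure (\<Pi>\<^sub>M l\<in>{0..k}. lborel) (moment_region b k n \<kappa>)"
proof -
  let ?M = "\<Pi>\<^sub>M l\<in>{0..k}. lborel :: real measure"
  have ind: "(\<Prod>j=1..n. indicator {0..1} (v j)) = (if \<forall>j\<in>{1..n}. v j \<in> {0..1} then 1 else (0::real))" for v :: "nat \<Rightarrow> real"
  proof (cases "\<forall>j\<in>{1..n}. v j \<in> {0..1}")
    case True
    then have "(\<Prod>j=1..n. indicator {0..1} (v j)) = (\<Prod>j=1..n. (1::real))"
      by (intro prod.cong) auto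
    with True show ?thesis by simp
  next
    case False
    then obtain j where "j \<in> {1..n}" "v j \<notin> {0..1}" by blast
    then have "(\<Prod>j=1..n. indicator {0..1} (v j)) = (0::real)"
      by (intro prod_zero bexI[of _ j]) auto
    with False show ?thesis by simp
  qed
  have pw: "indicator (moment_box k) x *\<^sub>R
        (\<Prod>j=1..n. indicator {0..1} (x 0 - b * (\<Sum>i=1..j. (-1) ^ i * x (\<kappa> i))))
      = (indicator (moment_region b k n \<kappa>) x :: real)" for x
    unfolding ind[of "\<lambda>j. x 0 - b * (\<Sum>i=1..j. (-1) ^ i * x (\<kappa> i))"]
    by (simp add: moment_region_def indicator_def)
  have "(LINT x:moment_box k | ?M.
      (\<Prod>j=1..n. indicator {0..1} (x 0 - b * (\<Sum>i=1..j. (-1) ^ i * x (\<kappa> i)))))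
    = (\<integral>x. (indicator (moment_region b k n \<kappa>) x :: real) \<partial>?M)"
    unfolding set_lebesgue_integral_def pw ..
  also have "\<dots> = measure ?M (moment_region b k n \<kappa>)"
    using sets.sets_into_space[OF moment_region_sets(2)[OF assms, where b=b]] by (simp add: Int_absorb2)
  finally show ?thesis .
qed

lemma floor_over_N_tendsto:
  fixes c :: "nat \<Rightarrow> real"
  assumes "(\<lambda>N. c N / real N) \<longlonglongrightarrow> L"
  shows "(\<lambda>N. real_of_int \<lfloor>c N\<rfloor> / real N) \<longlonglongrightarrow> L"
proof -
  have "(\<lambda>N. real_of_int \<lfloor>c N\<rfloor> / real N - c N / real N) \<longlonglongrightarrow> 0"
  proof (rule Lim_null_comparison)
    show "(\<lambda>N. 1 / real N) \<longlonglongrightarrow> 0" by (rule lim_const_over_n)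
    show "\<forall>\<^sub>F N in sequentially. norm (real_of_int \<lfloor>c N\<rfloor> / real N - c N / real N) \<le> 1 / real N"
    proof (rule always_eventually, rule allI)
      fix N
      have "\<bar>real_of_int \<lfloor>c N\<rfloor> - c N\<bar> \<le> 1" by linarith
      then show "norm (real_of_int \<lfloor>c N\<rfloor> / real N - c N / real N) \<le> 1 / real N"
        by (simp add: divide_right_mono flip: diff_divide_distrib)
    qed
  qed
  from tendsto_add[OF this assms] show ?thesis by simp
qed

text \<open>The factor \<open>b\<close> of the limiting region appears here, as the limit of \<open>(2 * bw N + 1) / (2 * N)\<close>.\<close>

lemma discretise_tendsto:
  fixes bw :: "nat \<Rightarrow> nat"
  assumes bw: "(\<lambda>N. real (bw N) / real N) \<longlonglongrightarrow> b"
  shows "(\<lambda>N. real_of_int (discretise N (bw N) l t) / real N) \<longlonglongrightarrow> (if l = 0 then t else b * t)"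
proof (cases "l = 0")
  case True
  have "(\<lambda>N. real N * t / real N) \<longlonglongrightarrow> t"
  proof (rule tendsto_eventually)
    show "\<forall>\<^sub>F N in sequentially. real N * t / real N = t"
      using eventually_gt_at_top[of 0] by eventually_elim simp
  qed
  from floor_over_N_tendsto[OF this] show ?thesis using True by (simp add: discretise_def)
next
  case False
  have "(\<lambda>N. (2 * (real (bw N) / real N) + 1 / real N) * ((t + 1) / 2)) \<longlonglongrightarrow> (2 * b + 0) * ((t + 1) / 2)"
    by (intro tendsto_intros bw lim_const_over_n)
  then have "(\<lambda>N. (real (2 * bw N + 1) * (t + 1) / 2) / real N) \<longlonglongrightarrow> b * (t + 1)"
    by (simp add: add_divide_distrib algebra_simps)
  from tendsto_diff[OF floor_over_N_tendsto[OF this] bw] show ?thesis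
    using False by (simp add: discretise_def diff_divide_distrib algebra_simps)
qed

lemma discretise_in_box:
  assumes N: "N > 0"
  shows "discretise N \<beta> l t \<in> (if l = 0 then {0..<int N} else {- int \<beta>..int \<beta>}) \<longleftrightarrow>
    (if l = 0 then 0 \<le> t else - 1 \<le> t) \<and> t < 1"
proof (cases "l = 0")
  case True
  have "discretise N \<beta> l t \<in> {0..<int N} \<longleftrightarrow> 0 \<le> real N * t \<and> real N * t < real N"
    using True by (simp add: discretise_def zero_le_floor floor_less_iff)
  also have "\<dots> \<longleftrightarrow> 0 \<le> t \<and> t < 1" using N by (simp add: zero_le_mult_iff)
  finally show ?thesis using True by simp
next
  case False
  let ?m = "real (2 * \<beta> + 1)"
  have "discretise N \<beta> l t \<in> {- int \<beta>..int \<beta>}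
     \<longleftrightarrow> 0 \<le> \<lfloor>?m * (t + 1) / 2\<rfloor> \<and> \<lfloor>?m * (t + 1) / 2\<rfloor> < int (2 * \<beta> + 1)"
    using False by (auto simp: discretise_def)
  also have "\<dots> \<longleftrightarrow> 0 \<le> ?m * (t + 1) / 2 \<and> ?m * (t + 1) / 2 < ?m"
    unfolding zero_le_floor floor_less_iff by simp
  also have "\<dots> \<longleftrightarrow> - 1 \<le> t \<and> t < 1"
  proof -
    have gen: "0 \<le> m * (t + 1) / 2 \<and> m * (t + 1) / 2 < m \<longleftrightarrow> - 1 \<le> t \<and> t < 1" if "m > 0" for m :: real
    proof -
      have "m * (t + 1) / 2 < m \<longleftrightarrow> m * ((t + 1) / 2) < m * 1" by simp
      also have "\<dots> \<longleftrightarrow> (t + 1) / 2 < 1" using that by (rule mult_less_cancel_left_pos)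
      finally show ?thesis using that by (auto simp: zero_le_mult_iff)
    qed
    show ?thesis by (rule gen) simp
  qed
  finally show ?thesis using False by simp
qed

lemma int_quotient_iff:
  assumes "N > 0"
  shows "real_of_int v / real N < 0 \<longleftrightarrow> v < 0" "0 < real_of_int v / real N \<longleftrightarrow> 0 < v"
    "real_of_int v / real N < 1 \<longleftrightarrow> v < int N" "1 < real_of_int v / real N \<longleftrightarrow> int N < v"
  using assms by (auto simp: divide_simps)

text \<open>After division by \<open>N\<close> the heights of the discretised point converge to those of \<open>x\<close>. So membership in the
region is eventually decided by \<open>x\<close>, provided that no height of \<open>x\<close> lies on the boundary of \<open>[0,1]\<close> and
no coordinate is at the right endpoint, where the floor function overshoots.\<close>

lemma cell_union_pointwise:
  fixes bw :: "nat \<Rightarrow> nat"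
  assumes bw: "(\<lambda>N. real (bw N) / real N) \<longlonglongrightarrow> b"
    and \<kappa>: "\<And>i. i \<in> {1..n} \<Longrightarrow> \<kappa> i \<in> {1..k}"
    and x: "x \<in> extensional {0..k}"
    and lt1: "\<And>l. l \<in> {0..k} \<Longrightarrow> x l \<noteq> 1"
    and bd: "\<And>j. j \<in> {1..n} \<Longrightarrow> x 0 - b * (\<Sum>i=1..j. (-1) ^ i * x (\<kappa> i)) \<notin> {0, 1}"
  shows "\<forall>\<^sub>F N in sequentially. x \<in> cell_union N (bw N) k n \<kappa> \<longleftrightarrow> x \<in> moment_region b k n \<kappa>"
proof -
  let ?z = "\<lambda>N. \<lambda>l\<in>{0..k}. discretise N (bw N) l (x l)"
  let ?v = "\<lambda>j. x 0 - b * (\<Sum>i=1..j. (-1) ^ i * x (\<kappa> i))"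
  let ?V = "\<lambda>N j. ?z N 0 - (\<Sum>i=1..j. (-1) ^ i * ?z N (\<kappa> i))"
  have box: "?z N \<in> lattice_box N (bw N) k \<longleftrightarrow> x \<in> moment_box k" if N: "N > 0" for N
  proof -
    have "discretise N (bw N) l (x l) \<in> (if l = 0 then {0..<int N} else {- int (bw N)..int (bw N)})
        \<longleftrightarrow> x l \<in> (if l = 0 then {0..1} else {-1..1})" if "l \<in> {0..k}" for l
      unfolding discretise_in_box[OF N] using lt1[OF that] by auto
    then show ?thesis
      unfolding lattice_box_def moment_box_def PiE_iff using x by simp
  qed
  have lim: "(\<lambda>N. real_of_int (?V N j) / real N) \<longlonglongrightarrow> ?v j" if j: "j \<in> {1..n}" for j
  proof -
    have \<kappa>j: "\<kappa> i \<in> {0..k}" "\<kappa> i \<noteq> 0" if "i \<in> {1..j}" for i using \<kappa>[of i] that j by auto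
    have "(\<lambda>N. real_of_int (discretise N (bw N) 0 (x 0)) / real N
          - (\<Sum>i=1..j. (-1) ^ i * (real_of_int (discretise N (bw N) (\<kappa> i) (x (\<kappa> i))) / real N)))
       \<longlonglongrightarrow> x 0 - (\<Sum>i=1..j. (-1) ^ i * (b * x (\<kappa> i)))"
    proof (intro tendsto_diff tendsto_sum tendsto_mult tendsto_const)
      show "(\<lambda>N. real_of_int (discretise N (bw N) 0 (x 0)) / real N) \<longlonglongrightarrow> x 0"
        using discretise_tendsto[OF bw, of 0 "x 0"] by simp
      show "(\<lambda>N. real_of_int (discretise N (bw N) (\<kappa> i) (x (\<kappa> i))) / real N) \<longlonglongrightarrow> b * x (\<kappa> i)"
        if "i \<in> {1..j}" for i
        using discretise_tendsto[OF bw, of "\<kappa> i" "x (\<kappa> i)"] \<kappa>j[OF that] by simp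
    qed
    moreover have "real_of_int (?V N j) / real N = real_of_int (discretise N (bw N) 0 (x 0)) / real N
          - (\<Sum>i=1..j. (-1) ^ i * (real_of_int (discretise N (bw N) (\<kappa> i) (x (\<kappa> i))) / real N))" for N
    proof -
      have "(\<Sum>i=1..j. (-1) ^ i * ?z N (\<kappa> i)) = (\<Sum>i=1..j. (-1) ^ i * discretise N (bw N) (\<kappa> i) (x (\<kappa> i)))"
        using \<kappa>j by (intro sum.cong) auto
      then show ?thesis by (simp add: diff_divide_distrib sum_divide_distrib)
    qed
    moreover have "(\<Sum>i=1..j. (-1) ^ i * (b * x (\<kappa> i))) = b * (\<Sum>i=1..j. (-1) ^ i * x (\<kappa> i))"
      by (simp add: sum_distrib_left algebra_simps)
    ultimately show ?thesis by simp
  qed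
  have ev: "\<forall>\<^sub>F N in sequentially. \<forall>j\<in>{1..n}. ?V N j \<in> {0..<int N} \<longleftrightarrow> ?v j \<in> {0..1}"
  proof (rule eventually_ball_finite)
    show "\<forall>j\<in>{1..n}. \<forall>\<^sub>F N in sequentially. ?V N j \<in> {0..<int N} \<longleftrightarrow> ?v j \<in> {0..1}"
    proof
      fix j assume j: "j \<in> {1..n}"
      consider "?v j < 0" | "0 < ?v j" "?v j < 1" | "1 < ?v j" using bd[OF j] by fastforce
      then show "\<forall>\<^sub>F N in sequentially. ?V N j \<in> {0..<int N} \<longleftrightarrow> ?v j \<in> {0..1}"
      proof cases
        case 1
        from order_tendstoD(2)[OF lim[OF j] 1] eventually_gt_at_top[of 0] show ?thesis
        proof eventually_elim
          case (elim N)
          then have "?V N j < 0" using int_quotient_iff(1) by blast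
          with 1 show ?case by auto
        qed
      next
        case 2
        from order_tendstoD(1)[OF lim[OF j] 2(1)] order_tendstoD(2)[OF lim[OF j] 2(2)]
          eventually_gt_at_top[of 0] show ?thesis
        proof eventually_elim
          case (elim N)
          then have "0 < ?V N j" "?V N j < int N" using int_quotient_iff(2,3) by blast+
          with 2 show ?case by auto
        qed
      next
        case 3
        from order_tendstoD(1)[OF lim[OF j] 3] eventually_gt_at_top[of 0] show ?thesis
        proof eventually_elim
          case (elim N)
          then have "int N < ?V N j" using int_quotient_iff(4) by blast
          with 3 show ?case by auto
        qed
      qed
    qed
  qed simp
  from ev eventually_gt_at_top[of 0] show ?thesis
  proof eventually_elim
    case (elim N)
    then show ?case
      unfolding mem_cell_union[OF elim(2) x] lattice_region_def moment_region_def
      using box[OF elim(2)] by blast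
  qed
qed

text \<open>Dominated convergence for the indicators of the unions of boxes, all of which lie in the moment box. The
exceptional points form a null set by \<open>AE_PiM_lborel_affine_neq\<close>; for the heights this uses that \<open>x 0\<close> has
coefficient \<open>1\<close> in each of them.\<close>

theorem lattice_region_card_limit:
  fixes bw :: "nat \<Rightarrow> nat"
  assumes bw: "(\<lambda>N. real (bw N) / real N) \<longlonglongrightarrow> b"
    and \<kappa>: "\<And>i. i \<in> {1..n} \<Longrightarrow> \<kappa> i \<in> {1..k}"
  shows "(\<lambda>N. real (card (lattice_region N (bw N) k n \<kappa>)) / real N ^ Suc k)
    \<longlonglongrightarrow> b ^ k * measure (\<Pi>\<^sub>M l\<in>{0..k}. lborel) (moment_region b k n \<kappa>)"
proof -
  let ?M = "\<Pi>\<^sub>M l\<in>{0..k}. lborel :: real measure"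
  let ?S = "\<lambda>N. cell_union N (bw N) k n \<kappa>"
  let ?R = "moment_region b k n \<kappa>"
  note R = moment_region_sets(2)[OF \<kappa>, where b=b] and box = moment_region_sets(1)[OF \<kappa>]
  \<comment> \<open>Points with a coordinate at the right endpoint, and points with a height on the boundary, are negligible.\<close>
  have ae1: "AE x in ?M. \<forall>l\<in>{0..k}. x l \<noteq> 1"
  proof (rule AE_finite_allI)
    fix l assume l: "l \<in> {0..k}"
    have ins: "insert l ({0..k} - {l}) = {0..k}" using l by auto
    have "AE x in (\<Pi>\<^sub>M l\<in>insert l ({0..k} - {l}). lborel). x l + 0 \<noteq> (1::real)"
      by (rule AE_PiM_lborel_affine_neq) auto
    then show "AE x in ?M. x l \<noteq> 1" unfolding ins by simp
  qed simp
  have ae2: "AE x in ?M. \<forall>j\<in>{1..n}. x 0 - b * (\<Sum>i=1..j. (-1) ^ i * x (\<kappa> i)) \<notin> {0, 1}"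
  proof (rule AE_finite_allI)
    fix j assume j: "j \<in> {1..n}"
    have ins: "insert 0 {1..k} = {0..k}" by auto
    have \<kappa>j: "\<kappa> i \<in> {0..k}" "\<kappa> i \<noteq> 0" if "i \<in> {1..j}" for i using \<kappa>[of i] that j by auto
    have "AE x in (\<Pi>\<^sub>M l\<in>insert 0 {1..k}. lborel). x 0 + (- (b * (\<Sum>i=1..j. (-1) ^ i * x (\<kappa> i)))) \<noteq> (c::real)" for c
    proof (rule AE_PiM_lborel_affine_neq)
      have "(\<lambda>x. x (\<kappa> i)) \<in> borel_measurable ?M" if "i \<in> {1..j}" for i
        using \<kappa>j(1)[OF that] by measurable
      then show "(\<lambda>x. - (b * (\<Sum>i=1..j. (-1) ^ i * x (\<kappa> i)))) \<in> borel_measurable (\<Pi>\<^sub>M l\<in>insert 0 {1..k}. lborel)"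
        unfolding ins by (intro borel_measurable_uminus borel_measurable_times borel_measurable_sum) auto
      show "- (b * (\<Sum>i=1..j. (-1) ^ i * (x(0 := t)) (\<kappa> i))) = - (b * (\<Sum>i=1..j. (-1) ^ i * x (\<kappa> i)))" for x :: "nat \<Rightarrow> real" and t
      proof -
        have "(x(0 := t)) (\<kappa> i) = x (\<kappa> i)" if "i \<in> {1..j}" for i using \<kappa>j(2)[OF that] by simp
        then have "(\<Sum>i=1..j. (-1) ^ i * (x(0 := t)) (\<kappa> i)) = (\<Sum>i=1..j. (-1) ^ i * x (\<kappa> i))"
          by (intro sum.cong refl) (simp only:)
        then show ?thesis by (simp only:)
      qed
    qed auto
    from this[of 0] this[of 1] show "AE x in ?M. x 0 - b * (\<Sum>i=1..j. (-1) ^ i * x (\<kappa> i)) \<notin> {0, 1}"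
      unfolding ins by eventually_elim auto
  qed simp
  have sub: "?S N \<subseteq> moment_box k" for N
  proof (cases "N = 0")
    case True
    then have "lattice_region N (bw N) k n \<kappa> = {}"
      by (auto simp: lattice_region_def lattice_box_def PiE_iff)
    then show ?thesis by (simp add: cell_union_def)
  next
    case False
    show ?thesis
    proof
      fix x assume x: "x \<in> ?S N"
      then have ext: "x \<in> extensional {0..k}" by (auto simp: cell_union_def PiE_iff)
      have "(\<lambda>l\<in>{0..k}. discretise N (bw N) l (x l)) \<in> lattice_box N (bw N) k"
        using x False mem_cell_union[OF _ ext] unfolding lattice_region_def by blast
      then have z: "discretise N (bw N) l (x l) \<in> (if l = 0 then {0..<int N} else {- int (bw N)..int (bw N)})"
        if "l \<in> {0..k}" for l
        using that unfolding lattice_box_def PiE_iff by simp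
      have "x l \<in> (if l = 0 then {0..1} else {-1..1})" if l: "l \<in> {0..k}" for l
        using z[OF l] False unfolding discretise_in_box[OF False[unfolded neq0_conv]] by auto
      then show "x \<in> moment_box k" using ext by (auto simp: moment_box_def PiE_iff)
    qed
  qed
  have "(\<lambda>N. \<integral>x. indicator (?S N) x \<partial>?M) \<longlonglongrightarrow> (\<integral>x. (indicator ?R x :: real) \<partial>?M)"
  proof (rule integral_dominated_convergence[where w="indicator (moment_box k)"])
    show "integrable ?M (indicator (moment_box k) :: _ \<Rightarrow> real)"
      using box emeasure_moment_box[of k] by simp
    show "AE x in ?M. (\<lambda>N. indicator (?S N) x :: real) \<longlonglongrightarrow> indicator ?R x"
      using ae1 ae2 AE_space
    proof eventually_elim
      case (elim x)
      have "x \<in> extensional {0..k}" using elim(3) by (auto simp: space_PiM PiE_iff)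
      then have "\<forall>\<^sub>F N in sequentially. x \<in> ?S N \<longleftrightarrow> x \<in> ?R"
        using elim by (intro cell_union_pointwise[OF bw \<kappa>]) auto
      then show ?case
        by (intro tendsto_eventually) (auto elim!: eventually_mono simp: indicator_def)
    qed
    show "AE x in ?M. norm (indicator (?S N) x :: real) \<le> indicator (moment_box k) x" for N
      using sub[of N] by (intro AE_I2) (auto simp: indicator_def)
  qed (use R cell_union_sets in auto)
  moreover have "(\<integral>x. indicator (?S N) x \<partial>?M) = measure ?M (?S N)" for N
    using sets.sets_into_space[OF cell_union_sets[of N "bw N" k n \<kappa>]] by (simp add: Int_absorb2)
  moreover have "(\<integral>x. indicator ?R x \<partial>?M) = measure ?M ?R"
    using sets.sets_into_space[OF R] by (simp add: Int_absorb2)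
  ultimately have lim: "(\<lambda>N. measure ?M (?S N)) \<longlonglongrightarrow> measure ?M ?R" by simp
  have "(\<lambda>N. real (bw N) / real N + (1 / 2) / real N) \<longlonglongrightarrow> b + 0"
    by (intro tendsto_add bw lim_const_over_n)
  from tendsto_mult[OF tendsto_power[OF this, of k] lim]
  have "(\<lambda>N. (real (bw N) / real N + (1 / 2) / real N) ^ k * measure ?M (?S N)) \<longlonglongrightarrow> b ^ k * measure ?M ?R"
    by simp
  moreover have "\<forall>\<^sub>F N in sequentially. (real (bw N) / real N + (1 / 2) / real N) ^ k * measure ?M (?S N)
      = real (card (lattice_region N (bw N) k n \<kappa>)) / real N ^ Suc k"
    using eventually_gt_at_top[of 0]
  proof eventually_elim
    case (elim N)
    let ?m = "real (2 * bw N + 1)"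
    have "real (bw N) / real N + (1 / 2) / real N = ?m / (2 * real N)"
      using elim by (simp add: field_simps)
    moreover have "(?m / (2 * real N)) ^ k * (1 / real N * (2 / ?m) ^ k) = 1 / real N ^ Suc k"
    proof -
      have "(m / (2 * r)) * (2 / m) = 1 / r" if "m > 0" "r > 0" for m r :: real
        using that by (simp add: field_simps)
      from this[of ?m "real N"] have "(?m / (2 * real N)) * (2 / ?m) = 1 / real N" using elim by simp
      then have "((?m / (2 * real N)) * (2 / ?m)) ^ k = (1 / real N) ^ k" by simp
      then show ?thesis by (simp add: power_mult_distrib power_one_over field_simps del: of_nat_add of_nat_mult)
    qed
    ultimately show ?case
      unfolding measure_cell_union[OF elim] mult.left_commute[of _ "real (card _)"]
      by (simp only: times_divide_eq_right mult_1_right)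
  qed
  ultimately show ?thesis by (rule Lim_transform_eventually)
qed

section \<open>The limit law\<close>

lemma card_filter_eq_sum: "finite S \<Longrightarrow> card {x \<in> S. Q x} = (\<Sum>x\<in>S. if Q x then 1 else 0)"
  by (simp add: sum.If_cases Int_def)

text \<open>Words that follow a pairing are automatically closed, so the only condition left is that the walk stays
inside the matrix. Together with the start, the letters of the blocks form a lattice point.\<close>

lemma walks_over_pairing:
  assumes P: "P \<in> opposite_parity_pairings (2 * k)"
  shows "(\<Sum>f | f \<in> {1..2 * k} \<rightarrow>\<^sub>E band \<beta> \<and> constant_on_blocks P f. closed_walks N (2 * k) f)
    = card (lattice_region N \<beta> k (2 * k) (block_index P))"
proof -
  let ?A = "band \<beta>"
  let ?\<Phi> = "\<lambda>y. \<lambda>i\<in>{1..2 * k}. y (block_index P i)"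
  let ?Q = "\<lambda>z. \<forall>j\<in>{1..2 * k}. z 0 - (\<Sum>i=1..j. (-1) ^ i * z (block_index P i)) \<in> {0..<int N}"
  let ?box = "\<lambda>l::nat. if l = 0 then {0..<int N} else band \<beta>"
  have ins: "{0..k} = insert 0 {1..k}" by auto
  have inner: "closed_walks N (2 * k) (?\<Phi> y) = (\<Sum>c\<in>{0..<int N}. if ?Q (y(0 := c)) then 1 else 0)"
    if y: "y \<in> {1..k} \<rightarrow>\<^sub>E ?A" for y
  proof -
    have "?\<Phi> y \<in> {f \<in> {1..2 * k} \<rightarrow>\<^sub>E ?A. constant_on_blocks P f}"
      using bij_betwE[OF constant_on_blocks_bij[OF P, of ?A]] y by blast
    then have cl: "?\<Phi> y \<in> closed_words (2 * k) ?A"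
      using constant_on_blocks_closed(1)[OF P] by blast
    have height: "walk_height c (?\<Phi> y) j = (y(0 := c)) 0 - (\<Sum>i=1..j. (-1) ^ i * (y(0 := c)) (block_index P i))"
      if j: "j \<in> {1..2 * k}" for j c
    proof -
      have "(\<Sum>i=1..j. (-1) ^ i * ?\<Phi> y i) = (\<Sum>i=1..j. (-1) ^ i * (y(0 := c)) (block_index P i))"
      proof (intro sum.cong refl)
        fix i assume "i \<in> {1..j}"
        then have i: "i \<in> {1..2 * k}" using j by auto
        then have "block_index P i \<noteq> 0" using block_index_range[OF P i] by simp
        then show "(-1) ^ i * ?\<Phi> y i = (-1) ^ i * (y(0 := c)) (block_index P i)" using i by simp
      qed
      then show ?thesis by (simp add: walk_height_def)
    qed
    have inside: "walk_inside N c (?\<Phi> y) (2 * k) \<longleftrightarrow> ?Q (y(0 := c))" for c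
      unfolding walk_inside_def using height by (simp del: fun_upd_apply restrict_apply)
    have "closed_walks N (2 * k) (?\<Phi> y) = card {i \<in> {..<N}. ?Q (y(0 := int i))}"
      using closed_walks_even_closed[OF _ cl, of N] inside by simp
    also have "\<dots> = card (int ` {i \<in> {..<N}. ?Q (y(0 := int i))})"
      by (intro card_image[symmetric]) (auto simp: inj_on_def)
    also have "int ` {i \<in> {..<N}. ?Q (y(0 := int i))} = {c \<in> {0..<int N}. ?Q (y(0 := c))}"
    proof (intro equalityI subsetI)
      fix c assume "c \<in> {c \<in> {0..<int N}. ?Q (y(0 := c))}"
      then show "c \<in> int ` {i \<in> {..<N}. ?Q (y(0 := int i))}"
        by (intro image_eqI[of _ _ "nat c"]) (auto simp del: fun_upd_apply)
    qed (auto simp del: fun_upd_apply)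
    also have "card \<dots> = (\<Sum>c\<in>{0..<int N}. if ?Q (y(0 := c)) then 1 else 0)"
      by (rule card_filter_eq_sum) simp
    finally show ?thesis .
  qed
  have "(\<Sum>f | f \<in> {1..2 * k} \<rightarrow>\<^sub>E ?A \<and> constant_on_blocks P f. closed_walks N (2 * k) f)
    = (\<Sum>y\<in>{1..k} \<rightarrow>\<^sub>E ?A. closed_walks N (2 * k) (?\<Phi> y))"
    by (rule sum.reindex_bij_betw[OF constant_on_blocks_bij[OF P], symmetric])
  also have "\<dots> = (\<Sum>y\<in>{1..k} \<rightarrow>\<^sub>E ?A. \<Sum>c\<in>{0..<int N}. if ?Q (y(0 := c)) then 1 else 0)"
    using inner by (rule sum.cong[OF refl])
  also have "\<dots> = (\<Sum>y\<in>PiE {1..k} ?box. \<Sum>c\<in>?box 0. if ?Q (y(0 := c)) then 1 else 0)"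
  proof -
    have "({1..k} \<rightarrow>\<^sub>E ?A) = PiE {1..k} ?box" by (rule PiE_cong) auto
    then show ?thesis by (simp only: if_True simp_thms)
  qed
  also have "\<dots> = (\<Sum>z\<in>PiE {0..k} ?box. if ?Q z then 1 else 0)"
  proof -
    have "0 \<notin> {1..k}" by simp
    from sum_PiE_insert[OF this, where A="?box" and g="\<lambda>z. if ?Q z then 1 else (0::nat)"]
    show ?thesis unfolding ins by (rule sym)
  qed
  also have "\<dots> = card {z \<in> PiE {0..k} ?box. ?Q z}"
    by (rule card_filter_eq_sum[symmetric]) (intro finite_PiE, auto)
  also have "\<dots> = card (lattice_region N \<beta> k (2 * k) (block_index P))"
    unfolding lattice_region_def lattice_box_def ..
  finally show ?thesis .
qed

lemma hankel_band_moment_eq: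
  "hankel_band_moment b k = 1 / (2 - b) ^ k *
     (\<Sum>P\<in>opposite_parity_pairings (2 * k).
        measure (\<Pi>\<^sub>M l\<in>{0..k}. lborel) (moment_region b k (2 * k) (block_index P)))"
  unfolding hankel_band_moment_def moment_box_def[symmetric]
  by (intro arg_cong2[where f="(*)"] sum.cong refl moment_integral_eq_measure block_index_range)

lemma hankel_band_moment_bounds:
  assumes "b \<le> 1"
  shows "0 \<le> hankel_band_moment b k" "hankel_band_moment b k \<le> real (2 * k) ^ k"
proof -
  let ?M = "\<Pi>\<^sub>M l\<in>{0..k}. lborel :: real measure"
  let ?v = "\<lambda>P. measure ?M (moment_region b k (2 * k) (block_index P))"
  have b: "1 \<le> (2 - b) ^ k" using assms by (intro one_le_power) auto
  show "0 \<le> hankel_band_moment b k"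
    unfolding hankel_band_moment_eq using assms by (intro mult_nonneg_nonneg sum_nonneg) auto
  have v: "?v P \<le> 2 ^ k" if P: "P \<in> opposite_parity_pairings (2 * k)" for P
  proof -
    have "?v P \<le> measure ?M (moment_box k)"
    proof (rule measure_mono_fmeasurable)
      show "moment_region b k (2 * k) (block_index P) \<in> sets ?M"
        by (intro moment_region_sets block_index_range[OF P])
      show "moment_box k \<in> fmeasurable ?M"
        using moment_region_sets(1)[of "2 * k" "block_index P" k] block_index_range[OF P]
        by (intro fmeasurableI) (auto simp: emeasure_moment_box)
    qed (auto simp: moment_region_def)
    also have "\<dots> = 2 ^ k" by (simp add: measure_def emeasure_moment_box)
    finally show ?thesis .
  qed
  have "hankel_band_moment b k \<le> 1 * (\<Sum>P\<in>opposite_parity_pairings (2 * k). ?v P)"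
    unfolding hankel_band_moment_eq using b by (intro mult_right_mono sum_nonneg) auto
  also have "\<dots> \<le> (\<Sum>P\<in>opposite_parity_pairings (2 * k). 2 ^ k)"
    unfolding mult_1 by (rule sum_mono) (rule v)
  also have "\<dots> \<le> real (k ^ k) * 2 ^ k"
    using opposite_parity_pairings_card(2)[of k] by (simp flip: of_nat_power)
  also have "\<dots> = real (2 * k) ^ k" by (simp add: power_mult_distrib)
  finally show "hankel_band_moment b k \<le> real (2 * k) ^ k" .
qed

lemma power_le_fact_ratio: "real k ^ j * fact k \<le> fact (k + j)"
proof (induction j)
  case (Suc j)
  have "real k ^ Suc j * fact k = real k * (real k ^ j * fact k)" by simp
  also have "\<dots> \<le> real (Suc (k + j)) * fact (k + j)" using Suc by (intro mult_mono) auto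
  finally show ?case by simp
qed simp

text \<open>The bound \<open>(2 * k) ^ k\<close> on the moment is compared with \<open>k ^ k * fact k \<le> fact (2 * k)\<close>.\<close>

lemma hankel_band_moment_growth:
  assumes "b \<le> 1"
  shows "(\<lambda>k. t ^ (2 * k) * hankel_band_moment b k / fact (2 * k)) \<longlonglongrightarrow> 0"
proof (rule Lim_null_comparison)
  show "(\<lambda>k. (2 * t\<^sup>2) ^ k / fact k) \<longlonglongrightarrow> 0" 
    using summable_LIMSEQ_zero[OF summable_exp[of "2 * t\<^sup>2"]] by (simp add: divide_inverse mult.commute)
  show "\<forall>\<^sub>F k in sequentially. norm (t ^ (2 * k) * hankel_band_moment b k / fact (2 * k)) \<le> (2 * t\<^sup>2) ^ k / fact k"
  proof (intro always_eventually allI)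
    fix k
    note m = hankel_band_moment_bounds[OF assms, of k]
    have kk: "real k ^ k > 0" by (cases "k = 0") auto
    have f: "real k ^ k * fact k \<le> fact (2 * k)" using power_le_fact_ratio[of k k] by (simp add: mult_2)
    have "norm (t ^ (2 * k) * hankel_band_moment b k / fact (2 * k)) = t ^ (2 * k) * hankel_band_moment b k / fact (2 * k)"
      using m by (simp add: abs_mult power_even_abs)
    also have "\<dots> \<le> t ^ (2 * k) * real (2 * k) ^ k / (real k ^ k * fact k)"
      using m f kk by (intro frac_le mult_left_mono) (auto simp: power_mult)
    also have "\<dots> = (2 * t\<^sup>2) ^ k / fact k"
      using kk by (simp add: power_mult power_mult_distrib)
    finally show "norm (t ^ (2 * k) * hankel_band_moment b k / fact (2 * k)) \<le> (2 * t\<^sup>2) ^ k / fact k" .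
  qed
qed

locale hankel_band_ensemble = independent_entries M a for M :: "'w measure" and a +
  fixes b :: real and bw :: "nat \<Rightarrow> nat"
  assumes b_pos: "0 < b" and b_le: "b \<le> 1"
    and bw_less: "\<And>N. 1 \<le> N \<Longrightarrow> bw N < N"
    and bw_lim: "(\<lambda>N. real (bw N) / real N) \<longlonglongrightarrow> b"
begin

definition scaling :: "nat \<Rightarrow> real" where
  "scaling N = 1 / sqrt ((2 - b) * b * real N)"

definition hankel :: "nat \<Rightarrow> 'w \<Rightarrow> real mat" where
  "hankel N \<omega> = scaling N \<cdot>\<^sub>m hankel_band_mat (\<lambda>j. a j \<omega>) (bw N) N"

definition trace_moment :: "nat \<Rightarrow> nat \<Rightarrow> 'w \<Rightarrow> real" where
  "trace_moment n N \<omega> = mat_trace (hankel N \<omega> ^\<^sub>m n) / real N"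

text \<open>The coefficient of a word in the normalised trace. It is at most \<open>scaling N ^ n\<close> in general, and smaller by
a factor \<open>N\<close> for odd \<open>n\<close>, where a closed walk is determined by its word.\<close>

definition weight :: "nat \<Rightarrow> nat \<Rightarrow> (nat \<Rightarrow> int) \<Rightarrow> real" where
  "weight n N f = scaling N ^ n / real N * real (closed_walks N n f)"

lemma trace_moment_eq:
  "trace_moment n N \<omega> = (\<Sum>f\<in>{1..n} \<rightarrow>\<^sub>E band (bw N). weight n N f * word_prod n f \<omega>)"
proof -
  let ?H = "hankel_band_mat (\<lambda>j. a j \<omega>) (bw N) N"
  have "mat_trace (hankel N \<omega> ^\<^sub>m n) = scaling N ^ n * mat_trace (?H ^\<^sub>m n)"
    unfolding hankel_def power_smult_mat[OF hankel_band_mat_carrier]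
    by (rule mat_trace_smult[of _ N]) simp
  then show ?thesis
    unfolding trace_moment_def trace_hankel_power weight_def
    by (simp add: sum_distrib_left sum_divide_distrib mult_ac)
qed

lemma trace_moment_even:
  assumes "even n"
  shows "trace_moment n N \<omega> = (\<Sum>f\<in>closed_words n (band (bw N)). weight n N f * word_prod n f \<omega>)"
  unfolding trace_moment_eq
proof (rule sum.mono_neutral_right)
  show "finite ({1..n} \<rightarrow>\<^sub>E band (bw N))" by (intro finite_PiE) auto
qed (use closed_walks_even[OF assms] in \<open>auto simp: closed_words_def weight_def\<close>)

lemma scale_pos: "0 < (2 - b) * b"
  using b_pos b_le by simp

lemma scaling_nonneg: "0 \<le> scaling N"
  using scale_pos unfolding scaling_def by simp

lemma scaling_even: "scaling N ^ (2 * k) = 1 / ((2 - b) * b * real N) ^ k"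
  using scale_pos by (simp add: scaling_def power_mult power_divide)

lemma letters_le:
  assumes "1 \<le> N"
  shows "real (card (band (bw N))) \<le> 2 * real N"
  using bw_less[OF assms] by simp

text \<open>The normalisation is chosen such that each pair of positions with one free letter contributes a bounded
factor.\<close>

lemma scaled_letters_le:
  assumes "1 \<le> N"
  shows "real (card (band (bw N))) ^ k / ((2 - b) * b * real N) ^ k \<le> (2 / ((2 - b) * b)) ^ k"
proof -
  have "real (card (band (bw N))) / ((2 - b) * b * real N) \<le> 2 * real N / ((2 - b) * b * real N)"
    using letters_le[OF assms] scale_pos assms by (intro divide_right_mono) auto
  also have "\<dots> = 2 / ((2 - b) * b)" using assms by simp
  finally have "(real (card (band (bw N))) / ((2 - b) * b * real N)) ^ k \<le> (2 / ((2 - b) * b)) ^ k"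
    using scale_pos by (intro power_mono) auto
  then show ?thesis by (simp add: power_divide)
qed

text \<open>Two words of length \<open>n\<close> have at most \<open>n\<close> distinct letters, which the normalisation compensates. The two
divisions by \<open>N\<close> are not compensated by starting points, so the second moment is \<open>O(N^-2)\<close>.\<close>

theorem odd_trace_moment_tendsto:
  assumes n: "odd n"
  shows "AE \<omega> in M. (\<lambda>N. trace_moment n N \<omega>) \<longlonglongrightarrow> 0"
proof -
  define K where "K = (1 + 2 * real n * abs_moment (2 * n)) * (2 ^ ((2 * n) * (2 * n)) * 2 ^ (2 * n))"
  have w: "\<bar>weight n N f\<bar> \<le> scaling N ^ n / real N" for N f
  proof -
    have "scaling N ^ n / real N * real (closed_walks N n f) \<le> scaling N ^ n / real N * 1"
      using closed_walks_odd[OF n, of N f] scaling_nonneg by (intro mult_left_mono) auto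
    then show ?thesis using scaling_nonneg by (simp add: weight_def abs_mult)
  qed
  have A: "finite (band \<beta>)" "band \<beta> \<noteq> {}" for \<beta> by auto
  note sm = second_moment[where A="band (bw N)" and w="weight n N" and n=n for N, OF A w, folded trace_moment_eq]
  have bound: "expectation (\<lambda>\<omega>. trace_moment n N \<omega> ^ 2) \<le> (K * (2 / ((2 - b) * b)) ^ n) / (real N)\<^sup>2"
    if N: "1 \<le> N" for N
  proof -
    have "expectation (\<lambda>\<omega>. trace_moment n N \<omega> ^ 2) \<le>
       (scaling N ^ n / real N) ^ 2 * K * real (card (band (bw N))) ^ n"
      using sm(2)[of N] unfolding K_def by (simp only: mult.assoc)
    also have "\<dots> = K / (real N)\<^sup>2 * (real (card (band (bw N))) ^ n / ((2 - b) * b * real N) ^ n)"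
      by (simp add: power_divide scaling_even flip: power_mult) (simp add: mult.commute[of n 2] scaling_even)
    also have "\<dots> \<le> K / (real N)\<^sup>2 * (2 / ((2 - b) * b)) ^ n"
    proof (rule mult_left_mono[OF scaled_letters_le[OF N]])
      have "0 \<le> abs_moment (2 * n)" by (simp add: abs_moment_def)
      then show "0 \<le> K / (real N)\<^sup>2" by (simp add: K_def)
    qed
    finally show ?thesis by simp
  qed
  show ?thesis
    by (rule AE_tendsto_zero_of_inverse_squares[where p=2, OF _ _ sm(1) bound]) auto
qed

text \<open>The starting points compensate the divisions by \<open>N\<close>, and the bound \<open>O(N^-2)\<close> comes from the two letters
lost in linked quadruples. The empty word is excluded because there the exponent \<open>2 * n - 2\<close> would be
truncated.\<close>

theorem even_trace_moment_concentrates: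
  assumes n: "even n" "n \<noteq> 0"
  shows "AE \<omega> in M. (\<lambda>N. trace_moment n N \<omega> - expectation (trace_moment n N)) \<longlonglongrightarrow> 0"
proof -
  define K where "K = fourth_bound n * (2 ^ ((4 * n) * (4 * n)) * 2 ^ (4 * n))"
  let ?F = "\<lambda>N \<omega>. trace_moment n N \<omega> - expectation (trace_moment n N)"
  let ?m = "\<lambda>N. real (card (band (bw N)))"
  have w: "\<bar>weight n N f\<bar> \<le> scaling N ^ n" for N f
  proof -
    have "real (closed_walks N n f) / real N \<le> 1"
      using closed_walks_le[of N n f] by (cases "N = 0") auto
    then have "scaling N ^ n * (real (closed_walks N n f) / real N) \<le> scaling N ^ n * 1"
      using scaling_nonneg by (intro mult_left_mono) auto
    then show ?thesis using scaling_nonneg by (simp add: weight_def abs_mult)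
  qed
  have A: "finite (band \<beta>)" "band \<beta> \<noteq> {}" for \<beta> by auto
  note fm = fourth_central_moment[where A="band (bw N)" and w="weight n N" and n=n for N, OF A w,
      folded trace_moment_even[OF n(1)]]
  have K0: "0 \<le> K" unfolding K_def using centred_words_bound[of n undefined] by simp
  have bound: "expectation (\<lambda>\<omega>. ?F N \<omega> ^ 4) \<le> (K * (2 / ((2 - b) * b)) ^ (2 * n)) / (real N)\<^sup>2"
    if N: "1 \<le> N" for N
  proof -
    have m1: "1 \<le> ?m N" by simp
    have "expectation (\<lambda>\<omega>. ?F N \<omega> ^ 4) \<le> (scaling N ^ n) ^ 4 * K * ?m N ^ (2 * n - 2)"
      using fm(2)[of N] unfolding K_def by (simp only: mult.assoc)
    also have "(scaling N ^ n) ^ 4 = 1 / ((2 - b) * b * real N) ^ (2 * n)"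
      using scaling_even[of N "2 * n"] by (simp add: mult.commute flip: power_mult)
    also have "1 / ((2 - b) * b * real N) ^ (2 * n) * K * ?m N ^ (2 * n - 2) \<le>
       (K * (2 / ((2 - b) * b)) ^ (2 * n)) / (real N)\<^sup>2"
    proof -
      define s where "s = (2 - b) * b"
      have s: "s > 0" using scale_pos by (simp add: s_def)
      have "?m N ^ (2 * n - 2) \<le> (2 * real N) ^ (2 * n - 2)"
        using letters_le[OF N] by (intro power_mono) auto
      also have "\<dots> \<le> 4 * (2 * real N) ^ (2 * n - 2)" by simp
      also have "\<dots> = (2 * real N) ^ (2 * n) / (real N)\<^sup>2"
      proof -
        have "2 * n = (2 * n - 2) + 2" using n by (cases n) auto
        then have "(2 * real N) ^ (2 * n) = (2 * real N) ^ (2 * n - 2) * (2 * real N)\<^sup>2"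
          by (metis power_add)
        then show ?thesis using N by (simp add: power_mult_distrib)
      qed
      finally have "1 / (s * real N) ^ (2 * n) * K * ?m N ^ (2 * n - 2)
          \<le> 1 / (s * real N) ^ (2 * n) * K * ((2 * real N) ^ (2 * n) / (real N)\<^sup>2)"
        using s K0 by (intro mult_left_mono) auto
      also have "\<dots> = (K * (2 / s) ^ (2 * n)) / (real N)\<^sup>2"
        using N s by (simp add: power_divide power_mult_distrib)
      finally show ?thesis unfolding s_def .
    qed
    finally show ?thesis .
  qed
  show ?thesis
    by (rule AE_tendsto_zero_of_inverse_squares[where p=4, OF _ _ fm(1) bound]) auto
qed

definition pairing_walks :: "nat \<Rightarrow> nat \<Rightarrow> nat" where
  "pairing_walks k N = (\<Sum>P\<in>opposite_parity_pairings (2 * k).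
     \<Sum>f | f \<in> {1..2 * k} \<rightarrow>\<^sub>E band (bw N) \<and> constant_on_blocks P f. closed_walks N (2 * k) f)"

lemma pairing_walks_limit:
  "(\<lambda>N. scaling N ^ (2 * k) / real N * real (pairing_walks k N)) \<longlonglongrightarrow> hankel_band_moment b k"
proof -
  let ?s = "(2 - b) * b"
  let ?L = "\<lambda>P N. real (card (lattice_region N (bw N) k (2 * k) (block_index P))) / real N ^ Suc k"
  let ?v = "\<lambda>P. measure (\<Pi>\<^sub>M l\<in>{0..k}. lborel) (moment_region b k (2 * k) (block_index P))"
  have "(\<lambda>N. 1 / ?s ^ k * (\<Sum>P\<in>opposite_parity_pairings (2 * k). ?L P N))
     \<longlonglongrightarrow> 1 / ?s ^ k * (\<Sum>P\<in>opposite_parity_pairings (2 * k). b ^ k * ?v P)"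
    by (intro tendsto_mult tendsto_const tendsto_sum lattice_region_card_limit bw_lim block_index_range)
  moreover have "1 / ?s ^ k * (\<Sum>P\<in>opposite_parity_pairings (2 * k). b ^ k * ?v P) = hankel_band_moment b k"
    unfolding hankel_band_moment_eq using b_pos
    by (simp add: power_mult_distrib flip: sum_distrib_left)
  moreover have "1 / ?s ^ k * (\<Sum>P\<in>opposite_parity_pairings (2 * k). ?L P N)
     = scaling N ^ (2 * k) / real N * real (pairing_walks k N)" for N
  proof -
    have "pairing_walks k N = (\<Sum>P\<in>opposite_parity_pairings (2 * k).
        card (lattice_region N (bw N) k (2 * k) (block_index P)))"
      unfolding pairing_walks_def by (intro sum.cong refl walks_over_pairing)
    then show ?thesis
      unfolding scaling_even by (simp add: power_mult_distrib mult_ac flip: sum_divide_distrib)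
  qed
  ultimately show ?thesis by simp
qed

text \<open>Among closed words, only for degenerate ones does the expectation differ from the number of pairings followed.
The factor on the left replaces a division by the size of the alphabet, which would read \<open>k - 1\<close> in
the exponent on the right and be truncated for \<open>k = 0\<close>.\<close>

lemma expected_words:
  "\<exists>C. \<forall>N\<ge>1. \<bar>(\<Sum>f\<in>{1..2 * k} \<rightarrow>\<^sub>E band (bw N). real (closed_walks N (2 * k) f) * expectation (word_prod (2 * k) f))
      - real (pairing_walks k N)\<bar> * real (card (band (bw N))) \<le> C * real N * real (card (band (bw N))) ^ k"
proof -
  define K where "K = 1 + real (2 * k) * abs_moment (2 * k) + real (k ^ k)"
  define Q :: real where "Q = 2 ^ ((2 * k) * (2 * k)) * 2 ^ (2 * k)"
  show ?thesis
  proof (intro exI allI impI)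
    fix N :: nat assume N: "1 \<le> N"
    let ?A = "band (bw N)"
    let ?W = "{1..2 * k} \<rightarrow>\<^sub>E ?A"
    let ?PP = "opposite_parity_pairings (2 * k)"
    let ?E = "\<lambda>f. expectation (word_prod (2 * k) f)"
    let ?c = "\<lambda>f. card {P \<in> ?PP. constant_on_blocks P f}"
    let ?D = "{f \<in> closed_words (2 * k) ?A. multiplicity_ge_two {1..2 * k} f \<and> \<not> opposite_parity_paired (2 * k) f}"
    have finW: "finite ?W" by (intro finite_PiE) auto
    have finP: "finite ?PP" by (rule opposite_parity_pairings_card)
    have "pairing_walks k N = (\<Sum>P\<in>?PP. \<Sum>f\<in>?W. if constant_on_blocks P f then closed_walks N (2 * k) f else 0)"
      unfolding pairing_walks_def by (intro sum.cong refl sum.inter_filter finW)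
    also have "\<dots> = (\<Sum>f\<in>?W. \<Sum>P\<in>?PP. if constant_on_blocks P f then closed_walks N (2 * k) f else 0)"
      by (rule sum.swap)
    also have "\<dots> = (\<Sum>f\<in>?W. closed_walks N (2 * k) f * ?c f)"
      using finP by (intro sum.cong refl) (simp add: sum.If_cases Int_def)
    finally have pw: "real (pairing_walks k N) = (\<Sum>f\<in>?W. real (closed_walks N (2 * k) f) * real (?c f))" by simp
    have diff: "(\<Sum>f\<in>?W. real (closed_walks N (2 * k) f) * ?E f) - real (pairing_walks k N)
       = (\<Sum>f\<in>?W. real (closed_walks N (2 * k) f) * (?E f - real (?c f)))"
      unfolding pw by (simp add: right_diff_distrib sum_subtractf)
    have zero: "real (closed_walks N (2 * k) f) * (?E f - real (?c f)) = 0" if f: "f \<in> ?W - ?D" for f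
    proof -
      consider "f \<notin> closed_words (2 * k) ?A"
        | "\<not> multiplicity_ge_two {1..2 * k} f"
        | "opposite_parity_paired (2 * k) f"
        using f by blast
      then show ?thesis
      proof cases
        case 1
        then show ?thesis using closed_walks_even[of "2 * k" f ?A N] f by simp
      next
        case 2
        have "{P \<in> ?PP. constant_on_blocks P f} = {}"
          using 2 constant_on_blocks_closed(2)[of _ k f ?A] f by blast
        then have c0: "?c f = 0" by (simp only: card.empty)
        have E0: "?E f = 0" by (rule expectation_words_eq_0[OF 2]) simp
        show ?thesis unfolding c0 E0 by simp
      next
        case 3
        have "?E f = 1"
          using 3 by (intro expectation_paired_letters) (auto simp: opposite_parity_paired_def)
        moreover have "?c f = 1" unfolding unique_pairing_of_paired_word[OF 3] by simp
        ultimately show ?thesis by simp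
      qed
    qed
    have sub: "?D \<subseteq> ?W" by (auto simp: closed_words_def)
    have "(\<Sum>f\<in>?W. real (closed_walks N (2 * k) f) * (?E f - real (?c f)))
        = (\<Sum>f\<in>?D. real (closed_walks N (2 * k) f) * (?E f - real (?c f)))"
      using zero by (intro sum.mono_neutral_right finW sub) blast
    then have "\<bar>(\<Sum>f\<in>?W. real (closed_walks N (2 * k) f) * ?E f) - real (pairing_walks k N)\<bar>
        \<le> (\<Sum>f\<in>?D. \<bar>real (closed_walks N (2 * k) f) * (?E f - real (?c f))\<bar>)"
      unfolding diff by simp
    also have "\<dots> \<le> (\<Sum>f\<in>?D. real N * K)"
    proof (intro sum_mono)
      fix f
      have "\<bar>?E f\<bar> \<le> 1 + real (2 * k) * abs_moment (2 * k)"
        by (rule order_trans[OF integral_abs_bound])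
          (use monomial_bound(2)[of "{1..2 * k}" f] in simp)
      moreover have "?c f \<le> card ?PP" using finP by (intro card_mono) auto
      then have "real (?c f) \<le> real (k ^ k)"
        using opposite_parity_pairings_card(2)[of k] of_nat_mono order_trans by blast
      ultimately have "\<bar>?E f - real (?c f)\<bar> \<le> K"
        using abs_triangle_ineq4[of "?E f" "real (?c f)"] unfolding K_def by linarith
      then show "\<bar>real (closed_walks N (2 * k) f) * (?E f - real (?c f))\<bar> \<le> real N * K"
        using closed_walks_le[of N "2 * k" f] unfolding abs_mult by (intro mult_mono) auto
    qed
    also have "\<dots> = real (card ?D) * (real N * K)" by simp
    finally have le: "\<bar>(\<Sum>f\<in>?W. real (closed_walks N (2 * k) f) * ?E f) - real (pairing_walks k N)\<bar>
        \<le> real (card ?D) * (real N * K)" .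
    have K0: "0 \<le> K" by (simp add: K_def abs_moment_def)
    have D: "real (card ?D) * real (card ?A) \<le> Q * real (card ?A) ^ k"
    proof (cases "k = 0")
      case True
      then have "?D = {}" by (auto simp: opposite_parity_paired_def)
      then have "card ?D = 0" by (simp only: card.empty)
      then show ?thesis by (simp add: Q_def)
    next
      case False
      have A: "finite ?A" "?A \<noteq> {}" by auto
      have "real (card ?D) \<le> Q * real (card ?A) ^ (k - 1)"
        using of_nat_mono[OF card_degenerate_words[OF A, of k], where ?'a = real] unfolding Q_def by simp
      then have "real (card ?D) * real (card ?A) \<le> Q * real (card ?A) ^ (k - 1) * real (card ?A)"
        by (intro mult_right_mono) auto
      also have "\<dots> = Q * real (card ?A) ^ k" using False by (simp add: power_eq_if)
      finally show ?thesis .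
    qed
    have "\<bar>(\<Sum>f\<in>?W. real (closed_walks N (2 * k) f) * ?E f) - real (pairing_walks k N)\<bar> * real (card ?A)
        \<le> real (card ?D) * (real N * K) * real (card ?A)"
      using le by (intro mult_right_mono) auto
    also have "\<dots> = (real (card ?D) * real (card ?A)) * (real N * K)" by (simp only: mult_ac)
    also have "\<dots> \<le> (Q * real (card ?A) ^ k) * (real N * K)"
      using D K0 by (intro mult_right_mono) auto
    also have "\<dots> = (Q * K) * real N * real (card ?A) ^ k" by (simp only: mult_ac)
    finally show "\<bar>(\<Sum>f\<in>?W. real (closed_walks N (2 * k) f) * ?E f) - real (pairing_walks k N)\<bar> * real (card ?A)
        \<le> (Q * K) * real N * real (card ?A) ^ k" .
  qed
qed

text \<open>The words not accounted for by pairings have one free letter less, and the size of the alphabet tends to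
infinity because \<open>b > 0\<close>.\<close>

theorem expected_even_moment_limit:
  "(\<lambda>N. expectation (trace_moment (2 * k) N)) \<longlonglongrightarrow> hankel_band_moment b k"
proof -
  let ?S = "\<lambda>N. \<Sum>f\<in>{1..2 * k} \<rightarrow>\<^sub>E band (bw N). real (closed_walks N (2 * k) f) * expectation (word_prod (2 * k) f)"
  let ?m = "\<lambda>N. real (card (band (bw N)))"
  obtain C where C: "\<And>N. 1 \<le> N \<Longrightarrow> \<bar>?S N - real (pairing_walks k N)\<bar> * ?m N \<le> C * real N * ?m N ^ k"
    using expected_words by blast
  have E: "expectation (trace_moment (2 * k) N) = scaling N ^ (2 * k) / real N * ?S N" for N
  proof -
    have "expectation (trace_moment (2 * k) N)
      = (\<Sum>f\<in>{1..2 * k} \<rightarrow>\<^sub>E band (bw N). weight (2 * k) N f * expectation (word_prod (2 * k) f))"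
      unfolding trace_moment_eq by (rule expectation_linear_combination) (rule monomial_bound, simp)
    then show ?thesis by (simp add: weight_def sum_distrib_left mult.assoc)
  qed
  have m_lim: "(\<lambda>N. 1 / ?m N) \<longlonglongrightarrow> 0"
  proof -
    have "(\<lambda>N. real (bw N) / real N) \<longlonglongrightarrow> b" by (rule bw_lim)
    then have "\<forall>\<^sub>F N in sequentially. b / 2 < real (bw N) / real N"
      using b_pos by (intro order_tendstoD) auto
    then have "\<forall>\<^sub>F N in sequentially. norm (1 / ?m N) \<le> (2 / b) / real N"
      using eventually_gt_at_top[of 0]
    proof eventually_elim
      case (elim N)
      then have "b * real N / 2 \<le> ?m N" by (simp add: field_simps)
      then have "1 / ?m N \<le> 1 / (b * real N / 2)"
        using elim b_pos by (intro divide_left_mono mult_pos_pos) auto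
      then show ?case by simp
    qed
    then show ?thesis by (rule Lim_null_comparison) (rule lim_const_over_n)
  qed
  have "(\<lambda>N. expectation (trace_moment (2 * k) N) - scaling N ^ (2 * k) / real N * real (pairing_walks k N)) \<longlonglongrightarrow> 0"
  proof (rule Lim_null_comparison)
    show "\<forall>\<^sub>F N in sequentially. norm (expectation (trace_moment (2 * k) N) - scaling N ^ (2 * k) / real N * real (pairing_walks k N))
      \<le> \<bar>C\<bar> * (2 / ((2 - b) * b)) ^ k * (1 / ?m N)"
      using eventually_ge_at_top[of 1]
    proof eventually_elim
      case (elim N)
      let ?d = "\<bar>?S N - real (pairing_walks k N)\<bar>"
      have c0: "0 \<le> scaling N ^ (2 * k) / real N" using scaling_nonneg by simp
      have m0: "0 < ?m N" by simp
      have "?d * ?m N \<le> \<bar>C\<bar> * (real N * ?m N ^ k)"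
        using C[OF elim] mult_right_mono[OF abs_ge_self[of C], of "real N * ?m N ^ k"] by (simp add: mult.assoc)
      then have d: "?d \<le> \<bar>C\<bar> * (real N * ?m N ^ k) / ?m N" using m0 by (simp only: pos_le_divide_eq)
      have "norm (expectation (trace_moment (2 * k) N) - scaling N ^ (2 * k) / real N * real (pairing_walks k N))
         = scaling N ^ (2 * k) / real N * ?d"
        unfolding E right_diff_distrib[symmetric] real_norm_def abs_mult using c0 by simp
      also have "\<dots> \<le> scaling N ^ (2 * k) / real N * (\<bar>C\<bar> * (real N * ?m N ^ k) / ?m N)"
        using d c0 by (rule mult_left_mono)
      also have "\<dots> = \<bar>C\<bar> * (?m N ^ k / ((2 - b) * b * real N) ^ k) * (1 / ?m N)"
        using elim by (simp add: scaling_even)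
      also have "\<dots> \<le> \<bar>C\<bar> * (2 / ((2 - b) * b)) ^ k * (1 / ?m N)"
        using scaled_letters_le[OF elim, of k] m0 by (intro mult_right_mono mult_left_mono) auto
      finally show ?case .
    qed
    show "(\<lambda>N. \<bar>C\<bar> * (2 / ((2 - b) * b)) ^ k * (1 / ?m N)) \<longlonglongrightarrow> 0"
      using tendsto_mult[OF tendsto_const m_lim] by simp
  qed
  from tendsto_add[OF this pairing_walks_limit[of k]] show ?thesis by simp
qed

definition limit_moment :: "nat \<Rightarrow> real" where
  "limit_moment n = (if even n then hankel_band_moment b (n div 2) else 0)"

theorem trace_moments_tendsto:
  "AE \<omega> in M. \<forall>n. (\<lambda>N. trace_moment n N \<omega>) \<longlonglongrightarrow> limit_moment n"
  unfolding AE_all_countable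
proof
  fix n
  show "AE \<omega> in M. (\<lambda>N. trace_moment n N \<omega>) \<longlonglongrightarrow> limit_moment n"
  proof (cases "even n")
    case True
    then obtain k where k: "n = 2 * k" by (auto elim: evenE)
    have "AE \<omega> in M. (\<lambda>N. trace_moment n N \<omega> - expectation (trace_moment n N)) \<longlonglongrightarrow> 0"
    proof (cases "n = 0")
      case True
      then have "trace_moment n N \<omega> = expectation (trace_moment n N)" for N \<omega>
        unfolding trace_moment_eq by (simp add: prob_space)
      then show ?thesis by simp
    qed (use even_trace_moment_concentrates True in auto)
    then show ?thesis
    proof eventually_elim
      case (elim \<omega>)
      from tendsto_add[OF elim] expected_even_moment_limit[of k]
      show ?case using k by (fastforce simp: limit_moment_def)
    qed
  next
    case False
    with odd_trace_moment_tendsto[OF False] show ?thesis by (simp add: limit_moment_def)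
  qed
qed

lemma hankel_eigenvalue_distribution:
  assumes "0 < N"
  shows "real_distribution (eigenvalue_distribution (hankel N \<omega>))"
    and "integrable (eigenvalue_distribution (hankel N \<omega>)) (\<lambda>x. x ^ n)"
    and "(\<integral>x. x ^ n \<partial>eigenvalue_distribution (hankel N \<omega>)) = trace_moment n N \<omega>"
proof -
  let ?H = "hankel_band_mat (\<lambda>j. a j \<omega>) (bw N) N"
  have c: "hankel N \<omega> \<in> carrier_mat N N" by (simp add: hankel_def)
  have d: "dim_row ?H = N" "dim_col ?H = N" using hankel_band_mat_carrier carrier_matD by blast+
  have s: "hankel N \<omega> $$ (i, j) = hankel N \<omega> $$ (j, i)" if "i < N" "j < N" for i j
    using that d hankel_band_mat_symmetric[OF that, of "\<lambda>j. a j \<omega>" "bw N"] by (simp add: hankel_def)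
  note e = eigenvalue_distribution_moments[OF c assms s]
  show "real_distribution (eigenvalue_distribution (hankel N \<omega>))"
    "integrable (eigenvalue_distribution (hankel N \<omega>)) (\<lambda>x. x ^ n)"
    "(\<integral>x. x ^ n \<partial>eigenvalue_distribution (hankel N \<omega>)) = trace_moment n N \<omega>"
    using e by (simp_all add: trace_moment_def)
qed

lemma limit_moment_growth: "(\<lambda>k. t ^ (2 * k) * limit_moment (2 * k) / fact (2 * k)) \<longlonglongrightarrow> 0"
  using hankel_band_moment_growth[OF b_le, of t] by (simp add: limit_moment_def)

text \<open>The index is shifted, since for \<open>N = 0\<close> the eigenvalue distribution is not a probability measure.\<close>

lemma weak_limit_at:
  assumes \<omega>: "\<forall>n. (\<lambda>N. trace_moment n N \<omega>) \<longlonglongrightarrow> limit_moment n"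
  obtains \<gamma> where "real_distribution \<gamma>" "\<And>n. integrable \<gamma> (\<lambda>x. x ^ n)"
    "\<And>n. (\<integral>x. x ^ n \<partial>\<gamma>) = limit_moment n"
    "weak_conv_m (\<lambda>N. eigenvalue_distribution (hankel N \<omega>)) \<gamma>"
proof -
  let ?\<mu> = "\<lambda>N. eigenvalue_distribution (hankel (Suc N) \<omega>)"
  obtain \<gamma> where \<gamma>: "real_distribution \<gamma>" "\<And>n. integrable \<gamma> (\<lambda>x. x ^ n)"
    "\<And>n. (\<integral>x. x ^ n \<partial>\<gamma>) = limit_moment n" "weak_conv_m ?\<mu> \<gamma>"
  proof (rule method_of_moments[of ?\<mu> limit_moment])
    show "(\<lambda>N. \<integral>x. x ^ n \<partial>?\<mu> N) \<longlonglongrightarrow> limit_moment n" for n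
      using LIMSEQ_Suc[OF \<omega>[rule_format, of n]] by (simp add: hankel_eigenvalue_distribution)
  qed (use limit_moment_growth in \<open>auto simp: hankel_eigenvalue_distribution\<close>)
  have "weak_conv_m (\<lambda>N. eigenvalue_distribution (hankel N \<omega>)) \<gamma>"
    using \<gamma>(4) unfolding weak_conv_m_def weak_conv_def
    by (auto simp: filterlim_sequentially_Suc[of "\<lambda>N. cdf (eigenvalue_distribution (hankel N \<omega>)) _"])
  with \<gamma> that show ?thesis by blast
qed

lemma limit_moment_determines:
  assumes "real_distribution \<mu>" "\<And>n. integrable \<mu> (\<lambda>x. x ^ n)" "\<And>n. (\<integral>x. x ^ n \<partial>\<mu>) = limit_moment n"
    and "real_distribution \<nu>" "\<And>n. integrable \<nu> (\<lambda>x. x ^ n)" "\<And>n. (\<integral>x. x ^ n \<partial>\<nu>) = limit_moment n"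
  shows "\<mu> = \<nu>"
  by (rule moment_determinacy[OF assms limit_moment_growth])

text \<open>The limit is constructed from a single realisation with convergent moments and is then recognised, by its
moments, as the limit of almost every other one.\<close>

theorem hankel_band_limit_law:
  "\<exists>\<gamma>. symmetric_distribution \<gamma> \<and> has_even_moments \<gamma> (hankel_band_moment b) \<and>
      (\<forall>\<nu>. symmetric_distribution \<nu> \<and> has_even_moments \<nu> (hankel_band_moment b) \<longrightarrow> \<nu> = \<gamma>) \<and>
      (AE \<omega> in M. weak_conv_m (\<lambda>N. eigenvalue_distribution (hankel N \<omega>)) \<gamma>)"
proof -
  have "\<exists>\<omega>. \<forall>n. (\<lambda>N. trace_moment n N \<omega>) \<longlonglongrightarrow> limit_moment n"
    using trace_moments_tendsto by (intro eventually_happens') (auto simp: ae_filter_eq_bot_iff emeasure_space_1)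
  then obtain \<omega>0 where "\<forall>n. (\<lambda>N. trace_moment n N \<omega>0) \<longlonglongrightarrow> limit_moment n" ..
  then obtain \<gamma> where \<gamma>: "real_distribution \<gamma>" "\<And>n. integrable \<gamma> (\<lambda>x. x ^ n)"
    "\<And>n. (\<integral>x. x ^ n \<partial>\<gamma>) = limit_moment n"
    using weak_limit_at by blast
  have sym: "distr \<gamma> borel uminus = \<gamma>"
  proof (rule limit_moment_determines[OF _ _ _ \<gamma>])
    show "real_distribution (distr \<gamma> borel uminus)" by (rule distr_uminus_moment[OF \<gamma>(1,2)])
    show "integrable (distr \<gamma> borel uminus) (\<lambda>x. x ^ n)" for n by (rule distr_uminus_moment[OF \<gamma>(1,2)])
    show "(\<integral>x. x ^ n \<partial>distr \<gamma> borel uminus) = limit_moment n" for n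
      unfolding distr_uminus_moment(3)[OF \<gamma>(1,2)] \<gamma>(3) by (simp add: limit_moment_def)
  qed
  have uniq: "\<nu> = \<gamma>" if \<nu>: "symmetric_distribution \<nu>" "has_even_moments \<nu> (hankel_band_moment b)" for \<nu>
  proof -
    have rd: "real_distribution \<nu>" and sy: "distr \<nu> borel uminus = \<nu>"
      using \<nu>(1) by (auto simp: symmetric_distribution_def)
    interpret \<nu>: real_distribution \<nu> by (rule rd)
    have int: "integrable \<nu> (\<lambda>x. x ^ n)" for n
      by (rule integrable_power_of_even_moment)
        (use \<nu>(2) in \<open>auto simp: has_even_moments_def \<nu>.prob_space_axioms\<close>)
    have mom: "(\<integral>x. x ^ n \<partial>\<nu>) = limit_moment n" for n
    proof (cases "even n")
      case True
      then obtain k where "n = 2 * k" by (auto elim: evenE)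
      then show ?thesis using \<nu>(2) by (simp add: has_even_moments_def limit_moment_def)
    next
      case False
      then have "(\<integral>x. x ^ n \<partial>\<nu>) = - (\<integral>x. x ^ n \<partial>\<nu>)"
        using distr_uminus_moment(3)[OF rd int, of n] unfolding sy by simp
      then show ?thesis using False by (simp add: limit_moment_def)
    qed
    show ?thesis by (rule limit_moment_determines[OF rd int mom \<gamma>])
  qed
  have conv: "AE \<omega> in M. weak_conv_m (\<lambda>N. eigenvalue_distribution (hankel N \<omega>)) \<gamma>"
    using trace_moments_tendsto
  proof eventually_elim
    case (elim \<omega>)
    then obtain \<gamma>' where \<gamma>': "real_distribution \<gamma>'" "\<And>n. integrable \<gamma>' (\<lambda>x. x ^ n)"
      "\<And>n. (\<integral>x. x ^ n \<partial>\<gamma>') = limit_moment n"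
      "weak_conv_m (\<lambda>N. eigenvalue_distribution (hankel N \<omega>)) \<gamma>'"
      using weak_limit_at by blast
    have "\<gamma>' = \<gamma>" by (rule limit_moment_determines[OF \<gamma>'(1,2,3) \<gamma>])
    with \<gamma>'(4) show ?case by simp
  qed
  show ?thesis
  proof (intro exI[of _ \<gamma>] conjI allI impI)
    show "symmetric_distribution \<gamma>" using \<gamma>(1) sym by (simp add: symmetric_distribution_def)
    show "has_even_moments \<gamma> (hankel_band_moment b)"
      using \<gamma> by (simp add: has_even_moments_def limit_moment_def)
    show "\<nu> = \<gamma>" if "symmetric_distribution \<nu> \<and> has_even_moments \<nu> (hankel_band_moment b)" for \<nu>
      using that uniq by blast
  qed (rule conv)
qed

end

theorem theorem2p3:
  fixes M :: "'w measure" and a :: "int \<Rightarrow> 'w \<Rightarrow> real"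
    and b :: real and bw :: "nat \<Rightarrow> nat"
  assumes "0 < b" and "b \<le> 1"
    and "\<And>N. 1 \<le> N \<Longrightarrow> bw N < N"
    and "(\<lambda>N. real (bw N) / real N) \<longlonglongrightarrow> b"
    and "prob_space M"
    and "prob_space.indep_vars M (\<lambda>_. borel) a UNIV"
    and "\<And>j. (\<integral>\<omega>. a j \<omega> \<partial>M) = 0"
    and "\<And>j. (\<integral>\<omega>. \<bar>a j \<omega>\<bar> ^ 2 \<partial>M) = 1"
    and "\<And>k::nat. (SUP j. \<integral>\<^sup>+\<omega>. ennreal (\<bar>a j \<omega>\<bar> ^ k) \<partial>M) < \<infinity>"
  shows "\<exists>\<gamma>. symmetric_distribution \<gamma> \<and>
      has_even_moments \<gamma> (hankel_band_moment b) \<and>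
      (\<forall>\<nu>. symmetric_distribution \<nu> \<and> has_even_moments \<nu> (hankel_band_moment b) \<longrightarrow> \<nu> = \<gamma>) \<and>
      (AE \<omega> in M. weak_conv_m
         (\<lambda>N. eigenvalue_distribution
           ((1 / sqrt ((2 - b) * b * real N)) \<cdot>\<^sub>m hankel_band_mat (\<lambda>j. a j \<omega>) (bw N) N))
         \<gamma>)"
proof -
  interpret prob_space M by fact
  interpret hankel_band_ensemble M a b bw
    by unfold_locales (use assms in auto)
  show ?thesis
    using hankel_band_limit_law unfolding hankel_def scaling_def .
qed

end
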